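(* Let $N\ge 1$ and $p=1+2/N$, and consider the Cauchy problem \[ \partial_t u=\Delta u+|u|^{p-1}u \ \text{ in } \mathbb{R}^N\times(0,T),\qquad u(x,0)=\phi(x)\ \text{ in } \mathbb{R}^N . \] (i) (Existence) If $\phi\in X_q$ for some $q\ge N/2$ ($\phi$ possibly sign-changing), then the problem has a local-in-time mild solution $u(t)$, and there is $C>0$ such that $\|u(t)\|_{\infty}\le C t^{-N/2}(-\log t)^{-q}$ for all sufficiently small $t>0$. In particular, the problem has a local-in-time mild solution for every $\phi\in X_{N/2}$. (ii) (Nonexistence) For each $0\le q<N/2$ there is a nonnegative initial function $\phi_0\in X_q$ (namely, for some $0<\varepsilon<N/2-q$, $\phi_0(x)=|x|^{-N}(-\log|x|)^{-N/2-1+\varepsilon}$ for $|x|<1/e$ and $\phi_0(x)=0$ for $|x|\ge 1/e$) such that the problem with $\phi=\phi_0$ has no local-in-time nonnegative integral solution, and hence no local-in-time nonnegative mild solution.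
   Context: For $\phi\in L^1(\mathbb{R}^N)$, $S(t)[\phi](x):=\int_{\mathbb{R}^N}G_t(x-y)\phi(y)\,dy$ with $G_t(z)=(4\pi t)^{-N/2}e^{-|z|^2/(4t)}$; $\|\cdot\|_r$ is the $L^r(\mathbb{R}^N)$ norm. Let $f(u):=|u|^{p-1}u$ and $\mathcal{F}[u](t):=S(t)\phi+\int_0^t S(t-s)f(u(s))\,ds$. A measurable function $u$ on $\mathbb{R}^N\times(0,T)$ is an integral solution if for some $T>0$, $u(t)=\mathcal{F}[u](t)$ for a.e. $x\in\mathbb{R}^N$ and all $0<t<T$, and $\|u(t)\|_\infty<\infty$ for $0<t<T$. It is a mild solution if it is an integral solution and $u\in C([0,T),L^1(\mathbb{R}^N))$. "Local-in-time" means such a solution exists for some $T>0$. For $0\le q<\infty$, $X_q:=\{\phi\in L^1_{\rm loc}(\mathbb{R}^N): \int_{\mathbb{R}^N}|\phi|[\log(e+|\phi|)]^q\,dx<\infty\}$. *)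

theory Defs
  imports "HOL-Analysis.Analysis"
begin

definition heat_kernel :: "real \<Rightarrow> 'a::euclidean_space \<Rightarrow> real" where
  "heat_kernel t z = (4 * pi * t) powr (- real DIM('a) / 2) * exp (- (norm z)\<^sup>2 / (4 * t))"

definition heat_sg :: "real \<Rightarrow> ('a::euclidean_space \<Rightarrow> real) \<Rightarrow> 'a \<Rightarrow> real" where
  "heat_sg t \<phi> x = (\<integral> y. heat_kernel t (x - y) * \<phi> y \<partial>lebesgue)"

definition fnl :: "real \<Rightarrow> real \<Rightarrow> real" where
  "fnl p v = \<bar>v\<bar> powr (p - 1) * v"

definition duhamel :: "real \<Rightarrow> ('a::euclidean_space \<Rightarrow> real) \<Rightarrow> (real \<Rightarrow> 'a \<Rightarrow> real) \<Rightarrow> real \<Rightarrow> 'a \<Rightarrow> real" where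
  "duhamel p \<phi> u t x = heat_sg t \<phi> x
     + (\<integral> s. indicator {0<..<t} s * heat_sg (t - s) (\<lambda>y. fnl p (u s y)) x \<partial>lebesgue)"

definition Linf_norm :: "('a::euclidean_space \<Rightarrow> real) \<Rightarrow> real" where
  "Linf_norm f = Inf {M. 0 \<le> M \<and> (AE x in lebesgue. \<bar>f x\<bar> \<le> M)}"

definition integral_solution :: "real \<Rightarrow> ('a::euclidean_space \<Rightarrow> real) \<Rightarrow> real \<Rightarrow> (real \<Rightarrow> 'a \<Rightarrow> real) \<Rightarrow> bool" where
  "integral_solution p \<phi> T u \<longleftrightarrow> 0 < T \<and>
     set_borel_measurable lebesgue ({0<..<T} \<times> UNIV) (\<lambda>z::real \<times> 'a. u (fst z) (snd z)) \<and>
     (\<forall>t\<in>{0<..<T}. AE x in lebesgue.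
        integrable lebesgue (\<lambda>y. heat_kernel t (x - y) * \<phi> y) \<and>
        integrable lebesgue (\<lambda>z::real \<times> 'a. indicator {0<..<t} (fst z) *
             heat_kernel (t - fst z) (x - snd z) * fnl p (u (fst z) (snd z))) \<and>
        u t x = duhamel p \<phi> u t x) \<and>
     (\<forall>t\<in>{0<..<T}. \<exists>M. AE x in lebesgue. \<bar>u t x\<bar> \<le> M)"

definition mild_solution :: "real \<Rightarrow> ('a::euclidean_space \<Rightarrow> real) \<Rightarrow> real \<Rightarrow> (real \<Rightarrow> 'a \<Rightarrow> real) \<Rightarrow> bool" where
  "mild_solution p \<phi> T u \<longleftrightarrow> integral_solution p \<phi> T u \<and>
     (\<forall>t\<in>{0..<T}. integrable lebesgue (u t)) \<and>
     (AE x in lebesgue. u 0 x = \<phi> x) \<and>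
     (\<forall>t0\<in>{0..<T}. ((\<lambda>t. \<integral> x. \<bar>u t x - u t0 x\<bar> \<partial>lebesgue) \<longlongrightarrow> 0) (at t0 within {0..<T}))"

definition nonneg_on :: "real \<Rightarrow> (real \<Rightarrow> 'a::euclidean_space \<Rightarrow> real) \<Rightarrow> bool" where
  "nonneg_on T u \<longleftrightarrow> (AE z in (lebesgue :: (real \<times> 'a) measure).
       z \<in> {0<..<T} \<times> UNIV \<longrightarrow> 0 \<le> u (fst z) (snd z))"

definition X_space :: "real \<Rightarrow> ('a::euclidean_space \<Rightarrow> real) set" where
  "X_space q = {\<phi>. \<phi> \<in> borel_measurable lebesgue \<and>
      (\<forall>K. compact K \<longrightarrow> set_integrable lebesgue K \<phi>) \<and>
      integrable lebesgue (\<lambda>x. \<bar>\<phi> x\<bar> * (ln (exp 1 + \<bar>\<phi> x\<bar>)) powr q)}"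

end

(* Existence: with L = -ln t and psi = |phi| ln(e + |phi|)^q, the function
   U(t) = 2 S(t)|phi| + L^(-q) S(t)psi is a supersolution for small t. Splitting |phi| at the level
   s^(-N/4) bounds U(s) by a small power of 1/s plus a multiple of L^(-q) S(s)psi, and since
   s^(N/2) ||S(s)psi||_oo tends to 0, the integral of S(t-s) U(s)^p over 0 < s < t is at most
   U(t)/(2p). Hence the Picard map is a contraction for the norm sup |u|/U.

   Nonexistence: if u(s,y) >= c s^(-N/2) (-ln s)^e on |y| <= sqrt s, then the Duhamel term gives
   u(t,x) >= k t^(-N/2) times the integral over 0 < s < t/2 of s^(-1) (-ln s)^(p e) on |x| <= sqrt t.
   This improves the exponent e to p e + 1, so e + N/2 is multiplied by p. Starting from
   e = -N/2 + epsilon one reaches p e >= -1 after finitely many steps, where the integral diverges. *)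
theory Submission
  imports Defs "HOL-Probability.Distributions" "HOL-Real_Asymp.Real_Asymp"
begin

section \<open>The heat kernel\<close>

text \<open>The exponent is critical because \<open>p - 1 = 2 / N\<close>: a solution of size
  s^(-N/2) has |u|^(p-1) of size 1/s, which just fails to be integrable at 0. The weight ln(e +
  |phi|)^q gains a factor L^(-2q/N) there, and q >= N/2 makes it at most 1/L. The level s^(-N/4)
  serves two purposes: its power 2/N is s^(-1/2), which is integrable, and its logarithm is (N/4) L,
  so cutting there still gains the full L^(-q). What remains is the integral of s^(-1) L^(-q-1),
  equal to L^(-q)/q, so the weight in U reproduces itself. All estimates stay linear in S(s)|phi|
  and S(s)psi, so that S(t-s) S(s) = S(t) disposes of the space variable. The denominator 2p pays
  for the Lipschitz constant p U^(p-1) of the nonlinearity and leaves a contraction factor 1/2.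
  Lebesgue measure on the product is not the product of Lebesgue measures, so data and solutions are
  replaced by Borel representatives before Fubini is applied, and nonnegative integrals are taken in
  \<open>ennreal\<close>, where Tonelli applies without finiteness conditions.\<close>

lemma borel_measurable_heat_kernel [measurable (raw)]:
  fixes g :: "'b \<Rightarrow> 'a::euclidean_space"
  assumes [measurable]: "f \<in> borel_measurable M" "g \<in> borel_measurable M"
  shows "(\<lambda>w. heat_kernel (f w) (g w)) \<in> borel_measurable M"
  unfolding heat_kernel_def by measurable

lemma heat_kernel_nonneg [simp]: "0 \<le> heat_kernel t z"
  by (simp add: heat_kernel_def)

lemma heat_kernel_commute: "heat_kernel t (x - y) = heat_kernel t (y - x)"
  by (simp add: heat_kernel_def norm_minus_commute)

lemma heat_kernel_le:
  fixes z :: "'a::euclidean_space"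
  assumes "0 < t"
  shows "heat_kernel t z \<le> t powr (- real DIM('a) / 2)"
proof -
  have "heat_kernel t z \<le> (4 * pi * t) powr (- real DIM('a) / 2) * 1"
    unfolding heat_kernel_def using assms by (intro mult_left_mono) auto
  also have "\<dots> \<le> t powr (- real DIM('a) / 2)"
  proof -
    have "t \<le> 4 * pi * t" using assms pi_gt3 by simp
    then show ?thesis using assms by (simp add: powr_mono2')
  qed
  finally show ?thesis .
qed

text \<open>The kernel is the product over the coordinates of centred normal densities of variance
  2t, so the integral factorises.\<close>

lemma nn_integral_heat_kernel:
  assumes t: "0 < t"
  shows "(\<integral>\<^sup>+ z. ennreal (heat_kernel t (z::'a::euclidean_space)) \<partial>lborel) = 1"
proof -
  define s where "s = sqrt (2 * t)"
  have s: "s > 0" "s\<^sup>2 = 2 * t" using t by (auto simp: s_def)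
  have 1: "heat_kernel t z = (\<Prod>b\<in>Basis. normal_density 0 s (z \<bullet> b))" for z :: 'a
  proof -
    have a: "normal_density 0 s y = (4 * pi * t) powr (-1/2) * exp (- y\<^sup>2 / (4 * t))" for y
    proof -
      have "(4 * pi * t) powr (-1/2) = 1 / sqrt (4 * pi * t)"
        using t by (simp add: powr_minus powr_half_sqrt divide_simps)
      then show ?thesis
        by (simp add: normal_density_def s algebra_simps)
    qed
    have "(\<Prod>b\<in>Basis. normal_density 0 s (z \<bullet> b)) =
       ((4 * pi * t) powr (-1/2)) ^ DIM('a) * exp (\<Sum>b\<in>Basis. - (z \<bullet> b)\<^sup>2 / (4 * t))"
      by (simp add: a prod.distrib exp_sum)
    also have "((4 * pi * t) powr (-1/2)) ^ DIM('a) = (4 * pi * t) powr (- real DIM('a) / 2)"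
      using t by (simp add: powr_powr flip: powr_realpow)
    also have "(\<Sum>b\<in>Basis. - (z \<bullet> b)\<^sup>2 / (4 * t)) = - (norm z)\<^sup>2 / (4 * t)"
    proof -
      have "(norm z)\<^sup>2 = (\<Sum>b\<in>Basis. (z \<bullet> b)\<^sup>2)"
        unfolding power2_norm_eq_inner by (subst euclidean_inner) (simp add: power2_eq_square)
      then show ?thesis by (simp add: sum_divide_distrib[symmetric] sum_negf)
    qed
    finally show ?thesis by (simp add: heat_kernel_def)
  qed
  have "(\<integral>\<^sup>+ z. ennreal (heat_kernel t (z::'a)) \<partial>lborel) =
      (\<integral>\<^sup>+ z. (\<Prod>b\<in>Basis. ennreal (normal_density 0 s (z \<bullet> b))) \<partial>(lborel::'a measure))"
    by (simp add: 1 prod_ennreal)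
  also have "\<dots> = (\<Prod>b\<in>(Basis::'a set). (\<integral>\<^sup>+x. ennreal (normal_density 0 s x) \<partial>lborel))"
    by (rule nn_integral_lborel_prod) auto
  also have "(\<integral>\<^sup>+x. ennreal (normal_density 0 s x) \<partial>lborel) = 1"
    using s by (subst nn_integral_eq_integral) auto
  finally show ?thesis by simp
qed

lemma nn_integral_lborel_shift:
  fixes f :: "'a::euclidean_space \<Rightarrow> ennreal"
  assumes [measurable]: "f \<in> borel_measurable borel"
  shows "(\<integral>\<^sup>+ y. f (c + y) \<partial>lborel) = (\<integral>\<^sup>+ y. f y \<partial>lborel)"
proof -
  have "(\<integral>\<^sup>+ y. f y \<partial>lborel) = (\<integral>\<^sup>+ y. f y \<partial>distr lborel borel ((+) c))"
    by (simp add: lborel_distr_plus)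
  also have "\<dots> = (\<integral>\<^sup>+ y. f (c + y) \<partial>lborel)"
    by (subst nn_integral_distr) auto
  finally show ?thesis ..
qed

lemma nn_integral_heat_kernel_diff:
  fixes x :: "'a::euclidean_space"
  assumes t: "0 < t"
  shows "(\<integral>\<^sup>+ y. ennreal (heat_kernel t (y - x)) \<partial>lborel) = 1"
    "(\<integral>\<^sup>+ y. ennreal (heat_kernel t (x - y)) \<partial>lborel) = 1"
proof -
  show 1: "(\<integral>\<^sup>+ y. ennreal (heat_kernel t (y - x)) \<partial>lborel) = 1"
    using nn_integral_lborel_shift[of "\<lambda>z. ennreal (heat_kernel t z)" "- x"]
    by (simp add: nn_integral_heat_kernel[OF t])
  then show "(\<integral>\<^sup>+ y. ennreal (heat_kernel t (x - y)) \<partial>lborel) = 1"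
    by (subst heat_kernel_commute)
qed

text \<open>Completing the square: as a function of \<open>y\<close> the product is a Gaussian
  centred at a weighted mean of \<open>x\<close> and \<open>z\<close>. Integrating out
  \<open>y\<close> then gives the Chapman-Kolmogorov identity.\<close>

lemma heat_kernel_mult:
  fixes x y z :: "'a::euclidean_space"
  assumes a: "0 < a" and b: "0 < b"
  shows "heat_kernel a (x - y) * heat_kernel b (y - z) =
    heat_kernel (a + b) (x - z) * heat_kernel (a * b / (a + b)) (y - ((b/(a+b)) *\<^sub>R x + (a/(a+b)) *\<^sub>R z))"
proof -
  define N where "N = - real DIM('a) / 2"
  define m where "m = (b/(a+b)) *\<^sub>R x + (a/(a+b)) *\<^sub>R z"
  have ab: "a + b > 0" using a b by simp
  have 1: "(4 * pi * a) powr N * (4 * pi * b) powr N = (4 * pi * (a + b)) powr N * (4 * pi * (a * b / (a + b))) powr N"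
    
  proof -
    have "(4 * pi * a) * (4 * pi * b) = (4 * pi * (a + b)) * (4 * pi * (a * b / (a + b)))"
      using ab by simp
    then show ?thesis using a b ab by (metis powr_mult)
  qed
  \<comment> \<open>With \<open>y\<close> as origin, equality of the exponents becomes an identity
    between quadratic forms in \<open>X\<close> and \<open>Z\<close>.\<close>
  define X Z where "X = x - y" and "Z = z - y"
  have m: "m - y = (b/(a+b)) *\<^sub>R X + (a/(a+b)) *\<^sub>R Z"
  proof -
    have "y = (b/(a+b)) *\<^sub>R y + (a/(a+b)) *\<^sub>R y"
      using ab by (metis add.commute add_divide_distrib divide_self less_irrefl scaleR_add_left scaleR_one)
    then show ?thesis unfolding m_def X_def Z_def
      by (metis (no_types, lifting) add_diff_add scaleR_diff_right)
  qed
  have 2: "(norm (x - y))\<^sup>2 / (4 * a) + (norm (y - z))\<^sup>2 / (4 * b) =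
     (norm (x - z))\<^sup>2 / (4 * (a + b)) + (norm (y - m))\<^sup>2 / (4 * (a * b / (a + b)))"
  proof -
    have n: "norm (x - y) = norm X" "norm (y - z) = norm Z" "norm (x - z) = norm (X - Z)"
      "norm (y - m) = norm ((b/(a+b)) *\<^sub>R X + (a/(a+b)) *\<^sub>R Z)"
      unfolding m[symmetric] by (simp_all add: X_def Z_def norm_minus_commute)
    have e1: "(norm (X - Z))\<^sup>2 = X \<bullet> X + Z \<bullet> Z - 2 * (X \<bullet> Z)"
      by (simp add: power2_norm_eq_inner inner_diff inner_commute)
    have e2: "(norm ((b/(a+b)) *\<^sub>R X + (a/(a+b)) *\<^sub>R Z))\<^sup>2 =
       (b\<^sup>2 * (X \<bullet> X) + a\<^sup>2 * (Z \<bullet> Z) + 2 * a * b * (X \<bullet> Z)) / (a+b)\<^sup>2"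
    proof -
      have "(norm (c *\<^sub>R X + d *\<^sub>R Z))\<^sup>2 = c\<^sup>2 * (X \<bullet> X) + d\<^sup>2 * (Z \<bullet> Z) + 2 * c * d * (X \<bullet> Z)" for c d
        unfolding power2_norm_eq_inner by (simp add: inner_add inner_commute algebra_simps power2_eq_square)
      then show ?thesis
        by (simp add: power_divide add_divide_distrib) (simp add: power2_eq_square)
    qed
    have e3: "(norm X)\<^sup>2 = X \<bullet> X" "(norm Z)\<^sup>2 = Z \<bullet> Z" by (simp_all add: power2_norm_eq_inner)
    \<comment> \<open>Here \<open>p\<close>, \<open>q\<close>, \<open>r\<close> stand for the inner
      products of \<open>X\<close> with \<open>X\<close>, \<open>Z\<close> with \<open>Z\<close>,
      and \<open>X\<close> with \<open>Z\<close>.\<close>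
    have "p / (4*a) + q / (4*b) = (p + q - 2*r) / (4*(a+b)) + (b\<^sup>2 * p + a\<^sup>2 * q + 2 * a * b * r)/(a+b)\<^sup>2 / (4 * (a * b / (a + b)))"
      for p q r :: real
    proof -
      have h: "(b\<^sup>2 * p + a\<^sup>2 * q + 2 * a * b * r)/(a+b)\<^sup>2 / (4 * (a * b / (a + b)))
         = (b\<^sup>2 * p + a\<^sup>2 * q + 2 * a * b * r)/(4 * (a+b) * a * b)"
        using a b ab by (simp add: power2_eq_square)
      have "(p + q - 2*r) / (4*(a+b)) = (p + q - 2*r) * a * b / (4 * (a+b) * a * b)"
        using a b ab by simp
      moreover have "p / (4*a) = p * b * (a+b) / (4 * (a+b) * a * b)"
        using a b ab by (simp add: frac_eq_eq) (simp add: algebra_simps)?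
      moreover have "q / (4*b) = q * a * (a+b) / (4 * (a+b) * a * b)"
        using a b ab by (simp add: frac_eq_eq) (simp add: algebra_simps)?
      moreover have "p * b * (a+b) + q * a * (a+b) = (p + q - 2*r) * a * b + (b\<^sup>2 * p + a\<^sup>2 * q + 2 * a * b * r)"
        by (simp add: algebra_simps power2_eq_square)
      ultimately show ?thesis unfolding h by (metis add_divide_distrib)
    qed
    then show ?thesis unfolding n e1 e2 e3 .
  qed
  have hk: "heat_kernel t w = (4 * pi * t) powr N * exp (- ((norm w)\<^sup>2 / (4 * t)))" for t and w :: 'a
    by (simp add: heat_kernel_def N_def)
  have "heat_kernel a (x - y) * heat_kernel b (y - z) = ((4 * pi * a) powr N * (4 * pi * b) powr N) *
     exp (- ((norm (x - y))\<^sup>2 / (4 * a) + (norm (y - z))\<^sup>2 / (4 * b)))"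
    unfolding hk by (simp only: minus_add_distrib exp_add mult_ac)
  also have "\<dots> = heat_kernel (a + b) (x - z) * heat_kernel (a * b / (a + b)) (y - m)"
    unfolding 1 2 hk by (simp only: minus_add_distrib exp_add mult_ac)
  finally show ?thesis by (simp add: m_def)
qed

lemma nn_integral_heat_kernel_mult:
  fixes x z :: "'a::euclidean_space"
  assumes a: "0 < a" and b: "0 < b"
  shows "(\<integral>\<^sup>+ y. ennreal (heat_kernel a (x - y)) * ennreal (heat_kernel b (y - z)) \<partial>lborel)
    = ennreal (heat_kernel (a + b) (x - z))"
  using a b
  by (simp add: ennreal_mult[symmetric] heat_kernel_mult)
     (simp add: ennreal_mult nn_integral_cmult nn_integral_heat_kernel_diff)

text \<open>The semigroup on functions with values in [0, infinity]. Monotonicity, additivity and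
  the exchange of integrals hold here for all measurable functions, finite or not.\<close>

definition heat_nn :: "real \<Rightarrow> ('a::euclidean_space \<Rightarrow> ennreal) \<Rightarrow> 'a \<Rightarrow> ennreal" where
  "heat_nn t f x = (\<integral>\<^sup>+ y. ennreal (heat_kernel t (x - y)) * f y \<partial>lborel)"

lemma borel_measurable_heat_nn [measurable (raw)]:
  fixes g :: "'b \<Rightarrow> 'a::euclidean_space"
  assumes [measurable]: "t \<in> borel_measurable M" "g \<in> borel_measurable M"
    "(\<lambda>(w,y). f w y) \<in> borel_measurable (M \<Otimes>\<^sub>M lborel)"
  shows "(\<lambda>w. heat_nn (t w) (f w) (g w)) \<in> borel_measurable M"
  unfolding heat_nn_def by measurable

lemma heat_nn_mono: "(\<And>y. f y \<le> g y) \<Longrightarrow> heat_nn t f x \<le> heat_nn t g x"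
  unfolding heat_nn_def by (intro nn_integral_mono mult_left_mono) auto

lemma heat_nn_cmult:
  assumes [measurable]: "f \<in> borel_measurable borel"
  shows "heat_nn t (\<lambda>y. c * f y) x = c * heat_nn t f x"
  unfolding heat_nn_def by (subst nn_integral_cmult[symmetric]) (auto simp: mult_ac)

lemma heat_nn_add:
  assumes [measurable]: "f \<in> borel_measurable borel" "g \<in> borel_measurable borel"
  shows "heat_nn t (\<lambda>y. f y + g y) x = heat_nn t f x + heat_nn t g x"
  unfolding heat_nn_def by (subst nn_integral_add[symmetric]) (auto simp: distrib_left)

lemma heat_nn_const: "0 < t \<Longrightarrow> heat_nn t (\<lambda>y. c) x = c"
  unfolding heat_nn_def by (subst nn_integral_multc) (auto simp: nn_integral_heat_kernel_diff)

lemma nn_integral_heat_nn: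
  fixes f :: "'a::euclidean_space \<Rightarrow> ennreal"
  assumes [measurable]: "f \<in> borel_measurable borel" and t: "0 < t"
  shows "(\<integral>\<^sup>+ x. heat_nn t f x \<partial>lborel) = (\<integral>\<^sup>+ y. f y \<partial>lborel)"
proof -
  have "(\<integral>\<^sup>+ x. heat_nn t f x \<partial>lborel) =
     (\<integral>\<^sup>+ y. \<integral>\<^sup>+ x. ennreal (heat_kernel t (x - y)) * f y \<partial>lborel \<partial>lborel)"
    unfolding heat_nn_def by (rule lborel_pair.Fubini') measurable
  then show ?thesis
    by (simp add: nn_integral_multc nn_integral_heat_kernel_diff[OF t])
qed

text \<open>The semigroup law. In the supersolution estimate it turns a space-time integral into
  integrals over time alone.\<close>

lemma heat_nn_heat_nn:
  fixes f :: "'a::euclidean_space \<Rightarrow> ennreal"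
  assumes [measurable]: "f \<in> borel_measurable borel" and "0 < a" "0 < b"
  shows "heat_nn a (heat_nn b f) x = heat_nn (a + b) f x"
proof -
  have "heat_nn a (heat_nn b f) x =
     (\<integral>\<^sup>+ y. \<integral>\<^sup>+ z. ennreal (heat_kernel a (x - y)) * (ennreal (heat_kernel b (y - z)) * f z) \<partial>lborel \<partial>lborel)"
    unfolding heat_nn_def by (subst nn_integral_cmult) auto
  also have "\<dots> =
     (\<integral>\<^sup>+ z. \<integral>\<^sup>+ y. ennreal (heat_kernel a (x - y)) * (ennreal (heat_kernel b (y - z)) * f z) \<partial>lborel \<partial>lborel)"
    by (rule lborel_pair.Fubini') measurable
  also have "\<dots> = heat_nn (a + b) f x"
    using assms
    by (simp add: heat_nn_def mult.assoc[symmetric] nn_integral_multc nn_integral_heat_kernel_mult)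
  finally show ?thesis .
qed

section \<open>The heat semigroup on integrable functions\<close>

lemma heat_sg_lborel:
  fixes \<phi> :: "'a::euclidean_space \<Rightarrow> real"
  assumes [measurable]: "\<phi> \<in> borel_measurable borel"
  shows "heat_sg t \<phi> x = (\<integral> y. heat_kernel t (x - y) * \<phi> y \<partial>lborel)"
  unfolding heat_sg_def by (rule integral_completion) measurable

lemma borel_measurable_heat_sg [measurable (raw)]:
  fixes \<phi> :: "'a::euclidean_space \<Rightarrow> real"
  assumes [measurable]: "\<phi> \<in> borel_measurable borel" "t \<in> borel_measurable M" "g \<in> borel_measurable M"
  shows "(\<lambda>w. heat_sg (t w) \<phi> (g w)) \<in> borel_measurable M"
  unfolding heat_sg_lborel[OF assms(1)] by measurable

lemma integrable_heat_kernel_mult: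
  fixes \<phi> :: "'a::euclidean_space \<Rightarrow> real"
  assumes "integrable lborel \<phi>" "0 < t"
  shows "integrable lborel (\<lambda>y. heat_kernel t (x - y) * \<phi> y)"
proof (rule Bochner_Integration.integrable_bound)
  show "integrable lborel (\<lambda>y. t powr (- real DIM('a) / 2) * \<phi> y)" using assms by simp
  show "(\<lambda>y. heat_kernel t (x - y) * \<phi> y) \<in> borel_measurable lborel" using assms by measurable
  show "AE y in lborel. norm (heat_kernel t (x - y) * \<phi> y) \<le> norm (t powr (- real DIM('a) / 2) * \<phi> y)"
    using heat_kernel_le[OF assms(2)] by (intro AE_I2) (auto simp: abs_mult intro!: mult_right_mono)
qed

lemma heat_sg_eq_heat_nn:
  fixes \<phi> :: "'a::euclidean_space \<Rightarrow> real"
  assumes "integrable lborel \<phi>" "0 < t" "\<And>y. 0 \<le> \<phi> y"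
  shows "ennreal (heat_sg t \<phi> x) = heat_nn t (\<lambda>y. ennreal (\<phi> y)) x"
proof -
  have [measurable]: "\<phi> \<in> borel_measurable borel" using assms by auto
  show ?thesis
    unfolding heat_nn_def heat_sg_lborel[OF \<open>\<phi> \<in> borel_measurable borel\<close>]
    using assms
    by (subst nn_integral_eq_integral[symmetric]) (auto intro!: integrable_heat_kernel_mult simp: ennreal_mult)
qed

text \<open>Covers the non-integrable case too, since the Bochner integral then has the default
  value 0.\<close>

lemma ennreal_abs_integral_le:
  "ennreal \<bar>\<integral> z. f z \<partial>M\<bar> \<le> (\<integral>\<^sup>+ z. ennreal \<bar>f z\<bar> \<partial>M)"
proof (cases "integrable M f")
  case True
  then show ?thesis using integral_norm_bound_ennreal[of M f] by simp
next
  case False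
  then show ?thesis by (simp add: not_integrable_integral_eq)
qed

text \<open>Young's inequality in L^1, by Tonelli and translation invariance. It is applied to heat
  kernels and to differences of heat kernels.\<close>

lemma nn_integral_convolution_le:
  fixes k \<phi> :: "'a::euclidean_space \<Rightarrow> real"
  assumes [measurable]: "k \<in> borel_measurable borel" "\<phi> \<in> borel_measurable borel"
  shows "(\<integral>\<^sup>+ x. ennreal \<bar>\<integral> y. k (x - y) * \<phi> y \<partial>lborel\<bar> \<partial>lborel)
    \<le> (\<integral>\<^sup>+ x. ennreal \<bar>k x\<bar> \<partial>lborel) * (\<integral>\<^sup>+ y. ennreal \<bar>\<phi> y\<bar> \<partial>lborel)"
proof -
  have "(\<integral>\<^sup>+ x. ennreal \<bar>\<integral> y. k (x - y) * \<phi> y \<partial>lborel\<bar> \<partial>lborel)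
    \<le> (\<integral>\<^sup>+ x. \<integral>\<^sup>+ y. ennreal \<bar>k (x - y) * \<phi> y\<bar> \<partial>lborel \<partial>lborel)"
    by (intro nn_integral_mono ennreal_abs_integral_le)
  also have "\<dots> = (\<integral>\<^sup>+ y. \<integral>\<^sup>+ x. ennreal \<bar>k (x - y) * \<phi> y\<bar> \<partial>lborel \<partial>lborel)"
    by (rule lborel_pair.Fubini') measurable
  also have "\<dots> = (\<integral>\<^sup>+ y. (\<integral>\<^sup>+ x. ennreal \<bar>k x\<bar> \<partial>lborel) * ennreal \<bar>\<phi> y\<bar> \<partial>lborel)"
  proof (intro nn_integral_cong)
    fix y
    have "(\<integral>\<^sup>+ x. ennreal \<bar>k (x - y)\<bar> \<partial>lborel) = (\<integral>\<^sup>+ x. ennreal \<bar>k x\<bar> \<partial>lborel)"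
      using nn_integral_lborel_shift[of "\<lambda>x. ennreal \<bar>k x\<bar>" "- y"] by simp
    then show "(\<integral>\<^sup>+ x. ennreal \<bar>k (x - y) * \<phi> y\<bar> \<partial>lborel)
       = (\<integral>\<^sup>+ x. ennreal \<bar>k x\<bar> \<partial>lborel) * ennreal \<bar>\<phi> y\<bar>"
      by (simp add: abs_mult ennreal_mult nn_integral_multc)
  qed
  also have "\<dots> = (\<integral>\<^sup>+ x. ennreal \<bar>k x\<bar> \<partial>lborel) * (\<integral>\<^sup>+ y. ennreal \<bar>\<phi> y\<bar> \<partial>lborel)"
    by (simp add: nn_integral_cmult)
  finally show ?thesis .
qed

lemma heat_sg_diff:
  fixes f g :: "'a::euclidean_space \<Rightarrow> real"
  assumes "integrable lborel f" "integrable lborel g" "0 < t"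
  shows "heat_sg t (\<lambda>x. f x - g x) x = heat_sg t f x - heat_sg t g x"
proof -
  have [measurable]: "f \<in> borel_measurable borel" "g \<in> borel_measurable borel" using assms by auto
  show ?thesis
    using assms integrable_heat_kernel_mult[of f t x] integrable_heat_kernel_mult[of g t x]
    by (simp add: heat_sg_lborel right_diff_distrib)
qed

lemma nn_integral_heat_sg_le:
  fixes f :: "'a::euclidean_space \<Rightarrow> real"
  assumes [measurable]: "f \<in> borel_measurable borel" and t: "0 < t"
  shows "(\<integral>\<^sup>+ x. ennreal \<bar>heat_sg t f x\<bar> \<partial>lborel) \<le> (\<integral>\<^sup>+ x. ennreal \<bar>f x\<bar> \<partial>lborel)"
  using nn_integral_convolution_le[of "heat_kernel t" f] t
  by (simp add: heat_sg_lborel nn_integral_heat_kernel)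

lemma integrable_heat_sg:
  fixes f :: "'a::euclidean_space \<Rightarrow> real"
  assumes f: "integrable lborel f" and t: "0 < t"
  shows "integrable lborel (heat_sg t f)"
proof -
  have [measurable]: "f \<in> borel_measurable borel" using f by auto
  have "(\<integral>\<^sup>+ x. ennreal \<bar>f x\<bar> \<partial>lborel) < \<infinity>" using f by (simp add: integrable_iff_bounded)
  then show ?thesis
    using nn_integral_heat_sg_le[of f t] t
    by (auto simp: integrable_iff_bounded intro: le_less_trans)
qed

subsection \<open>Strong continuity at time zero\<close>

text \<open>Strong continuity of the semigroup in L^1 is the statement that this error vanishes as
  the time tends to 0.\<close>

definition heat_err :: "real \<Rightarrow> ('a::euclidean_space \<Rightarrow> real) \<Rightarrow> ennreal" where
  "heat_err t f = (\<integral>\<^sup>+ x. ennreal \<bar>heat_sg t f x - f x\<bar> \<partial>lborel)"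

text \<open>The difference \<open>f - g\<close> enters twice, once directly and once through the
  semigroup, which contracts the L^1 norm; hence the factor 2.\<close>

lemma heat_err_approx:
  fixes f g :: "'a::euclidean_space \<Rightarrow> real"
  assumes f: "integrable lborel f" and g: "integrable lborel g" and t: "0 < t"
  shows "heat_err t f \<le> heat_err t g + 2 * (\<integral>\<^sup>+ x. ennreal \<bar>f x - g x\<bar> \<partial>lborel)"
proof -
  have [measurable]: "f \<in> borel_measurable borel" "g \<in> borel_measurable borel" using f g by auto
  have "heat_err t f \<le> (\<integral>\<^sup>+ x. ennreal \<bar>heat_sg t g x - g x\<bar> +
     (ennreal \<bar>heat_sg t (\<lambda>x. f x - g x) x\<bar> + ennreal \<bar>f x - g x\<bar>) \<partial>lborel)"
    unfolding heat_err_def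
    by (intro nn_integral_mono) (simp add: heat_sg_diff[OF f g t] ennreal_plus[symmetric] del: ennreal_plus)
  also have "\<dots> = heat_err t g + ((\<integral>\<^sup>+ x. ennreal \<bar>heat_sg t (\<lambda>x. f x - g x) x\<bar> \<partial>lborel)
     + (\<integral>\<^sup>+ x. ennreal \<bar>f x - g x\<bar> \<partial>lborel))"
    unfolding heat_err_def by (simp add: nn_integral_add)
  also have "\<dots> \<le> heat_err t g + ((\<integral>\<^sup>+ x. ennreal \<bar>f x - g x\<bar> \<partial>lborel)
     + (\<integral>\<^sup>+ x. ennreal \<bar>f x - g x\<bar> \<partial>lborel))"
    using nn_integral_heat_sg_le[of "\<lambda>x. f x - g x" t] t by (intro add_mono) auto
  finally show ?thesis by (simp add: mult_2)
qed

lemma tendsto_0_ennrealI: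
  assumes "\<And>e::real. 0 < e \<Longrightarrow> eventually (\<lambda>n. f n < ennreal e) F"
  shows "(f \<longlongrightarrow> 0) F"
proof (rule order_tendstoI)
  fix a :: ennreal assume "0 < a"
  then show "eventually (\<lambda>n. f n < a) F"
  proof (cases a)
    case (real r)
    with \<open>0 < a\<close> show ?thesis using assms[of r] by simp
  next
    case top
    have "eventually (\<lambda>n. f n < ennreal 1) F" using assms[of 1] by simp
    then show ?thesis
      unfolding top by (rule eventually_mono) (erule less_trans, rule ennreal_less_top)
  qed
qed auto

text \<open>The functions with vanishing error form an L^1-closed set. This carries the density
  argument below.\<close>

lemma heat_err_tendsto_approx:
  fixes f :: "'a::euclidean_space \<Rightarrow> real"
  assumes f: "integrable lborel f" and \<tau>: "\<And>n::nat. 0 < \<tau> n"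
    and ex: "\<And>e::real. 0 < e \<Longrightarrow> \<exists>g. integrable lborel g \<and> (\<lambda>n. heat_err (\<tau> n) g) \<longlonglongrightarrow> 0 \<and>
        (\<integral>\<^sup>+ x. ennreal \<bar>f x - g x\<bar> \<partial>lborel) \<le> ennreal e"
  shows "(\<lambda>n. heat_err (\<tau> n) f) \<longlonglongrightarrow> 0"
proof (rule tendsto_0_ennrealI)
  fix e :: real assume e: "0 < e"
  obtain g where g: "integrable lborel g" "(\<lambda>n. heat_err (\<tau> n) g) \<longlonglongrightarrow> 0"
    "(\<integral>\<^sup>+ x. ennreal \<bar>f x - g x\<bar> \<partial>lborel) \<le> ennreal (e / 8)"
    using ex[of "e/8"] e by auto
  have "eventually (\<lambda>n. heat_err (\<tau> n) g < ennreal (e/2)) sequentially"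
    using g(2) e by (intro order_tendstoD) auto
  then show "eventually (\<lambda>n. heat_err (\<tau> n) f < ennreal e) sequentially"
  proof eventually_elim
    case (elim n)
    have "heat_err (\<tau> n) f \<le> heat_err (\<tau> n) g + 2 * ennreal (e / 8)"
      using heat_err_approx[OF f g(1) \<tau>[of n]] g(3)
      by (meson add_left_mono mult_left_mono order_trans zero_le)
    also have "\<dots> \<le> ennreal (e/2) + 2 * ennreal (e/8)"
      using elim by (intro add_right_mono) simp
    also have "\<dots> = ennreal (3 * e / 4)"
      using e by (simp add: ennreal_plus[symmetric] ennreal_mult[symmetric] flip: ennreal_numeral del: ennreal_plus)
    also have "\<dots> < ennreal e" using e by (simp add: ennreal_lessI)
    finally show ?case .
  qed
qed

text \<open>Half of the Gaussian exponent yields the decay factor; the other half is, up to 2^(N/2),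
  the kernel at time \<open>2 * t\<close>, which has mass 1.\<close>

lemma nn_integral_heat_kernel_outside_ball:
  fixes x :: "'a::euclidean_space"
  assumes t: "0 < t" and r: "0 \<le> r"
  shows "(\<integral>\<^sup>+ y. ennreal (heat_kernel t (x - y)) * indicator (- ball x r) y \<partial>lborel)
    \<le> ennreal (2 powr (real DIM('a) / 2) * exp (- r\<^sup>2 / (8 * t)))"
proof -
  have "(\<integral>\<^sup>+ y. ennreal (heat_kernel t (x - y)) * indicator (- ball x r) y \<partial>lborel)
    \<le> (\<integral>\<^sup>+ y. ennreal (2 powr (real DIM('a) / 2) * exp (- r\<^sup>2 / (8 * t))) * ennreal (heat_kernel (2 * t) (x - y)) \<partial>lborel)"
  proof (rule nn_integral_mono)
    fix y :: 'a
    have "heat_kernel t (x - y) \<le> 2 powr (real DIM('a) / 2) * exp (- r\<^sup>2 / (8 * t)) * heat_kernel (2 * t) (x - y)"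
      if "r \<le> norm (x - y)"
    proof -
      have a: "(4 * pi * t) powr (- real DIM('a) / 2) = 2 powr (real DIM('a) / 2) * (4 * pi * (2 * t)) powr (- real DIM('a) / 2)"
      proof -
        have "(4 * pi * (2 * t)) powr (- real DIM('a) / 2) = 2 powr (- real DIM('a) / 2) * (4 * pi * t) powr (- real DIM('a) / 2)"
          using t by (subst powr_mult[symmetric]) (auto simp: mult_ac)
        then show ?thesis by (simp add: powr_minus)
      qed
      have "r\<^sup>2 \<le> (norm (x - y))\<^sup>2" using that r by (intro power_mono) auto
      then have "exp (- (norm (x - y))\<^sup>2 / (4 * t)) \<le> exp (- r\<^sup>2 / (8 * t)) * exp (- (norm (x - y))\<^sup>2 / (4 * (2 * t)))"
        using t by (simp add: mult_exp_exp field_simps)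
      then show ?thesis
        unfolding heat_kernel_def a
        using mult_left_mono[of "exp (- (norm (x - y))\<^sup>2 / (4 * t))" "exp (- r\<^sup>2 / (8 * t)) * exp (- (norm (x - y))\<^sup>2 / (4 * (2 * t)))"
          "2 powr (real DIM('a) / 2) * (4 * pi * (2 * t)) powr (- real DIM('a) / 2)"]
        by (simp add: mult.assoc mult.left_commute)
    qed
    then show "ennreal (heat_kernel t (x - y)) * indicator (- ball x r) y \<le>
      ennreal (2 powr (real DIM('a) / 2) * exp (- r\<^sup>2 / (8 * t))) * ennreal (heat_kernel (2 * t) (x - y))"
      by (auto simp: indicator_def dist_norm ennreal_mult[symmetric] intro!: ennreal_leI)
  qed
  also have "\<dots> = ennreal (2 powr (real DIM('a) / 2) * exp (- r\<^sup>2 / (8 * t)))"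
    using t by (simp add: nn_integral_cmult nn_integral_heat_kernel_diff)
  finally show ?thesis .
qed

lemma heat_nn_indicator_open_tendsto:
  fixes U :: "'a::euclidean_space set"
  assumes U: "open U" "x \<in> U" and \<tau>: "\<And>n::nat. 0 < \<tau> n" "\<tau> \<longlonglongrightarrow> 0"
  shows "(\<lambda>n. 1 - heat_nn (\<tau> n) (indicator U) x) \<longlonglongrightarrow> 0"
proof -
  have [measurable]: "U \<in> sets borel" using U by auto
  obtain r where r: "r > 0" "ball x r \<subseteq> U" using U open_contains_ball by blast
  have le: "1 - heat_nn (\<tau> n) (indicator U) x \<le> ennreal (2 powr (real DIM('a) / 2) * exp (- r\<^sup>2 / (8 * \<tau> n)))" for n
  proof -
    have "1 = (\<integral>\<^sup>+ y. ennreal (heat_kernel (\<tau> n) (x - y)) \<partial>lborel)"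
      using \<tau> by (simp add: nn_integral_heat_kernel_diff)
    also have "\<dots> \<le> (\<integral>\<^sup>+ y. ennreal (heat_kernel (\<tau> n) (x - y)) * indicator U y
        + ennreal (heat_kernel (\<tau> n) (x - y)) * indicator (- ball x r) y \<partial>lborel)"
      using r by (intro nn_integral_mono) (auto simp: indicator_def)
    also have "\<dots> = heat_nn (\<tau> n) (indicator U) x + (\<integral>\<^sup>+ y. ennreal (heat_kernel (\<tau> n) (x - y)) * indicator (- ball x r) y \<partial>lborel)"
      by (simp add: nn_integral_add heat_nn_def)
    also have "\<dots> \<le> heat_nn (\<tau> n) (indicator U) x + ennreal (2 powr (real DIM('a) / 2) * exp (- r\<^sup>2 / (8 * \<tau> n)))"
      using r \<tau> by (intro add_left_mono nn_integral_heat_kernel_outside_ball) auto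
    finally show ?thesis by (simp add: ennreal_minus_le_iff)
  qed
  have "(\<lambda>n. 2 powr (real DIM('a) / 2) * exp (- r\<^sup>2 / (8 * \<tau> n))) \<longlonglongrightarrow> 2 powr (real DIM('a) / 2) * 0"
  proof (intro tendsto_mult tendsto_const)
    have "filterlim \<tau> (at_right 0) sequentially"
      using \<tau> by (intro tendsto_imp_filterlim_at_right) auto
    moreover have "((\<lambda>s. exp (- r\<^sup>2 / (8 * s))) \<longlongrightarrow> 0) (at_right 0)"
      using r(1) by real_asymp
    ultimately show "(\<lambda>n. exp (- r\<^sup>2 / (8 * \<tau> n))) \<longlonglongrightarrow> 0" by (rule filterlim_compose[rotated])
  qed
  from tendsto_ennrealI[OF this]
  have lim: "(\<lambda>n. ennreal (2 powr (real DIM('a) / 2) * exp (- r\<^sup>2 / (8 * \<tau> n)))) \<longlonglongrightarrow> 0"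
    by (simp only: mult_zero_right ennreal_0)
  show ?thesis
    by (rule tendsto_sandwich[OF always_eventually[OF allI[OF zero_le]] always_eventually[OF allI[OF le]] tendsto_const lim])
qed

text \<open>The flow preserves mass, so what leaves \<open>U\<close> equals what arrives outside
  \<open>U\<close>, and the error is twice the loss inside. Pointwise convergence is therefore used
  at points of \<open>U\<close> alone; the boundary of an open set may have positive
  measure.\<close>

lemma heat_err_indicator_open:
  fixes U :: "'a::euclidean_space set"
  assumes U: "open U" "emeasure lborel U < \<infinity>" and \<tau>: "\<And>n::nat. 0 < \<tau> n" "\<tau> \<longlonglongrightarrow> 0"
  shows "(\<lambda>n. heat_err (\<tau> n) (indicator U)) \<longlonglongrightarrow> 0"
proof -
  have [measurable]: "U \<in> sets borel" using U by auto
  have int: "integrable lborel (indicator U :: 'a \<Rightarrow> real)" using U by (simp add: integrable_real_indicator)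
  define h where "h n = heat_nn (\<tau> n) (indicator U :: 'a \<Rightarrow> ennreal)" for n
  have [measurable]: "h n \<in> borel_measurable borel" for n unfolding h_def by measurable
  have h_eq: "ennreal (heat_sg (\<tau> n) (indicator U) x) = h n x" for n x
    using heat_sg_eq_heat_nn[OF int \<tau>(1), of n x] by (simp add: h_def ennreal_indicator)
  have h_le: "h n x \<le> 1" for n x
  proof -
    have "h n x \<le> heat_nn (\<tau> n) (\<lambda>y. 1) x" unfolding h_def by (rule heat_nn_mono) (simp add: indicator_def)
    then show ?thesis by (simp add: heat_nn_const \<tau>)
  qed
  have sg0: "0 \<le> heat_sg (\<tau> n) (indicator U) x" for n x
    by (subst heat_sg_lborel) (auto intro!: integral_nonneg_AE)
  have sg1: "heat_sg (\<tau> n) (indicator U) x \<le> 1" for n x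
    using h_le[of n x] unfolding h_eq[symmetric] by (simp add: ennreal_le_1)
  have h_int: "(\<integral>\<^sup>+ x. h n x \<partial>lborel) = emeasure lborel U" for n
    unfolding h_def by (simp add: nn_integral_heat_nn \<tau>)
  \<comment> \<open>The loss of mass inside \<open>U\<close>; it vanishes by dominated convergence
    with majorant the indicator of \<open>U\<close>.\<close>
  define d where "d n = (\<integral>\<^sup>+ x. (1 - h n x) * indicator U x \<partial>lborel)" for n
  have "d \<longlonglongrightarrow> (\<integral>\<^sup>+ x. (0::ennreal) \<partial>(lborel :: 'a measure))"
    unfolding d_def
  proof (rule nn_integral_dominated_convergence)
    show "(\<integral>\<^sup>+ x. indicator U x \<partial>lborel) < \<infinity>" using U by simp
    show "AE x in lborel. (1 - h j x) * indicator U x \<le> indicator U x" for j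
      by (intro AE_I2) (auto simp: indicator_def)
    show "AE x in lborel. (\<lambda>i. (1 - h i x) * indicator U x) \<longlonglongrightarrow> 0"
      using heat_nn_indicator_open_tendsto[OF U(1) _ \<tau>] by (intro AE_I2) (auto simp: indicator_def h_def)
  qed measurable
  then have d: "d \<longlonglongrightarrow> 0" by simp
  have "heat_err (\<tau> n) (indicator U) = d n + d n" for n
  proof -
    define c where "c = (\<integral>\<^sup>+ x. h n x * indicator U x \<partial>lborel)"
    define b where "b = (\<integral>\<^sup>+ x. h n x * indicator (- U) x \<partial>lborel)"
    have "b + c = emeasure lborel U"
      unfolding b_def c_def h_int[of n, symmetric]
      by (subst nn_integral_add[symmetric]) (auto intro!: nn_integral_cong simp: indicator_def)
    moreover have "d n + c = emeasure lborel U"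
    proof -
      have "d n + c = (\<integral>\<^sup>+ x. indicator U x \<partial>lborel)"
        unfolding d_def c_def
        by (subst nn_integral_add[symmetric])
           (auto intro!: nn_integral_cong simp: h_le distrib_right[symmetric] diff_add_self_ennreal)
      then show ?thesis by simp
    qed
    moreover have "c \<noteq> \<infinity>"
      using \<open>d n + c = emeasure lborel U\<close> U by auto
    ultimately have "b = d n"
      using ennreal_add_left_cancel[of c b "d n"] by (simp add: add.commute)
    moreover have "heat_err (\<tau> n) (indicator U) = d n + b"
    proof -
      have "heat_err (\<tau> n) (indicator U) = (\<integral>\<^sup>+ x. (1 - h n x) * indicator U x + h n x * indicator (- U) x \<partial>lborel)"
        unfolding heat_err_def
      proof (intro nn_integral_cong)
        fix x :: 'a
        have "1 - h n x = ennreal (1 - heat_sg (\<tau> n) (indicator U) x)"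
          using ennreal_minus[OF sg0, of 1 n x] by (simp add: h_eq)
        then show "ennreal \<bar>heat_sg (\<tau> n) (indicator U) x - indicator U x\<bar> =
            (1 - h n x) * indicator U x + h n x * indicator (- U) x"
          using sg0[of n x] sg1[of n x] by (cases "x \<in> U") (simp_all add: h_eq)
      qed
      also have "\<dots> = d n + b" unfolding d_def b_def by (rule nn_integral_add) measurable
      finally show ?thesis .
    qed
    ultimately show ?thesis by simp
  qed
  then show ?thesis using tendsto_add[OF d d] by simp
qed

text \<open>Induction over integrable functions. Indicators of measurable sets are reached from open
  sets by outer regularity, and limits by the closedness of the set of good functions.\<close>

theorem heat_err_tendsto_0:
  fixes f :: "'a::euclidean_space \<Rightarrow> real"
  assumes f: "integrable lborel f" and \<tau>: "\<And>n::nat. 0 < \<tau> n" "\<tau> \<longlonglongrightarrow> 0"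
  shows "(\<lambda>n. heat_err (\<tau> n) f) \<longlonglongrightarrow> 0"
  using f
proof (induction rule: integrable_induct)
  case (base A c)
  have [measurable]: "A \<in> sets borel" using base by simp
  have intA: "integrable lborel (indicator A :: 'a \<Rightarrow> real)" using base by (simp add: integrable_real_indicator)
  have "(\<lambda>n. heat_err (\<tau> n) (indicator A)) \<longlonglongrightarrow> 0"
  proof (rule heat_err_tendsto_approx[OF intA \<tau>(1)])
    fix e :: real assume "0 < e"
    then obtain U where U: "open U" "A \<subseteq> U" "emeasure lborel (U - A) < e"
      using outer_regular_lborel[of A e] by auto
    have [measurable]: "U \<in> sets borel" using U by auto
    have "emeasure lborel U = emeasure lborel A + emeasure lborel (U - A)"
      using U(2) by (subst plus_emeasure) (auto simp: Un_absorb1)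
    also have "\<dots> < \<infinity>" using less_trans[OF U(3) ennreal_less_top] base by simp
    finally have fin: "emeasure lborel U < \<infinity>" .
    show "\<exists>g. integrable lborel g \<and> (\<lambda>n. heat_err (\<tau> n) g) \<longlonglongrightarrow> 0 \<and>
        (\<integral>\<^sup>+ x. ennreal \<bar>indicator A x - g x\<bar> \<partial>lborel) \<le> ennreal e"
    proof (intro exI[of _ "indicator U"] conjI)
      show "integrable lborel (indicator U :: 'a \<Rightarrow> real)" using fin by (simp add: integrable_real_indicator)
      show "(\<lambda>n. heat_err (\<tau> n) (indicator U)) \<longlonglongrightarrow> 0"
        by (rule heat_err_indicator_open[OF U(1) fin \<tau>])
      have "(\<integral>\<^sup>+ x. ennreal \<bar>indicator A x - indicator U x\<bar> \<partial>lborel) = (\<integral>\<^sup>+ x. indicator (U - A) x \<partial>lborel)"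
        using U by (intro nn_integral_cong) (auto simp: indicator_def)
      then show "(\<integral>\<^sup>+ x. ennreal \<bar>indicator A x - indicator U x\<bar> \<partial>lborel) \<le> ennreal e"
        using U by simp
    qed
  qed
  then have "(\<lambda>n. ennreal \<bar>c\<bar> * heat_err (\<tau> n) (indicator A)) \<longlonglongrightarrow> ennreal \<bar>c\<bar> * 0"
    by (intro ennreal_tendsto_cmult) auto
  moreover have "heat_err (\<tau> n) (\<lambda>x. indicator A x *\<^sub>R c) = ennreal \<bar>c\<bar> * heat_err (\<tau> n) (indicator A)" for n
  proof -
    have "heat_sg (\<tau> n) (\<lambda>x. indicator A x *\<^sub>R c) x - indicator A x *\<^sub>R c
       = c * (heat_sg (\<tau> n) (indicator A) x - indicator A x)" for x
      by (simp add: heat_sg_lborel mult.assoc[symmetric]) (simp add: algebra_simps)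
    then show ?thesis
      unfolding heat_err_def by (subst nn_integral_cmult[symmetric]) (auto simp: abs_mult ennreal_mult)
  qed
  ultimately show ?case by simp
next
  case (add f g)
  have [measurable]: "f \<in> borel_measurable borel" "g \<in> borel_measurable borel" using add by auto
  have lim: "(\<lambda>n. heat_err (\<tau> n) f + heat_err (\<tau> n) g) \<longlonglongrightarrow> 0"
    using tendsto_add[OF add.IH] by simp
  have le: "heat_err (\<tau> n) (\<lambda>x. f x + g x) \<le> heat_err (\<tau> n) f + heat_err (\<tau> n) g" for n
  proof -
    have "heat_sg (\<tau> n) (\<lambda>x. f x + g x) x = heat_sg (\<tau> n) f x + heat_sg (\<tau> n) g x" for x
      using integrable_heat_kernel_mult[OF add.hyps(1) \<tau>(1)[of n], where x=x] integrable_heat_kernel_mult[OF add.hyps(2) \<tau>(1)[of n], where x=x]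
      by (simp add: heat_sg_lborel distrib_left)
    then have "heat_err (\<tau> n) (\<lambda>x. f x + g x) \<le>
      (\<integral>\<^sup>+ x. ennreal \<bar>heat_sg (\<tau> n) f x - f x\<bar> + ennreal \<bar>heat_sg (\<tau> n) g x - g x\<bar> \<partial>lborel)"
      unfolding heat_err_def
      by (intro nn_integral_mono) (simp add: ennreal_plus[symmetric] del: ennreal_plus)
    then show ?thesis unfolding heat_err_def by (simp add: nn_integral_add)
  qed
  show ?case
    by (rule tendsto_sandwich[OF always_eventually[OF allI[OF zero_le]] always_eventually[OF allI[OF le]] tendsto_const lim])
next
  case (lim f s)
  have [measurable]: "f \<in> borel_measurable borel" "s i \<in> borel_measurable borel" for i using lim by auto
  show ?case
  proof (rule heat_err_tendsto_approx[OF lim.hyps(4) \<tau>(1)])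
    fix e :: real assume e: "0 < e"
    have "(\<lambda>i. \<integral>\<^sup>+ x. ennreal \<bar>f x - s i x\<bar> \<partial>lborel) \<longlonglongrightarrow> (\<integral>\<^sup>+ x. 0 \<partial>(lborel :: 'a measure))"
    proof (rule nn_integral_dominated_convergence)
      show "(\<integral>\<^sup>+ x. ennreal (3 * \<bar>f x\<bar>) \<partial>lborel) < \<infinity>"
        using lim.hyps(4) by (simp add: integrable_iff_bounded ennreal_mult nn_integral_cmult ennreal_mult_less_top)
      \<comment> \<open>The induction rule supplies
        \<open>\<bar>s j x\<bar> \<le> 2 * \<bar>f x\<bar>\<close>, which explains the constant
        3.\<close>
      have "\<bar>f x - s j x\<bar> \<le> 3 * \<bar>f x\<bar>" for j x using lim.hyps(3)[of x j] by simp
      then show "AE x in lborel. ennreal \<bar>f x - s j x\<bar> \<le> ennreal (3 * \<bar>f x\<bar>)" for j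
        by (intro AE_I2 ennreal_leI)
      have "(\<lambda>i. \<bar>f x - s i x\<bar>) \<longlonglongrightarrow> \<bar>f x - f x\<bar>" for x using lim.hyps(2)[of x] by (intro tendsto_intros) auto
      then have "(\<lambda>i. ennreal \<bar>f x - s i x\<bar>) \<longlonglongrightarrow> ennreal 0" for x
        by (intro tendsto_ennrealI) simp
      then show "AE x in lborel. (\<lambda>i. ennreal \<bar>f x - s i x\<bar>) \<longlonglongrightarrow> 0"
        by simp
    qed measurable
    then have "eventually (\<lambda>i. (\<integral>\<^sup>+ x. ennreal \<bar>f x - s i x\<bar> \<partial>lborel) < ennreal e) sequentially"
      using e by (intro order_tendstoD) auto
    then obtain i where "(\<integral>\<^sup>+ x. ennreal \<bar>f x - s i x\<bar> \<partial>lborel) < ennreal e"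
      by (auto simp: eventually_sequentially)
    then show "\<exists>g. integrable lborel g \<and> (\<lambda>n. heat_err (\<tau> n) g) \<longlonglongrightarrow> 0 \<and>
        (\<integral>\<^sup>+ x. ennreal \<bar>f x - g x\<bar> \<partial>lborel) \<le> ennreal e"
      using lim.hyps(1)[of i] lim.IH[of i] by (intro exI[of _ "s i"]) auto
  qed
qed

subsection \<open>Continuity of the kernel in time\<close>

text \<open>Extension by zero to times t <= 0, so that Duhamel kernels for two final times can be
  compared even when the source time lies between them.\<close>

definition heat_kernel0 :: "real \<Rightarrow> 'a::euclidean_space \<Rightarrow> real" where
  "heat_kernel0 t z = (if 0 < t then heat_kernel t z else 0)"

lemma borel_measurable_heat_kernel0 [measurable (raw)]:
  fixes g :: "'b \<Rightarrow> 'a::euclidean_space"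
  assumes [measurable]: "f \<in> borel_measurable M" "g \<in> borel_measurable M"
  shows "(\<lambda>w. heat_kernel0 (f w) (g w)) \<in> borel_measurable M"
  unfolding heat_kernel0_def by measurable

lemma heat_kernel0_nonneg [simp]: "0 \<le> heat_kernel0 t z"
  by (simp add: heat_kernel0_def)

text \<open>The space variable is integrated out, so the dimension has to be supplied by a type
  argument.\<close>

definition heat_kernel_dist :: "'a::euclidean_space itself \<Rightarrow> real \<Rightarrow> real \<Rightarrow> ennreal" where
  "heat_kernel_dist (T :: 'a itself) a b = (\<integral>\<^sup>+ x. ennreal \<bar>heat_kernel0 a x - heat_kernel0 b (x::'a)\<bar> \<partial>lborel)"

lemma borel_measurable_heat_kernel_dist [measurable (raw)]:
  assumes [measurable]: "f \<in> borel_measurable M" "g \<in> borel_measurable M"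
  shows "(\<lambda>w. heat_kernel_dist TYPE('a::euclidean_space) (f w) (g w)) \<in> borel_measurable M"
  unfolding heat_kernel_dist_def by measurable

lemma heat_kernel_dist_le: "heat_kernel_dist TYPE('a::euclidean_space) a b \<le> 2"
proof -
  have 1: "(\<integral>\<^sup>+ x. ennreal (heat_kernel0 a (x::'a)) \<partial>lborel) \<le> 1" for a
    by (cases "0 < a") (simp_all add: heat_kernel0_def nn_integral_heat_kernel)
  have "heat_kernel_dist TYPE('a::euclidean_space) a b \<le>
     (\<integral>\<^sup>+ x. ennreal (heat_kernel0 a (x::'a)) + ennreal (heat_kernel0 b x) \<partial>lborel)"
    unfolding heat_kernel_dist_def
    by (intro nn_integral_mono)
       (simp add: ennreal_plus[symmetric] abs_le_iff add_increasing add_increasing2 del: ennreal_plus)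
  also have "\<dots> = (\<integral>\<^sup>+ x. ennreal (heat_kernel0 a (x::'a)) \<partial>lborel) + (\<integral>\<^sup>+ x. ennreal (heat_kernel0 b (x::'a)) \<partial>lborel)"
    by (rule nn_integral_add) measurable
  also have "\<dots> \<le> 1 + 1" by (intro add_mono 1)
  finally show ?thesis by simp
qed

text \<open>At \<open>b = 0\<close> the zero-extended kernel jumps from mass 1 to mass 0. For
  \<open>b > 0\<close> all times eventually lie between b/2 and 2b, and a multiple of the kernel at
  time 2b dominates them.\<close>

lemma heat_kernel_dist_tendsto:
  assumes b: "b \<noteq> 0" and a: "a \<longlonglongrightarrow> b"
  shows "(\<lambda>n. heat_kernel_dist TYPE('a::euclidean_space) (a n) b) \<longlonglongrightarrow> 0"
proof (cases "b < 0")
  case True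
  then have "eventually (\<lambda>n. a n < 0) sequentially" using a by (rule order_tendstoD(2)[rotated])
  then have "eventually (\<lambda>n. heat_kernel_dist TYPE('a) (a n) b = 0) sequentially"
    by eventually_elim (use True in \<open>simp add: heat_kernel_dist_def heat_kernel0_def\<close>)
  then show ?thesis by (rule tendsto_eventually)
next
  case False
  then have b: "b > 0" using b by simp
  have "eventually (\<lambda>n. b / 2 < a n \<and> a n < 2 * b) sequentially"
    using b by (intro eventually_conj order_tendstoD[OF a]) auto
  then obtain n0 where n0: "\<And>n. n \<ge> n0 \<Longrightarrow> b / 2 < a n \<and> a n < 2 * b"
    by (auto simp: eventually_sequentially)
  define c where "c n = a (n + n0)" for n
  have c: "b / 2 < c n" "c n < 2 * b" "c n > 0" for n
    using n0[of "n + n0"] b by (auto simp: c_def)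
  have cl: "c \<longlonglongrightarrow> b" unfolding c_def using a by (rule LIMSEQ_ignore_initial_segment)
  define K where "K = (4 * pi * (b/2)) powr (- real DIM('a) / 2) / (4 * pi * (2 * b)) powr (- real DIM('a) / 2)"
  have dom: "heat_kernel (c n) x \<le> K * heat_kernel (2 * b) x" for n and x :: 'a
  proof -
    have "(4 * pi * c n) powr (- real DIM('a) / 2) \<le> (4 * pi * (b/2)) powr (- real DIM('a) / 2)"
      using b c[of n] by (intro powr_mono2') auto
    moreover have "exp (- (norm x)\<^sup>2 / (4 * c n)) \<le> exp (- (norm x)\<^sup>2 / (4 * (2 * b)))"
      using b c[of n] by (auto intro!: divide_left_mono)
    ultimately have "heat_kernel (c n) x \<le> (4 * pi * (b/2)) powr (- real DIM('a) / 2) * exp (- (norm x)\<^sup>2 / (4 * (2 * b)))"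
      unfolding heat_kernel_def by (intro mult_mono) auto
    also have "\<dots> = K * heat_kernel (2 * b) x"
      using b by (simp add: K_def heat_kernel_def)
    finally show ?thesis .
  qed
  have "(\<lambda>n. \<integral>\<^sup>+ x. ennreal \<bar>heat_kernel0 (c n) x - heat_kernel0 b (x::'a)\<bar> \<partial>lborel) \<longlonglongrightarrow> (\<integral>\<^sup>+ x. 0 \<partial>(lborel::'a measure))"
  proof (rule nn_integral_dominated_convergence)
    have "0 \<le> K" using b by (simp add: K_def)
    then show "(\<integral>\<^sup>+ x. ennreal K * ennreal (heat_kernel (2 * b) (x::'a)) + ennreal (heat_kernel b x) \<partial>lborel) < \<infinity>"
      using b by (subst nn_integral_add) (auto simp: nn_integral_cmult nn_integral_heat_kernel)
    show "AE x in lborel. ennreal \<bar>heat_kernel0 (c j) x - heat_kernel0 b (x::'a)\<bar>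
      \<le> ennreal K * ennreal (heat_kernel (2 * b) x) + ennreal (heat_kernel b x)" for j
    proof (intro AE_I2)
      fix x :: 'a
      have "\<bar>heat_kernel0 (c j) x - heat_kernel0 b x\<bar> \<le> heat_kernel (c j) x + heat_kernel b x"
        using b c(3)[of j] heat_kernel_nonneg[of "c j" x] heat_kernel_nonneg[of b x]
        unfolding heat_kernel0_def abs_le_iff by simp
      also have "\<dots> \<le> K * heat_kernel (2 * b) x + heat_kernel b x" using dom by simp
      finally show "ennreal \<bar>heat_kernel0 (c j) x - heat_kernel0 b x\<bar>
        \<le> ennreal K * ennreal (heat_kernel (2 * b) x) + ennreal (heat_kernel b x)"
        using \<open>0 \<le> K\<close> by (simp add: ennreal_mult[symmetric] ennreal_plus[symmetric] del: ennreal_plus)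
    qed
    have "(\<lambda>i. \<bar>heat_kernel (c i) x - heat_kernel b x\<bar>) \<longlonglongrightarrow> \<bar>heat_kernel b x - heat_kernel b x\<bar>" for x :: 'a
      unfolding heat_kernel_def using b by (intro tendsto_intros cl) auto
    then have "(\<lambda>i. ennreal \<bar>heat_kernel (c i) x - heat_kernel b x\<bar>) \<longlonglongrightarrow> ennreal 0" for x :: 'a
      by (intro tendsto_ennrealI) simp
    then show "AE x in lborel. (\<lambda>i. ennreal \<bar>heat_kernel0 (c i) x - heat_kernel0 b (x::'a)\<bar>) \<longlonglongrightarrow> 0"
      using b c by (simp add: heat_kernel0_def)
  qed measurable
  then have "(\<lambda>n. heat_kernel_dist TYPE('a) (a (n + n0)) b) \<longlonglongrightarrow> 0"
    by (simp add: heat_kernel_dist_def c_def)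
  then show ?thesis by (rule LIMSEQ_offset)
qed

section \<open>The Duhamel term\<close>

lemma borel_measurable_fst_borel [measurable (raw)]:
  fixes f :: "'c \<Rightarrow> 'a::second_countable_topology \<times> 'b::second_countable_topology"
  assumes "f \<in> borel_measurable M"
  shows "(\<lambda>x. fst (f x)) \<in> borel_measurable M"
  using measurable_compose[OF assms, of fst borel]
  by (simp add: borel_measurable_continuous_onI continuous_on_fst continuous_on_id)

lemma borel_measurable_snd_borel [measurable (raw)]:
  fixes f :: "'c \<Rightarrow> 'a::second_countable_topology \<times> 'b::second_countable_topology"
  assumes "f \<in> borel_measurable M"
  shows "(\<lambda>x. snd (f x)) \<in> borel_measurable M"
  using measurable_compose[OF assms, of snd borel]
  by (simp add: borel_measurable_continuous_onI continuous_on_snd continuous_on_id)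

text \<open>With the time cut-off built in, the Duhamel term becomes a single integral over
  space-time, linear in its source, to which Tonelli and dominated convergence apply at
  once.\<close>

definition duhamel_kernel :: "real \<Rightarrow> 'a::euclidean_space \<Rightarrow> real \<times> 'a \<Rightarrow> real" where
  "duhamel_kernel t x z = indicator {0<..<t} (fst z) * heat_kernel (t - fst z) (x - snd z)"

lemma borel_measurable_duhamel_kernel [measurable (raw)]:
  fixes g :: "'b \<Rightarrow> 'a::euclidean_space"
  assumes [measurable]: "t \<in> borel_measurable M" "g \<in> borel_measurable M" "h \<in> borel_measurable M"
  shows "(\<lambda>w. duhamel_kernel (t w) (g w) (h w)) \<in> borel_measurable M"
proof -
  have [measurable]: "(\<lambda>w. fst (h w)) \<in> borel_measurable M" "(\<lambda>w. snd (h w)) \<in> borel_measurable M"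
    using assms(3) by (rule borel_measurable_fst_borel, rule borel_measurable_snd_borel)
  show ?thesis unfolding duhamel_kernel_def greaterThanLessThan_iff indicator_def by measurable
qed

lemma duhamel_kernel_nonneg [simp]: "0 \<le> duhamel_kernel t x z"
  by (simp add: duhamel_kernel_def)

lemma duhamel_kernel_eq_0: "fst z \<notin> {0<..<t} \<Longrightarrow> duhamel_kernel t x z = 0"
  by (auto simp: duhamel_kernel_def)

lemma nn_integral_duhamel_kernel:
  fixes g :: "real \<times> 'a::euclidean_space \<Rightarrow> ennreal"
  assumes [measurable]: "g \<in> borel_measurable borel"
  shows "(\<integral>\<^sup>+ z. ennreal (duhamel_kernel t x z) * g z \<partial>lborel) =
    (\<integral>\<^sup>+ s. indicator {0<..<t} s * heat_nn (t - s) (\<lambda>y. g (s, y)) x \<partial>lborel)"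
proof -
  have [measurable]: "g \<in> borel_measurable (borel \<Otimes>\<^sub>M borel)" by (simp add: borel_prod)
  have "(\<integral>\<^sup>+ z. ennreal (duhamel_kernel t x z) * g z \<partial>lborel) =
     (\<integral>\<^sup>+ z. ennreal (duhamel_kernel t x z) * g z \<partial>(lborel \<Otimes>\<^sub>M lborel))"
    by (simp add: lborel_prod)
  also have "\<dots> = (\<integral>\<^sup>+ s. \<integral>\<^sup>+ y. ennreal (duhamel_kernel t x (s, y)) * g (s, y) \<partial>lborel \<partial>lborel)"
    by (subst lborel.nn_integral_fst[symmetric]) (auto simp: lborel_prod)
  also have "\<dots> = (\<integral>\<^sup>+ s. indicator {0<..<t} s * heat_nn (t - s) (\<lambda>y. g (s, y)) x \<partial>lborel)"
    unfolding heat_nn_def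
    by (intro nn_integral_cong, subst nn_integral_cmult[symmetric])
       (auto simp: duhamel_kernel_def split: split_indicator intro!: nn_integral_cong)
  finally show ?thesis .
qed

lemma nn_integral_duhamel_kernel_diff:
  fixes z :: "real \<times> 'a::euclidean_space"
  assumes "0 < fst z"
  shows "(\<integral>\<^sup>+ x. ennreal \<bar>duhamel_kernel t x z - duhamel_kernel t' x z\<bar> \<partial>lborel)
    = heat_kernel_dist TYPE('a) (t - fst z) (t' - fst z)"
proof -
  have "duhamel_kernel t x z = heat_kernel0 (t - fst z) (- snd z + x)" for t x
    using assms by (auto simp: duhamel_kernel_def heat_kernel0_def)
  then show ?thesis
    unfolding heat_kernel_dist_def
    using nn_integral_lborel_shift[of "\<lambda>x. ennreal \<bar>heat_kernel0 (t - fst z) x - heat_kernel0 (t' - fst z) (x::'a)\<bar>" "- snd z"]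
    by simp
qed

text \<open>Exchanging the integrals bounds the L^1 distance by the integral of
  \<open>\<bar>g z\<bar>\<close> times a distance of heat kernels. That distance is at most 2, so
  2|g| is an integrable majorant.\<close>

lemma duhamel_L1_continuous:
  fixes g :: "real \<times> 'a::euclidean_space \<Rightarrow> real"
  assumes g: "integrable lborel g" "\<And>z. fst z \<le> 0 \<Longrightarrow> g z = 0"
    and \<tau>: "\<tau> \<longlonglongrightarrow> t"
  shows "(\<lambda>n. \<integral>\<^sup>+ x. ennreal \<bar>\<integral> z. (duhamel_kernel (\<tau> n) x z - duhamel_kernel t x z) * g z \<partial>lborel\<bar> \<partial>lborel) \<longlonglongrightarrow> 0"
proof -
  have [measurable]: "g \<in> borel_measurable borel" using g by auto
  define d where "d n z = ennreal \<bar>g z\<bar> * heat_kernel_dist TYPE('a) (\<tau> n - fst z) (t - fst z)" for n and z :: "real \<times> 'a"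
  have le: "(\<integral>\<^sup>+ x. ennreal \<bar>\<integral> z. (duhamel_kernel (\<tau> n) x z - duhamel_kernel t x z) * g z \<partial>lborel\<bar> \<partial>lborel)
    \<le> (\<integral>\<^sup>+ z. d n z \<partial>lborel)" for n
  proof -
    have "(\<integral>\<^sup>+ x. ennreal \<bar>\<integral> z. (duhamel_kernel (\<tau> n) x z - duhamel_kernel t x z) * g z \<partial>lborel\<bar> \<partial>lborel)
      \<le> (\<integral>\<^sup>+ x. \<integral>\<^sup>+ z. ennreal \<bar>(duhamel_kernel (\<tau> n) x z - duhamel_kernel t x z) * g z\<bar> \<partial>lborel \<partial>lborel)"
      by (intro nn_integral_mono ennreal_abs_integral_le)
    also have "\<dots> = (\<integral>\<^sup>+ z. \<integral>\<^sup>+ x. ennreal \<bar>(duhamel_kernel (\<tau> n) x z - duhamel_kernel t x z) * g z\<bar> \<partial>lborel \<partial>lborel)"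
      by (rule lborel_pair.Fubini') measurable
    also have "\<dots> = (\<integral>\<^sup>+ z. d n z \<partial>lborel)"
    proof (intro nn_integral_cong)
      fix z :: "real \<times> 'a"
      show "(\<integral>\<^sup>+ x. ennreal \<bar>(duhamel_kernel (\<tau> n) x z - duhamel_kernel t x z) * g z\<bar> \<partial>lborel) = d n z"
      proof (cases "fst z \<le> 0")
        case True
        then show ?thesis by (simp add: g d_def)
      next
        case False
        have "(\<integral>\<^sup>+ x. ennreal \<bar>(duhamel_kernel (\<tau> n) x z - duhamel_kernel t x z) * g z\<bar> \<partial>lborel)
          = (\<integral>\<^sup>+ x. ennreal \<bar>duhamel_kernel (\<tau> n) x z - duhamel_kernel t x z\<bar> \<partial>lborel) * ennreal \<bar>g z\<bar>"
          by (subst nn_integral_multc[symmetric]) (auto simp: abs_mult ennreal_mult)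
        then show ?thesis using False by (simp add: nn_integral_duhamel_kernel_diff d_def mult.commute)
      qed
    qed
    finally show ?thesis .
  qed
  \<comment> \<open>The kernel distance need not vanish in the limit when the source time equals
    \<open>t\<close>; those points form a null set.\<close>
  have AEt: "AE z in lborel. fst (z :: real \<times> 'a) \<noteq> t"
    unfolding lborel_prod[symmetric]
  proof (rule lborel_pair.AE_pair_measure)
    show "AE s in lborel. AE y in lborel. fst (s, y::'a) \<noteq> t"
      using AE_lborel_singleton[of t] by eventually_elim simp
  qed measurable
  have "(\<lambda>n. \<integral>\<^sup>+ z. d n z \<partial>lborel) \<longlonglongrightarrow> (\<integral>\<^sup>+ z. 0 \<partial>(lborel :: (real \<times> 'a) measure))"
  proof (rule nn_integral_dominated_convergence)
    show "d n \<in> borel_measurable lborel" for n unfolding d_def by measurable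
    show "(\<integral>\<^sup>+ z. 2 * ennreal \<bar>g z\<bar> \<partial>lborel) < \<infinity>"
      using g(1) by (simp add: nn_integral_cmult integrable_iff_bounded ennreal_mult_less_top)
    show "AE z in lborel. d j z \<le> 2 * ennreal \<bar>g z\<bar>" for j
      unfolding d_def mult.commute[of 2] by (intro AE_I2 mult_left_mono heat_kernel_dist_le) auto
    show "AE z in lborel. (\<lambda>i. d i z) \<longlonglongrightarrow> 0"
      using AEt
    proof eventually_elim
      case (elim z)
      have "(\<lambda>i. heat_kernel_dist TYPE('a) (\<tau> i - fst z) (t - fst z)) \<longlonglongrightarrow> 0"
        using elim by (intro heat_kernel_dist_tendsto tendsto_intros \<tau>) auto
      then have "(\<lambda>i. d i z) \<longlonglongrightarrow> ennreal \<bar>g z\<bar> * 0"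
        unfolding d_def by (intro ennreal_tendsto_cmult) auto
      then show ?case by simp
    qed
  qed measurable
  then have lim: "(\<lambda>n. \<integral>\<^sup>+ z. d n z \<partial>lborel) \<longlonglongrightarrow> 0" by simp
  show ?thesis
    by (rule tendsto_sandwich[OF always_eventually[OF allI[OF zero_le]] always_eventually[OF allI[OF le]] tendsto_const lim])
qed

section \<open>Picard iteration below a supersolution\<close>

lemma fnl_nonneg: "0 \<le> v \<Longrightarrow> fnl p v = v powr p"
  by (cases "v = 0") (auto simp: fnl_def powr_mult_base[of v "p - 1"] mult.commute)

lemma fnl_minus: "fnl p (- v) = - fnl p v"
  by (simp add: fnl_def)

lemma abs_fnl: "\<bar>fnl p v\<bar> = \<bar>v\<bar> powr p"
  using fnl_nonneg[of "\<bar>v\<bar>" p] by (simp add: fnl_def abs_mult)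

lemma borel_measurable_fnl [measurable (raw)]:
  "f \<in> borel_measurable M \<Longrightarrow> (\<lambda>x. fnl p (f x)) \<in> borel_measurable M"
  unfolding fnl_def by measurable

lemma powr_diff_le:
  fixes x y M p :: real
  assumes p: "1 < p" and xy: "0 \<le> x" "x \<le> y" "y \<le> M"
  shows "y powr p - x powr p \<le> p * M powr (p - 1) * (y - x)"
proof (cases "x = y")
  case False
  then have "x < y" using xy by simp
  have der: "((\<lambda>z. z powr p) has_real_derivative p * \<xi> powr (p - 1)) (at \<xi>)" if "x < \<xi>" for \<xi>
    using that xy by (intro has_real_derivative_powr) auto
  have "\<exists>l \<xi>. x < \<xi> \<and> \<xi> < y \<and> ((\<lambda>z. z powr p) has_real_derivative l) (at \<xi>) \<and> y powr p - x powr p = (y - x) * l"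
  proof (rule MVT[OF \<open>x < y\<close>])
    show "continuous_on {x..y} (\<lambda>z. z powr p)"
      using xy p by (intro continuous_on_powr') (auto intro!: continuous_intros)
    show "(\<lambda>z. z powr p) differentiable (at \<xi>)" if "x < \<xi>" "\<xi> < y" for \<xi>
      using der[OF that(1)] unfolding real_differentiable_def by blast
  qed
  then obtain \<xi> where "x < \<xi>" "\<xi> < y" "y powr p - x powr p = (y - x) * (p * \<xi> powr (p - 1))"
    using der DERIV_unique by metis
  moreover have "\<xi> powr (p - 1) \<le> M powr (p - 1)"
    using \<open>x < \<xi>\<close> \<open>\<xi> < y\<close> xy p by (intro powr_mono2) auto
  ultimately show ?thesis using p \<open>x < y\<close> by (simp add: mult_left_mono mult.commute)
qed (use assms in simp)

text \<open>For equal signs this is the mean value bound. For opposite signs both values are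
  compared with 0 and the two bounds are added, since then |a - b| = |a| + |b|.\<close>

lemma fnl_lipschitz:
  assumes p: "1 < p" and a: "\<bar>a\<bar> \<le> M" and b: "\<bar>b\<bar> \<le> M"
  shows "\<bar>fnl p a - fnl p b\<bar> \<le> p * M powr (p - 1) * \<bar>a - b\<bar>"
proof -
  have M: "0 \<le> M" using a by simp
  have same: "\<bar>fnl p x - fnl p y\<bar> \<le> p * M powr (p - 1) * \<bar>x - y\<bar>" if "0 \<le> x" "x \<le> M" "0 \<le> y" "y \<le> M" for x y
  proof (cases "x \<le> y")
    case True
    then have "x powr p \<le> y powr p" using that p by (intro powr_mono2) auto
    then show ?thesis using True that powr_diff_le[OF p, of x y M] by (simp add: fnl_nonneg abs_if)
  next
    case False
    then have "y powr p \<le> x powr p" using that p by (intro powr_mono2) auto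
    then show ?thesis using False that powr_diff_le[OF p, of y x M] by (simp add: fnl_nonneg abs_if)
  qed
  have opp: "\<bar>fnl p x - fnl p (- y)\<bar> \<le> p * M powr (p - 1) * \<bar>x - - y\<bar>" if "0 \<le> x" "x \<le> M" "0 \<le> y" "y \<le> M" for x y
  proof -
    have "fnl p z \<le> p * M powr (p - 1) * z" if "0 \<le> z" "z \<le> M" for z
      using same[of z 0] that by (simp add: fnl_nonneg)
    from this[of x] this[of y] show ?thesis using that
      by (simp add: fnl_minus fnl_nonneg distrib_left)
  qed
  consider "0 \<le> a" "0 \<le> b" | "0 \<le> a" "b \<le> 0" | "a \<le> 0" "0 \<le> b" | "a \<le> 0" "b \<le> 0" by linarith
  then show ?thesis
  proof cases
    case 1
    then show ?thesis using same[of a b] a b by simp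
  next
    case 2
    then show ?thesis using opp[of a "- b"] a b by simp
  next
    case 3
    then show ?thesis using opp[of b "- a"] a b by (simp add: abs_minus_commute)
  next
    case 4
    then show ?thesis using same[of "- a" "- b"] a b by (simp add: fnl_minus abs_minus_commute)
  qed
qed

lemma continuous_fnl:
  assumes p: "1 < p" and v: "v \<longlonglongrightarrow> l"
  shows "(\<lambda>n. fnl p (v n)) \<longlonglongrightarrow> fnl p l"
  unfolding fnl_def using p by (intro tendsto_intros tendsto_powr' v) auto

text \<open>In the iteration \<open>U\<close> is replaced by \<open>U z powr p\<close> and
  \<open>K\<close> comes from the supersolution inequality; \<open>c\<close> carries the contraction
  constant.\<close>

lemma duhamel_dominated:
  fixes U :: "real \<times> 'a::euclidean_space \<Rightarrow> real"
  assumes [measurable]: "U \<in> borel_measurable borel" "g \<in> borel_measurable borel"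
    and U: "(\<integral>\<^sup>+ z. ennreal (duhamel_kernel t x z) * ennreal (U z) \<partial>lborel) \<le> ennreal K" "0 \<le> K"
    and U0: "\<And>z. 0 \<le> U z"
    and g: "\<And>z. fst z \<in> {0<..<t} \<Longrightarrow> \<bar>g z\<bar> \<le> c * U z" and c: "0 \<le> c"
  shows "integrable lborel (\<lambda>z. duhamel_kernel t x z * g z)"
    and "\<bar>\<integral> z. duhamel_kernel t x z * g z \<partial>lborel\<bar> \<le> c * K"
proof -
  have "(\<integral>\<^sup>+ z. ennreal \<bar>duhamel_kernel t x z * g z\<bar> \<partial>lborel) \<le>
     (\<integral>\<^sup>+ z. ennreal c * (ennreal (duhamel_kernel t x z) * ennreal (U z)) \<partial>lborel)"
  proof (rule nn_integral_mono)
    fix z :: "real \<times> 'a"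
    have "\<bar>duhamel_kernel t x z * g z\<bar> \<le> c * (duhamel_kernel t x z * U z)"
    proof (cases "fst z \<in> {0<..<t}")
      case True
      have "duhamel_kernel t x z * \<bar>g z\<bar> \<le> duhamel_kernel t x z * (c * U z)"
        using g[OF True] by (intro mult_left_mono) auto
      then show ?thesis by (simp add: abs_mult mult_ac)
    qed (simp add: duhamel_kernel_eq_0)
    then show "ennreal \<bar>duhamel_kernel t x z * g z\<bar> \<le> ennreal c * (ennreal (duhamel_kernel t x z) * ennreal (U z))"
      using c U0 by (simp add: ennreal_mult[symmetric])
  qed
  also have "\<dots> \<le> ennreal c * ennreal K"
    using U by (subst nn_integral_cmult) (auto intro!: mult_left_mono)
  finally have le: "(\<integral>\<^sup>+ z. ennreal \<bar>duhamel_kernel t x z * g z\<bar> \<partial>lborel) \<le> ennreal (c * K)"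
    using c U by (simp add: ennreal_mult)
  then show "integrable lborel (\<lambda>z. duhamel_kernel t x z * g z)"
    by (auto simp: integrable_iff_bounded intro: le_less_trans)
  have "ennreal \<bar>\<integral> z. duhamel_kernel t x z * g z \<partial>lborel\<bar> \<le> ennreal (c * K)"
    using ennreal_abs_integral_le le by (rule order_trans)
  then show "\<bar>\<integral> z. duhamel_kernel t x z * g z \<partial>lborel\<bar> \<le> c * K"
    using c U by (simp add: ennreal_le_iff)
qed

text \<open>The constant 1/(2p) acts twice: being at most 1/2, it keeps every iterate below
  \<open>U\<close> together with \<open>lin\<close>, and multiplied by the Lipschitz constant
  \<open>p\<close> it halves successive differences relative to \<open>U\<close>.\<close>

theorem picard_supersolution:
  fixes \<phi> :: "'a::euclidean_space \<Rightarrow> real" and U :: "real \<times> 'a \<Rightarrow> real"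
  assumes p: "1 < p"
    and [measurable]: "\<phi> \<in> borel_measurable borel" "U \<in> borel_measurable borel"
    and U0: "\<And>z. 0 \<le> U z"
    and lin: "\<And>t x. 0 < t \<Longrightarrow> t < T \<Longrightarrow> \<bar>heat_sg t \<phi> x\<bar> \<le> U (t, x) / 2"
    and super: "\<And>t x. 0 < t \<Longrightarrow> t < T \<Longrightarrow>
      (\<integral>\<^sup>+ z. ennreal (duhamel_kernel t x z) * ennreal (U z powr p) \<partial>lborel) \<le> ennreal (U (t, x) / (2 * p))"
  obtains u :: "real \<times> 'a \<Rightarrow> real" where "u \<in> borel_measurable borel"
    "\<And>t x. 0 < t \<Longrightarrow> t < T \<Longrightarrow> \<bar>u (t, x)\<bar> \<le> U (t, x)"
    "\<And>t x. 0 < t \<Longrightarrow> t < T \<Longrightarrow> u (t, x) = heat_sg t \<phi> x + (\<integral> z. duhamel_kernel t x z * fnl p (u z) \<partial>lborel)"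
proof -
  define v where "v = rec_nat (\<lambda>z. 0) (\<lambda>n v z. heat_sg (fst z) \<phi> (snd z)
     + (\<integral> w. duhamel_kernel (fst z) (snd z) w * fnl p (v w) \<partial>lborel))"
  have v0: "v 0 = (\<lambda>z. 0)" by (simp add: v_def)
  have vS: "v (Suc n) z = heat_sg (fst z) \<phi> (snd z)
     + (\<integral> w. duhamel_kernel (fst z) (snd z) w * fnl p (v n w) \<partial>lborel)" for n z
    by (simp add: v_def)
  have [measurable]: "v n \<in> borel_measurable borel" for n
  proof (induction n)
    case (Suc n)
    note Suc [measurable]
    show ?case unfolding vS[abs_def] by measurable
  qed (simp add: v0)
  have Up [measurable]: "(\<lambda>z. U z powr p) \<in> borel_measurable borel" by measurable
  have dom: "integrable lborel (\<lambda>z. duhamel_kernel t x z * g z)"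
    "\<bar>\<integral> z. duhamel_kernel t x z * g z \<partial>lborel\<bar> \<le> c * (U (t, x) / (2 * p))"
    if "0 < t" "t < T" "g \<in> borel_measurable borel" "0 \<le> c"
      "\<And>z. 0 < fst z \<Longrightarrow> fst z < T \<Longrightarrow> \<bar>g z\<bar> \<le> c * U z powr p" for t x g c
    using duhamel_dominated[OF Up that(3) super[OF that(1,2)], of x c] U0 p that by auto
  have vU: "\<bar>v n z\<bar> \<le> U z" if "0 < fst z" "fst z < T" for n z
    using that
  proof (induction n arbitrary: z)
    case (Suc n)
    obtain t x where z: "z = (t, x)" by (cases z)
    have "\<bar>fnl p (v n w)\<bar> \<le> 1 * U w powr p" if "0 < fst w" "fst w < T" for w
      using Suc.IH[OF that] p by (auto simp: abs_fnl intro!: powr_mono2)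
    from dom(2)[OF _ _ _ _ this, of t x] Suc.prems z
    have "\<bar>\<integral> w. duhamel_kernel t x w * fnl p (v n w) \<partial>lborel\<bar> \<le> U (t, x) / (2 * p)" by simp
    also have "\<dots> \<le> U (t, x) / 2" using p U0[of "(t, x)"] by (intro divide_left_mono) auto
    finally have "\<bar>\<integral> w. duhamel_kernel t x w * fnl p (v n w) \<partial>lborel\<bar> \<le> U (t, x) / 2" .
    moreover have "\<bar>heat_sg t \<phi> x\<bar> \<le> U (t, x) / 2" using lin Suc.prems z by simp
    ultimately show ?case unfolding vS z by simp
  qed (simp add: v0 U0)
  have fv: "\<bar>fnl p (v n w)\<bar> \<le> 1 * U w powr p" if "0 < fst w" "fst w < T" for w n
    using vU[OF that] p by (auto simp: abs_fnl intro!: powr_mono2)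
  have int: "integrable lborel (\<lambda>w. duhamel_kernel t x w * fnl p (v n w))" if "0 < t" "t < T" for t x n
    using dom(1)[OF that _ _ fv] by simp
  \<comment> \<open>Contraction in the norm sup |v|/U. It is written without division, so points
    where \<open>U\<close> vanishes cause no trouble.\<close>
  have diff: "\<bar>v (Suc n) z - v n z\<bar> \<le> (1/2)^n * U z" if "0 < fst z" "fst z < T" for n z
    using that
  proof (induction n arbitrary: z)
    case 0
    then show ?case using vU[OF 0, of 1] by (simp add: v0)
  next
    case (Suc n)
    obtain t x where z: "z = (t, x)" by (cases z)
    have t: "0 < t" "t < T" using Suc.prems z by auto
    have *: "\<bar>fnl p (v (Suc n) w) - fnl p (v n w)\<bar> \<le> (p * (1/2)^n) * U w powr p" if w: "0 < fst w" "fst w < T" for w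
    proof -
      have "\<bar>fnl p (v (Suc n) w) - fnl p (v n w)\<bar> \<le> p * U w powr (p - 1) * \<bar>v (Suc n) w - v n w\<bar>"
        by (rule fnl_lipschitz[OF p vU[OF w] vU[OF w]])
      also have "\<dots> \<le> p * U w powr (p - 1) * ((1/2)^n * U w)"
        using Suc.IH[OF w] p by (intro mult_left_mono) auto
      also have "\<dots> = (p * (1/2)^n) * U w powr p"
        using U0[of w] by (cases "U w = 0") (simp_all add: powr_mult_base[of "U w" "p - 1"] mult_ac)
      finally show ?thesis .
    qed
    have "v (Suc (Suc n)) z - v (Suc n) z = (\<integral> w. duhamel_kernel t x w * (fnl p (v (Suc n) w) - fnl p (v n w)) \<partial>lborel)"
      using int[OF t, of x "Suc n"] int[OF t, of x n] by (simp add: vS[of "Suc n"] vS[of n] z right_diff_distrib del: One_nat_def)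
    also have "\<bar>\<dots>\<bar> \<le> (p * (1/2)^n) * (U (t, x) / (2 * p))"
      using dom(2)[OF t _ _ *] p by simp
    finally show ?case using p by (simp add: z)
  qed
  \<comment> \<open>\<open>lim\<close> is a total function, so \<open>u\<close> is measurable on all
    of space-time although convergence is known only for times between 0 and
    \<open>T\<close>.\<close>
  define u where "u z = lim (\<lambda>n. v n z)" for z
  have [measurable]: "u \<in> borel_measurable borel" unfolding u_def[abs_def] by measurable
  have conv: "(\<lambda>n. v n z) \<longlonglongrightarrow> u z" if z: "0 < fst z" "fst z < T" for z
  proof -
    have "summable (\<lambda>n. (1/2)^n * U z)" by (intro summable_mult2 summable_geometric) simp
    then have "summable (\<lambda>n. v (Suc n) z - v n z)"
      by (rule summable_comparison_test'[where N=0]) (use diff[OF z] in auto)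
    then have "convergent (\<lambda>n. \<Sum>k<n. v (Suc k) z - v k z)" by (simp add: summable_iff_convergent)
    then have "convergent (\<lambda>n. v n z)" using sum_lessThan_telescope[of "\<lambda>n. v n z"] by (simp add: v0)
    then show ?thesis unfolding u_def by (simp add: convergent_LIMSEQ_iff)
  qed
  show ?thesis
  proof (rule that[of u])
    show "u \<in> borel_measurable borel" by measurable
    show "\<bar>u (t, x)\<bar> \<le> U (t, x)" if "0 < t" "t < T" for t x
      by (rule LIMSEQ_le_const2[OF tendsto_rabs[OF conv]]) (use that vU in auto)
    show "u (t, x) = heat_sg t \<phi> x + (\<integral> z. duhamel_kernel t x z * fnl p (u z) \<partial>lborel)" if t: "0 < t" "t < T" for t x
    proof (rule LIMSEQ_unique)
      show "(\<lambda>n. v (Suc n) (t, x)) \<longlonglongrightarrow> u (t, x)"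
        using LIMSEQ_Suc[OF conv[of "(t, x)"]] t by simp
      \<comment> \<open>Passing to the limit in the fixed-point equation: the kernel times
        \<open>U w powr p\<close> is an integrable majorant.\<close>
      have "(\<lambda>n. \<integral> w. duhamel_kernel t x w * fnl p (v n w) \<partial>lborel) \<longlonglongrightarrow> (\<integral> w. duhamel_kernel t x w * fnl p (u w) \<partial>lborel)"
      proof (rule integral_dominated_convergence)
        show "integrable lborel (\<lambda>w. duhamel_kernel t x w * U w powr p)"
          by (rule dom(1)[OF t, where c=1]) auto
        show "AE w in lborel. (\<lambda>n. duhamel_kernel t x w * fnl p (v n w)) \<longlonglongrightarrow> duhamel_kernel t x w * fnl p (u w)"
        proof (intro AE_I2)
          fix w
          show "(\<lambda>n. duhamel_kernel t x w * fnl p (v n w)) \<longlonglongrightarrow> duhamel_kernel t x w * fnl p (u w)"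
          proof (cases "fst w \<in> {0<..<t}")
            case True
            then show ?thesis using t by (intro tendsto_intros continuous_fnl[OF p] conv) auto
          qed (simp add: duhamel_kernel_eq_0)
        qed
        show "AE w in lborel. norm (duhamel_kernel t x w * fnl p (v n w)) \<le> duhamel_kernel t x w * U w powr p" for n
        proof (intro AE_I2)
          fix w
          show "norm (duhamel_kernel t x w * fnl p (v n w)) \<le> duhamel_kernel t x w * U w powr p"
          proof (cases "fst w \<in> {0<..<t}")
            case True
            then show ?thesis using fv[of w n] t by (simp add: abs_mult mult_left_mono)
          qed (simp add: duhamel_kernel_eq_0)
        qed
      qed measurable
      then show "(\<lambda>n. v (Suc n) (t, x)) \<longlonglongrightarrow> heat_sg t \<phi> x + (\<integral> z. duhamel_kernel t x z * fnl p (u z) \<partial>lborel)"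
        unfolding vS by (auto intro!: tendsto_intros)
    qed
  qed
qed

section \<open>From a supersolution to a mild solution\<close>

lemma heat_sg_cong_AE:
  fixes \<phi> \<phi>' :: "'a::euclidean_space \<Rightarrow> real"
  assumes [measurable]: "\<phi> \<in> borel_measurable lebesgue" "\<phi>' \<in> borel_measurable lebesgue"
    and ae: "AE x in lebesgue. \<phi> x = \<phi>' x"
  shows "heat_sg t \<phi> x = heat_sg t \<phi>' x"
    and "integrable lebesgue (\<lambda>y. heat_kernel t (x - y) * \<phi> y) \<longleftrightarrow> integrable lebesgue (\<lambda>y. heat_kernel t (x - y) * \<phi>' y)"
proof -
  have [measurable]: "(\<lambda>y. heat_kernel t (x - y)) \<in> borel_measurable lebesgue"
    by (rule measurable_completion) measurable
  show "heat_sg t \<phi> x = heat_sg t \<phi>' x"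
    unfolding heat_sg_def by (rule integral_cong_AE) (use ae in auto)
  show "integrable lebesgue (\<lambda>y. heat_kernel t (x - y) * \<phi> y) \<longleftrightarrow> integrable lebesgue (\<lambda>y. heat_kernel t (x - y) * \<phi>' y)"
    by (rule integrable_cong_AE) (use ae in auto)
qed

text \<open>Fubini: joint integrability makes the iterated integral of \<open>duhamel\<close> equal
  to the space-time integral.\<close>

lemma duhamel_eq:
  fixes \<phi> :: "'a::euclidean_space \<Rightarrow> real" and u :: "real \<times> 'a \<Rightarrow> real"
  assumes [measurable]: "u \<in> borel_measurable borel"
    and int: "integrable lborel (\<lambda>z. duhamel_kernel t x z * fnl p (u z))"
  shows "duhamel p \<phi> (\<lambda>s y. u (s, y)) t x = heat_sg t \<phi> x + (\<integral> z. duhamel_kernel t x z * fnl p (u z) \<partial>lborel)"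
proof -
  have [measurable]: "u \<in> borel_measurable (borel \<Otimes>\<^sub>M borel)" by (simp add: borel_prod)
  have "(\<integral> s. indicator {0<..<t} s * heat_sg (t - s) (\<lambda>y. fnl p (u (s, y))) x \<partial>lebesgue) =
    (\<integral> s. indicator {0<..<t} s * (\<integral> y. heat_kernel (t - s) (x - y) * fnl p (u (s, y)) \<partial>lborel) \<partial>lebesgue)"
    by (simp add: heat_sg_lborel)
  also have "\<dots> = (\<integral> s. indicator {0<..<t} s * (\<integral> y. heat_kernel (t - s) (x - y) * fnl p (u (s, y)) \<partial>lborel) \<partial>lborel)"
    by (rule integral_completion) measurable
  also have "\<dots> = (\<integral> s. \<integral> y. duhamel_kernel t x (s, y) * fnl p (u (s, y)) \<partial>lborel \<partial>lborel)"
    by (intro Bochner_Integration.integral_cong) (simp_all add: duhamel_kernel_def mult.assoc)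
  also have "\<dots> = (\<integral> z. duhamel_kernel t x z * fnl p (u z) \<partial>(lborel \<Otimes>\<^sub>M lborel))"
    using int by (subst lborel_pair.integral_fst'[symmetric]) (simp_all add: lborel_prod)
  finally show ?thesis by (simp add: duhamel_def lborel_prod)
qed

lemma heat_sg_L1_continuous:
  fixes \<phi> :: "'a::euclidean_space \<Rightarrow> real"
  assumes \<phi>: "integrable lborel \<phi>" and t: "0 < t" and \<tau>: "\<tau> \<longlonglongrightarrow> t" "\<And>n. 0 < \<tau> n"
  shows "(\<lambda>n. \<integral>\<^sup>+ x. ennreal \<bar>heat_sg (\<tau> n) \<phi> x - heat_sg t \<phi> x\<bar> \<partial>lborel) \<longlonglongrightarrow> 0"
proof -
  have [measurable]: "\<phi> \<in> borel_measurable borel" using \<phi> by auto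
  have le: "(\<integral>\<^sup>+ x. ennreal \<bar>heat_sg (\<tau> n) \<phi> x - heat_sg t \<phi> x\<bar> \<partial>lborel) \<le>
    (\<integral>\<^sup>+ y. ennreal \<bar>\<phi> y\<bar> \<partial>lborel) * heat_kernel_dist TYPE('a) (\<tau> n) t" for n
  proof -
    have "heat_sg (\<tau> n) \<phi> x - heat_sg t \<phi> x = (\<integral> y. (heat_kernel0 (\<tau> n) (x - y) - heat_kernel0 t (x - y)) * \<phi> y \<partial>lborel)" for x
      using integrable_heat_kernel_mult[OF \<phi> t, of x] integrable_heat_kernel_mult[OF \<phi> \<tau>(2)[of n], of x] t \<tau>(2)[of n]
      by (simp add: heat_sg_lborel heat_kernel0_def left_diff_distrib)
    then show ?thesis
      using nn_integral_convolution_le[of "\<lambda>x. heat_kernel0 (\<tau> n) x - heat_kernel0 t x" \<phi>]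
      by (simp add: heat_kernel_dist_def mult.commute)
  qed
  have "(\<integral>\<^sup>+ y. ennreal \<bar>\<phi> y\<bar> \<partial>lborel) < \<infinity>" using \<phi> by (simp add: integrable_iff_bounded)
  then have "(\<lambda>n. (\<integral>\<^sup>+ y. ennreal \<bar>\<phi> y\<bar> \<partial>lborel) * heat_kernel_dist TYPE('a) (\<tau> n) t) \<longlonglongrightarrow> (\<integral>\<^sup>+ y. ennreal \<bar>\<phi> y\<bar> \<partial>lborel) * 0"
    using t by (intro ennreal_tendsto_cmult heat_kernel_dist_tendsto \<tau>) auto
  then have lim: "(\<lambda>n. (\<integral>\<^sup>+ y. ennreal \<bar>\<phi> y\<bar> \<partial>lborel) * heat_kernel_dist TYPE('a) (\<tau> n) t) \<longlonglongrightarrow> 0"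
    by simp
  show ?thesis
    by (rule tendsto_sandwich[OF always_eventually[OF allI[OF zero_le]] always_eventually[OF allI[OF le]] tendsto_const lim])
qed

text \<open>Each hypothesis on \<open>U\<close> supplies one clause: \<open>bdd\<close> the finite
  sup norm, \<open>int\<close> the integrability of each time slice, and \<open>intp\<close> a
  globally integrable source, from which continuity into L^1 follows.\<close>

theorem mild_solution_of_supersolution:
  fixes \<phi> \<phi>' :: "'a::euclidean_space \<Rightarrow> real" and U :: "real \<times> 'a \<Rightarrow> real"
  assumes p: "1 < p" and T: "0 < T"
    and \<phi>: "\<phi> \<in> borel_measurable lebesgue" and \<phi>': "integrable lborel \<phi>'" and ae: "AE x in lebesgue. \<phi> x = \<phi>' x"
    and U [measurable]: "U \<in> borel_measurable borel"
    and U0: "\<And>z. 0 \<le> U z"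
    and lin: "\<And>t x. 0 < t \<Longrightarrow> t < T \<Longrightarrow> \<bar>heat_sg t \<phi>' x\<bar> \<le> U (t, x) / 2"
    and super: "\<And>t x. 0 < t \<Longrightarrow> t < T \<Longrightarrow>
      (\<integral>\<^sup>+ z. ennreal (duhamel_kernel t x z) * ennreal (U z powr p) \<partial>lborel) \<le> ennreal (U (t, x) / (2 * p))"
    and bdd: "\<And>t. 0 < t \<Longrightarrow> t < T \<Longrightarrow> \<exists>M. \<forall>x. U (t, x) \<le> M"
    and int: "\<And>t. 0 < t \<Longrightarrow> t < T \<Longrightarrow> integrable lborel (\<lambda>x. U (t, x))"
    and intp: "integrable lborel (\<lambda>z. indicator {0<..<T} (fst z) * U z powr p)"
  obtains u where "mild_solution p \<phi> T u" "\<And>t x. 0 < t \<Longrightarrow> t < T \<Longrightarrow> \<bar>u t x\<bar> \<le> U (t, x)"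
proof -
  have \<phi>'m [measurable]: "\<phi>' \<in> borel_measurable borel" using \<phi>' by auto
  have \<phi>'l: "\<phi>' \<in> borel_measurable lebesgue" by (rule measurable_completion) measurable
  obtain v :: "real \<times> 'a \<Rightarrow> real" where v [measurable]: "v \<in> borel_measurable borel"
    and vU: "\<And>t x. 0 < t \<Longrightarrow> t < T \<Longrightarrow> \<bar>v (t, x)\<bar> \<le> U (t, x)"
    and veq: "\<And>t x. 0 < t \<Longrightarrow> t < T \<Longrightarrow> v (t, x) = heat_sg t \<phi>' x + (\<integral> z. duhamel_kernel t x z * fnl p (v z) \<partial>lborel)"
    by (rule picard_supersolution[OF p \<phi>'m U U0 lin super]) auto
  have vm [measurable]: "(\<lambda>x. v (t, x)) \<in> borel_measurable borel" for t
    by (rule measurable_compose[OF _ v]) (simp add: borel_prod[symmetric])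
  \<comment> \<open>The source cut off to times between 0 and \<open>T\<close>. Duhamel kernels with
    final time below \<open>T\<close> do not see the cut, and the cut source is integrable over all
    of space-time.\<close>
  define g where "g z = indicator {0<..<T} (fst z) * fnl p (v z)" for z
  have [measurable]: "g \<in> borel_measurable borel" unfolding g_def[abs_def] indicator_def greaterThanLessThan_iff by measurable
  have gle: "\<bar>g z\<bar> \<le> indicator {0<..<T} (fst z) * U z powr p" for z
    using vU[of "fst z" "snd z"] p by (auto simp: g_def indicator_def abs_mult abs_fnl intro!: powr_mono2)
  have g: "integrable lborel g"
    by (rule Bochner_Integration.integrable_bound[OF intp]) (use gle in auto)
  have g0: "g z = 0" if "fst z \<le> 0" for z using that by (simp add: g_def)
  have gv: "duhamel_kernel t x z * fnl p (v z) = duhamel_kernel t x z * g z" if "t < T" for t x z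
    using that by (cases "fst z \<in> {0<..<t}") (auto simp: g_def duhamel_kernel_eq_0)
  have intg: "integrable lborel (\<lambda>z. duhamel_kernel t x z * g z)" if "0 \<le> t" "t < T" for t x
  proof (cases "t = 0")
    case False
    show ?thesis
    proof (rule duhamel_dominated(1)[where c=1 and U="\<lambda>z. U z powr p" and K="U (t, x) / (2 * p)"])
      show "\<bar>g z\<bar> \<le> 1 * U z powr p" for z
        using gle[of z] by (cases "fst z \<in> {0<..<T}") auto
    qed (use False that super U0 p in auto)
  qed (simp add: duhamel_kernel_def)
  \<comment> \<open>Time 0 is patched by hand; the Duhamel integral does not see this value.\<close>
  define u where "u t x = (if t = 0 then \<phi> x else v (t, x))" for t x
  have veq': "v (t, x) = heat_sg t \<phi>' x + (\<integral> z. duhamel_kernel t x z * g z \<partial>lborel)" if "0 < t" "t < T" for t x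
    using veq[OF that] gv[OF that(2)] by simp
  have int_sol: "integral_solution p \<phi> T u"
    unfolding integral_solution_def
  proof (intro conjI ballI)
    show "0 < T" by fact
    have "(\<lambda>z. indicator ({0<..<T} \<times> UNIV) z *\<^sub>R v z) \<in> borel_measurable lebesgue"
    proof (rule measurable_completion)
      have "{0<..<T} \<times> (UNIV::'a set) \<in> sets borel" by (intro borel_open open_Times) auto
      then show "(\<lambda>z. indicator ({0<..<T} \<times> UNIV) z *\<^sub>R v z) \<in> borel_measurable lborel" by measurable
    qed
    then show "set_borel_measurable lebesgue ({0<..<T} \<times> UNIV) (\<lambda>z. u (fst z) (snd z))"
      unfolding set_borel_measurable_def
      by (rule measurable_cong[THEN iffD1, rotated]) (auto simp: u_def split: split_indicator)
    fix t assume t: "t \<in> {0<..<T}"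
    then have t': "0 < t" "t < T" by auto
    have eq: "indicator {0<..<t} (fst z) * heat_kernel (t - fst z) (x - snd z) * fnl p (u (fst z) (snd z))
        = duhamel_kernel t x z * fnl p (v z)" for z x
      by (auto simp: duhamel_kernel_def u_def)
    have int_v: "integrable lborel (\<lambda>z. duhamel_kernel t x z * fnl p (v z))" for x
      unfolding gv[OF t'(2)] using intg t' by simp
    have "duhamel p \<phi> u t x = duhamel p \<phi> (\<lambda>s y. v (s, y)) t x" for x
      unfolding duhamel_def
      by (intro arg_cong2[where f="(+)"] refl Bochner_Integration.integral_cong) (auto simp: u_def split: split_indicator)
    also have "\<dots> x = heat_sg t \<phi>' x + (\<integral> z. duhamel_kernel t x z * fnl p (v z) \<partial>lborel)" for x
      using duhamel_eq[OF v int_v] heat_sg_cong_AE(1)[OF \<phi> \<phi>'l ae] by simp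
    finally have "u t x = duhamel p \<phi> u t x" for x
      using veq t' by (simp add: u_def)
    moreover have "integrable lebesgue (\<lambda>y. heat_kernel t (x - y) * \<phi> y)" for x
      unfolding heat_sg_cong_AE(2)[OF \<phi> \<phi>'l ae]
      using integrable_heat_kernel_mult[OF \<phi>' t'(1)] by (subst integrable_completion) auto
    moreover have "integrable lebesgue (\<lambda>z. duhamel_kernel t x z * fnl p (v z))" for x
      using int_v by (subst integrable_completion) auto
    ultimately show "AE x in lebesgue.
        integrable lebesgue (\<lambda>y. heat_kernel t (x - y) * \<phi> y) \<and>
        integrable lebesgue (\<lambda>z::real \<times> 'a. indicator {0<..<t} (fst z) *
             heat_kernel (t - fst z) (x - snd z) * fnl p (u (fst z) (snd z))) \<and>
        u t x = duhamel p \<phi> u t x"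
      unfolding eq by auto
    obtain M where "\<And>x. U (t, x) \<le> M" using bdd[OF t'] by auto
    then have "\<bar>u t x\<bar> \<le> M" for x using vU[OF t', of x] t' by (simp add: u_def) (meson order_trans)
    then show "\<exists>M. AE x in lebesgue. \<bar>u t x\<bar> \<le> M" by auto
  qed
  have int_u: "integrable lebesgue (u t)" if "t \<in> {0..<T}" for t
  proof (cases "t = 0")
    case True
    have "integrable lebesgue \<phi>'" using \<phi>' by (subst integrable_completion) auto
    then have "integrable lebesgue \<phi>" using integrable_cong_AE[OF \<phi> \<phi>'l ae] by simp
    moreover have "u 0 = \<phi>" by (rule ext) (simp add: u_def)
    ultimately show ?thesis by (simp add: True)
  next
    case False
    have "integrable lborel (\<lambda>x. v (t, x))"
      by (rule Bochner_Integration.integrable_bound[OF int[of t]]) (use False that vU[of t] U0 in auto)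
    moreover have "u t = (\<lambda>x. v (t, x))" by (rule ext) (simp add: u_def False)
    ultimately show ?thesis by (subst integrable_completion) auto
  qed
  have cont: "((\<lambda>t. \<integral> x. \<bar>u t x - u t0 x\<bar> \<partial>lebesgue) \<longlongrightarrow> 0) (at t0 within {0..<T})" if t0: "t0 \<in> {0..<T}" for t0
  proof (subst tendsto_at_iff_sequentially, intro allI impI)
    fix \<tau> :: "nat \<Rightarrow> real" assume \<tau>: "\<forall>n. \<tau> n \<in> {0..<T} - {t0}" "\<tau> \<longlonglongrightarrow> t0"
    define D where "D n = (\<integral>\<^sup>+ x. ennreal \<bar>\<integral> z. (duhamel_kernel (\<tau> n) x z - duhamel_kernel t0 x z) * g z \<partial>lborel\<bar> \<partial>lborel)" for n
    \<comment> \<open>At time 0 the kernel formula gives 0, because \<open>0 powr _ = 0\<close>,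
      instead of the identity; hence the case distinction.\<close>
    define h where "h t x = (if t = 0 then \<phi>' x else heat_sg t \<phi>' x)" for t x
    have hm [measurable]: "h t \<in> borel_measurable borel" for t
      unfolding h_def[abs_def] by (cases "t = 0") auto
    define E where "E n = (\<integral>\<^sup>+ x. ennreal \<bar>h (\<tau> n) x - h t0 x\<bar> \<partial>lborel)" for n
    have D: "D \<longlonglongrightarrow> 0" unfolding D_def by (rule duhamel_L1_continuous[OF g g0 \<tau>(2)])
    have E: "E \<longlonglongrightarrow> 0"
    \<comment> \<open>Strong continuity of the semigroup handles t0 = 0, continuity of the kernel in
      time handles t0 > 0.\<close>
    proof (cases "t0 = 0")
      case True
      then have "E n = heat_err (\<tau> n) \<phi>'" for n
        using \<tau>(1) by (simp add: E_def heat_err_def h_def)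
      moreover have "(\<lambda>n. heat_err (\<tau> n) \<phi>') \<longlonglongrightarrow> 0"
        using \<tau> True by (intro heat_err_tendsto_0 \<phi>') (auto simp: order.strict_iff_order)
      ultimately show ?thesis by (simp add: E_def[abs_def])
    next
      case False
      have "t0 > 0" using t0 False by auto
      then have "eventually (\<lambda>n. \<tau> n > 0) sequentially" using \<tau>(2) by (intro order_tendstoD)
      then obtain n0 where n0: "\<And>n. n \<ge> n0 \<Longrightarrow> \<tau> n > 0" by (auto simp: eventually_sequentially)
      have "(\<lambda>n. \<integral>\<^sup>+ x. ennreal \<bar>heat_sg (\<tau> (n + n0)) \<phi>' x - heat_sg t0 \<phi>' x\<bar> \<partial>lborel) \<longlonglongrightarrow> 0"
        by (rule heat_sg_L1_continuous[OF \<phi>' \<open>t0 > 0\<close> LIMSEQ_ignore_initial_segment[OF \<tau>(2)] n0]) simp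
      moreover have "\<tau> (n + n0) \<noteq> 0" for n using n0[of "n + n0"] by simp
      ultimately have "(\<lambda>n. E (n + n0)) \<longlonglongrightarrow> 0" using False by (simp add: E_def h_def)
      then show ?thesis by (rule LIMSEQ_offset)
    qed
    have uh: "AE x in lebesgue. u t x = h t x + (\<integral> z. duhamel_kernel t x z * g z \<partial>lborel)" if "t \<in> {0..<T}" for t
    proof (cases "t = 0")
      case True
      then show ?thesis using ae by (simp add: u_def h_def duhamel_kernel_def)
    next
      case False
      then show ?thesis using that veq' by (simp add: u_def h_def)
    qed
    have le: "ennreal \<bar>\<integral> x. \<bar>u (\<tau> n) x - u t0 x\<bar> \<partial>lebesgue\<bar> \<le> E n + D n" for n
    proof -
      have tn: "0 \<le> \<tau> n" "\<tau> n < T" "0 \<le> t0" "t0 < T" using \<tau>(1) t0 by auto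
      have uh1: "AE x in lebesgue. u (\<tau> n) x = h (\<tau> n) x + (\<integral> z. duhamel_kernel (\<tau> n) x z * g z \<partial>lborel)"
        by (rule uh) (use tn in simp)
      have uh2: "AE x in lebesgue. u t0 x = h t0 x + (\<integral> z. duhamel_kernel t0 x z * g z \<partial>lborel)"
        by (rule uh[OF t0])
      have "ennreal \<bar>\<integral> x. \<bar>u (\<tau> n) x - u t0 x\<bar> \<partial>lebesgue\<bar> \<le> (\<integral>\<^sup>+ x. ennreal \<bar>\<bar>u (\<tau> n) x - u t0 x\<bar>\<bar> \<partial>lebesgue)"
        by (rule ennreal_abs_integral_le)
      also have "\<dots> \<le> (\<integral>\<^sup>+ x. ennreal \<bar>h (\<tau> n) x - h t0 x\<bar>
         + ennreal \<bar>\<integral> z. (duhamel_kernel (\<tau> n) x z - duhamel_kernel t0 x z) * g z \<partial>lborel\<bar> \<partial>lebesgue)"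
      proof (rule nn_integral_mono_AE)
        show "AE x in lebesgue. ennreal \<bar>\<bar>u (\<tau> n) x - u t0 x\<bar>\<bar> \<le> ennreal \<bar>h (\<tau> n) x - h t0 x\<bar>
         + ennreal \<bar>\<integral> z. (duhamel_kernel (\<tau> n) x z - duhamel_kernel t0 x z) * g z \<partial>lborel\<bar>"
          using uh1 uh2
        proof eventually_elim
          case (elim x)
          have "u (\<tau> n) x - u t0 x = (h (\<tau> n) x - h t0 x)
              + (\<integral> z. (duhamel_kernel (\<tau> n) x z - duhamel_kernel t0 x z) * g z \<partial>lborel)"
            unfolding elim left_diff_distrib using intg[OF tn(1,2), of x] intg[OF tn(3,4), of x] by simp
          then show ?case
            by (simp add: ennreal_plus[symmetric] abs_triangle_ineq del: ennreal_plus)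
        qed
      qed
      also have "\<dots> = E n + D n"
        unfolding nn_integral_completion E_def D_def by (rule nn_integral_add) measurable
      finally show ?thesis .
    qed
    have ED: "(\<lambda>n. E n + D n) \<longlonglongrightarrow> 0" using tendsto_add[OF E D] by simp
    have "(\<lambda>n. ennreal \<bar>\<integral> x. \<bar>u (\<tau> n) x - u t0 x\<bar> \<partial>lebesgue\<bar>) \<longlonglongrightarrow> 0"
      by (rule tendsto_sandwich[OF always_eventually[OF allI[OF zero_le]] always_eventually[OF allI[OF le]] tendsto_const ED])
    then have "(\<lambda>n. \<bar>\<integral> x. \<bar>u (\<tau> n) x - u t0 x\<bar> \<partial>lebesgue\<bar>) \<longlonglongrightarrow> 0"
      by (intro tendsto_ennrealD) auto
    then show "((\<lambda>t. \<integral> x. \<bar>u t x - u t0 x\<bar> \<partial>lebesgue) \<circ> \<tau>) \<longlonglongrightarrow> 0"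
      unfolding comp_def by (rule tendsto_rabs_zero_cancel)
  qed
  have "mild_solution p \<phi> T u"
    unfolding mild_solution_def using int_sol int_u cont by (auto simp: u_def)
  moreover have "\<bar>u t x\<bar> \<le> U (t, x)" if "0 < t" "t < T" for t x
    using vU[OF that] that by (simp add: u_def)
  ultimately show ?thesis by (rule that)
qed

section \<open>A supersolution in the critical case\<close>

lemma nn_integral_FTC_open:
  fixes f F :: "real \<Rightarrow> real"
  assumes "a < b"
    and "\<And>x. a < x \<Longrightarrow> x < b \<Longrightarrow> (F has_real_derivative f x) (at x)"
    and "\<And>x. a < x \<Longrightarrow> x < b \<Longrightarrow> isCont f x"
    and nn: "\<And>x. a < x \<Longrightarrow> x < b \<Longrightarrow> 0 \<le> f x"
    and "(F \<longlongrightarrow> A) (at_right a)" "(F \<longlongrightarrow> B) (at_left b)"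
  shows "(\<integral>\<^sup>+ x. indicator {a<..<b} x * ennreal (f x) \<partial>lborel) = ennreal (B - A)"
proof -
  \<comment> \<open>The antiderivative enters only through its one-sided limits, so the integrand
    may be singular at the ends.\<close>
  have ftc: "set_integrable lborel (einterval a b) f" "(LBINT x=a..b. f x) = B - A"
    by (rule interval_integral_FTC_nonneg[where F=F]; use assms in \<open>auto simp: ereal_tendsto_simps\<close>)+
  have e: "einterval (ereal a) (ereal b) = {a<..<b}" by (auto simp: einterval_def)
  have "(\<integral>\<^sup>+ x. indicator {a<..<b} x * ennreal (f x) \<partial>lborel) = (\<integral>\<^sup>+ x. ennreal (indicator {a<..<b} x * f x) \<partial>lborel)"
    by (intro nn_integral_cong) (auto split: split_indicator)
  also have "\<dots> = ennreal (\<integral> x. indicator {a<..<b} x * f x \<partial>lborel)"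
    using ftc(1) nn unfolding set_integrable_def e
    by (intro nn_integral_eq_integral) (auto split: split_indicator)
  also have "(\<integral> x. indicator {a<..<b} x * f x \<partial>lborel) = B - A"
    using ftc(2) \<open>a < b\<close> by (simp add: interval_lebesgue_integral_def set_lebesgue_integral_def e)
  finally show ?thesis .
qed

lemma nn_integral_inverse_sqrt:
  assumes "0 < (t::real)"
  shows "(\<integral>\<^sup>+ s. indicator {0<..<t} s * ennreal (s powr (-1/2)) \<partial>lborel) = ennreal (2 * t powr (1/2))"
proof -
  have "(\<integral>\<^sup>+ s. indicator {0<..<t} s * ennreal (s powr (-1/2)) \<partial>lborel) = ennreal (2 * t powr (1/2) - 0)"
  proof (rule nn_integral_FTC_open[where F="\<lambda>s. 2 * s powr (1/2)"])
    show "((\<lambda>s. 2 * s powr (1/2)) has_real_derivative x powr (-1/2)) (at x)" if "0 < x" "x < t" for x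
      using that by (auto intro!: derivative_eq_intros)
    show "((\<lambda>s::real. 2 * s powr (1/2)) \<longlongrightarrow> 0) (at_right 0)" by real_asymp
    show "((\<lambda>s. 2 * s powr (1/2)) \<longlongrightarrow> 2 * t powr (1/2)) (at_left t)"
      using assms by (intro tendsto_intros) auto
  qed (use assms in \<open>auto intro!: continuous_intros\<close>)
  then show ?thesis by simp
qed

text \<open>The antiderivative (-ln s)^(-q)/q vanishes at 0 because q > 0. This one integral closes
  the existence estimate, gives the mass of the singular datum near the origin, and drives the
  improvement of exponents in the nonexistence proof.\<close>

lemma nn_integral_inverse_log_powr:
  assumes t: "0 < t" "t < 1" and q: "0 < q"
  shows "(\<integral>\<^sup>+ s. indicator {0<..<t} s * ennreal (s powr (-1) * (- ln s) powr (- q - 1)) \<partial>lborel)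
    = ennreal ((- ln t) powr (- q) / q)"
proof -
  have "(\<integral>\<^sup>+ s. indicator {0<..<t} s * ennreal (s powr (-1) * (- ln s) powr (- q - 1)) \<partial>lborel)
    = ennreal ((- ln t) powr (- q) / q - 0)"
  proof (rule nn_integral_FTC_open[where F="\<lambda>s. (- ln s) powr (- q) / q"])
    show "((\<lambda>s. (- ln s) powr (- q) / q) has_real_derivative x powr (-1) * (- ln x) powr (- q - 1)) (at x)"
      if "0 < x" "x < t" for x
    proof -
      have "ln x < 0" using that t by simp
      then show ?thesis
        using that t q by (auto intro!: derivative_eq_intros simp: powr_minus_divide[of x 1])
    qed
    show "isCont (\<lambda>x. x powr (-1) * (- ln x) powr (- q - 1)) x" if "0 < x" "x < t" for x
    proof -
      have "ln x < 0" using that t by simp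
      then show ?thesis using that by (auto intro!: continuous_intros)
    qed
    show "((\<lambda>s. (- ln s) powr (- q) / q) \<longlongrightarrow> 0) (at_right 0)" using q by real_asymp
    have "ln t < 0" using t by simp
    then show "((\<lambda>s. (- ln s) powr (- q) / q) \<longlongrightarrow> (- ln t) powr (- q) / q) (at_left t)"
      using t q by (intro tendsto_intros) auto
  qed (use t in auto)
  then show ?thesis by simp
qed

section \<open>Order, linearity and sup bounds for the semigroup\<close>

lemma heat_sg_nonneg:
  fixes f :: "'a::euclidean_space \<Rightarrow> real"
  assumes [measurable]: "f \<in> borel_measurable borel" and "\<And>y. 0 \<le> f y"
  shows "0 \<le> heat_sg t f x"
  using assms(2) by (simp add: heat_sg_lborel integral_nonneg_AE)

lemma heat_sg_mono:
  fixes f g :: "'a::euclidean_space \<Rightarrow> real"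
  assumes "integrable lborel f" "integrable lborel g" "0 < t" "\<And>y. f y \<le> g y"
  shows "heat_sg t f x \<le> heat_sg t g x"
proof -
  have [measurable]: "f \<in> borel_measurable borel" "g \<in> borel_measurable borel" using assms by auto
  show ?thesis using assms
    by (auto simp: heat_sg_lborel intro!: integral_mono integrable_heat_kernel_mult mult_left_mono)
qed

lemma heat_sg_add:
  fixes f g :: "'a::euclidean_space \<Rightarrow> real"
  assumes "integrable lborel f" "integrable lborel g" "0 < t"
  shows "heat_sg t (\<lambda>x. f x + g x) x = heat_sg t f x + heat_sg t g x"
proof -
  have [measurable]: "f \<in> borel_measurable borel" "g \<in> borel_measurable borel" using assms by auto
  show ?thesis
    using assms integrable_heat_kernel_mult[of f t x] integrable_heat_kernel_mult[of g t x]
    by (simp add: heat_sg_lborel distrib_left)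
qed

lemma heat_sg_cmult:
  fixes f :: "'a::euclidean_space \<Rightarrow> real"
  assumes [measurable]: "f \<in> borel_measurable borel"
  shows "heat_sg t (\<lambda>x. c * f x) x = c * heat_sg t f x"
  by (simp add: heat_sg_lborel mult.left_commute)

lemma heat_sg_le_const:
  fixes f :: "'a::euclidean_space \<Rightarrow> real"
  assumes f: "integrable lborel f" and t: "0 < t" and f0: "\<And>y. 0 \<le> f y" and K: "\<And>y. f y \<le> K"
  shows "heat_sg t f x \<le> K"
proof -
  have K0: "0 \<le> K" using f0[of x] K[of x] by simp
  have "ennreal (heat_sg t f x) = heat_nn t (\<lambda>y. ennreal (f y)) x"
    by (rule heat_sg_eq_heat_nn[OF f t f0])
  also have "\<dots> \<le> heat_nn t (\<lambda>y. ennreal K) x" by (rule heat_nn_mono) (intro ennreal_leI K)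
  also have "\<dots> = ennreal K" by (simp add: heat_nn_const t)
  finally show ?thesis using K0 by (simp add: ennreal_le_iff)
qed

lemma heat_sg_le_integral:
  fixes f :: "'a::euclidean_space \<Rightarrow> real"
  assumes f: "integrable lborel f" and t: "0 < t" and f0: "\<And>y. 0 \<le> f y"
  shows "heat_sg t f x \<le> t powr (- real DIM('a) / 2) * (\<integral> y. f y \<partial>lborel)"
proof -
  have [measurable]: "f \<in> borel_measurable borel" using f by auto
  have "heat_sg t f x \<le> (\<integral> y. t powr (- real DIM('a) / 2) * f y \<partial>lborel)"
    unfolding heat_sg_lborel[OF \<open>f \<in> borel_measurable borel\<close>]
    by (intro integral_mono integrable_heat_kernel_mult f t mult_right_mono heat_kernel_le f0)
       (use f in auto)
  then show ?thesis by simp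
qed

text \<open>For integrable data the sup bound \<open>t powr (- N / 2)\<close> improves from \<open>O\<close> to \<open>o\<close> as \<open>t\<close> tends to zero;
  this smallness replaces a smallness assumption on the data.\<close>

lemma heat_sg_small:
  fixes f :: "'a::euclidean_space \<Rightarrow> real"
  assumes f: "integrable lborel f" and f0: "\<And>y. 0 \<le> f y" and \<eta>: "0 < \<eta>"
  shows "eventually (\<lambda>t. \<forall>x. heat_sg t f x \<le> \<eta> * t powr (- real DIM('a) / 2)) (at_right 0)"
proof -
  have [measurable]: "f \<in> borel_measurable borel" using f by auto
  \<comment> \<open>The excess over height n has small L^1 norm for large n, and the truncated part
    contributes at most n, which is negligible against t^(-N/2).\<close>
  define r where "r n y = f y - min (f y) (real n)" for n y
  have rm [measurable]: "r n \<in> borel_measurable borel" for n unfolding r_def[abs_def] by measurable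
  have r0: "0 \<le> r n y" "r n y \<le> f y" for n y using f0[of y] by (auto simp: r_def)
  have ri: "integrable lborel (r n)" for n
    by (rule Bochner_Integration.integrable_bound[OF f]) (use r0 f0 in auto)
  have mi: "integrable lborel (\<lambda>y. min (f y) (real n))" for n
    by (rule Bochner_Integration.integrable_bound[OF f]) (use f0 in auto)
  have "(\<lambda>n. \<integral> y. r n y \<partial>lborel) \<longlonglongrightarrow> (\<integral> y. 0 \<partial>(lborel::'a measure))"
  proof (rule integral_dominated_convergence[OF _ _ f])
    show "AE y in lborel. (\<lambda>n. r n y) \<longlonglongrightarrow> 0"
    proof (intro AE_I2 tendsto_eventually)
      fix y
      obtain n0 where "f y \<le> real n0" using real_arch_simple by blast
      then show "eventually (\<lambda>n. r n y = 0) sequentially"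
        by (auto simp: r_def eventually_sequentially intro!: exI[of _ n0])
    qed
  qed (use r0 in auto)
  then have "eventually (\<lambda>n. (\<integral> y. r n y \<partial>lborel) < \<eta> / 2) sequentially"
    using \<eta> by (intro order_tendstoD) auto
  then obtain n where n: "(\<integral> y. r n y \<partial>lborel) < \<eta> / 2" by (auto simp: eventually_sequentially)
  have "eventually (\<lambda>t. real n \<le> \<eta> / 2 * t powr (- real DIM('a) / 2)) (at_right 0)"
  proof -
    have "real DIM('a) > 0" by simp
    then have "filterlim (\<lambda>t. \<eta> / 2 * t powr (- real DIM('a) / 2)) at_top (at_right 0)"
      using \<eta> by real_asymp
    then show ?thesis by (simp add: filterlim_at_top)
  qed
  moreover have "eventually (\<lambda>t. 0 < (t::real)) (at_right 0)" by (simp add: eventually_at_right_less)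
  ultimately show ?thesis
  proof eventually_elim
    case (elim t)
    show ?case
    proof
      fix x :: 'a
      have "heat_sg t f x = heat_sg t (\<lambda>y. min (f y) (real n) + r n y) x" by (simp add: r_def)
      also have "\<dots> = heat_sg t (\<lambda>y. min (f y) (real n)) x + heat_sg t (r n) x"
        by (rule heat_sg_add[OF mi ri \<open>0 < t\<close>])
      also have "\<dots> \<le> real n + t powr (- real DIM('a) / 2) * (\<integral> y. r n y \<partial>lborel)"
        using f0 by (intro add_mono heat_sg_le_const[OF mi \<open>0 < t\<close>] heat_sg_le_integral[OF ri \<open>0 < t\<close>] r0) auto
      also have "\<dots> \<le> \<eta> / 2 * t powr (- real DIM('a) / 2) + t powr (- real DIM('a) / 2) * (\<eta> / 2)"
        using elim n by (intro add_mono mult_left_mono) auto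
      finally show "heat_sg t f x \<le> \<eta> * t powr (- real DIM('a) / 2)" by (simp add: field_simps)
    qed
  qed
qed

text \<open>Where |v| exceeds \<open>K\<close> the weight is at least (ln K)^q, so the weighted term
  alone dominates |v|.\<close>

lemma log_split:
  fixes v q K :: real
  assumes "0 \<le> q" "1 < K"
  shows "\<bar>v\<bar> \<le> min \<bar>v\<bar> K + ln K powr (- q) * (\<bar>v\<bar> * ln (exp 1 + \<bar>v\<bar>) powr q)"
proof (cases "\<bar>v\<bar> \<le> K")
  case False
  have lK: "0 < ln K" using assms by simp
  have "ln K \<le> ln (exp 1 + \<bar>v\<bar>)" using False assms by (intro ln_mono) (auto intro: add_increasing)
  then have "ln K powr q \<le> ln (exp 1 + \<bar>v\<bar>) powr q" using lK assms by (intro powr_mono2) auto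
  then have "ln K powr (- q) * ln K powr q \<le> ln K powr (- q) * ln (exp 1 + \<bar>v\<bar>) powr q"
    by (intro mult_left_mono) auto
  moreover have "ln K powr (- q) * ln K powr q = 1" using lK by (simp flip: powr_add)
  ultimately have "\<bar>v\<bar> * 1 \<le> \<bar>v\<bar> * (ln K powr (- q) * ln (exp 1 + \<bar>v\<bar>) powr q)"
    by (intro mult_left_mono) auto
  then show ?thesis using assms by (simp add: mult.left_commute add_increasing)
qed simp

text \<open>The pointwise core. For the truncated part \<open>a\<close> the power 2/N is at most
  s^(-1/2). For the weighted part it is at most \<delta> L^(-2q/N) / s. The result is linear in
  \<open>A\<close> and \<open>B\<close>, as the semigroup law requires.\<close>

lemma supersolution_powr_bound:
  fixes A B C L N a \<delta> p q s :: real
  assumes N: "0 < N" and p: "p = 1 + 2 / N" and q: "N / 2 \<le> q" and s: "0 < s" and L: "1 \<le> L" and C: "0 \<le> C" and \<delta>: "0 < \<delta>"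
    and a: "0 \<le> a" "a \<le> A" "a \<le> s powr (- N / 4)"
    and A: "A \<le> a + C * (L powr (- q) * B)"
    and B: "0 \<le> B" "B \<le> \<delta> powr (N / 2) * s powr (- N / 2)"
  shows "(2 * A + L powr (- q) * B) powr p \<le>
    2 powr p * (2 powr p + (2 * C + 1) powr p) * (s powr (-1/2) * A + \<delta> * (s powr (-1) * L powr (- q - 1)) * B)"
proof -
  have p1: "1 < p" "p - 1 = 2 / N" using N p by auto
  define b where "b = L powr (- q) * B"
  have b0: "0 \<le> b" using B by (simp add: b_def)
  define D where "D = 2 * C + 1"
  have D: "1 \<le> D" using C by (simp add: D_def)
  have base: "v powr p = v * v powr (2 / N)" if "0 \<le> v" for v
    using that p by (cases "v = 0") (simp_all add: powr_add)
  have ap: "a powr p \<le> s powr (-1/2) * A"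
  proof -
    have "a powr (2 / N) \<le> (s powr (- N / 4)) powr (2 / N)" using a N by (intro powr_mono2) auto
    also have "\<dots> = s powr (-1/2)" using N by (simp add: powr_powr)
    finally have "a * a powr (2 / N) \<le> A * s powr (-1/2)" using a by (intro mult_mono) auto
    then show ?thesis using a by (simp add: base mult.commute)
  qed
  have bp: "b powr p \<le> \<delta> * (s powr (-1) * L powr (- q - 1)) * B"
  proof -
    have "b powr (2 / N) \<le> (L powr (- q) * (\<delta> powr (N / 2) * s powr (- N / 2))) powr (2 / N)"
      using b0 B N by (intro powr_mono2) (auto simp: b_def intro!: mult_left_mono)
    also have "\<dots> = L powr (- (2 * q / N)) * (\<delta> * s powr (-1))"
      using N \<delta> s L by (simp add: powr_mult powr_powr mult_ac)
    \<comment> \<open>This is where q >= N/2 enters: 2q/N >= 1 and L >= 1.\<close>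
    also have "\<dots> \<le> L powr (-1) * (\<delta> * s powr (-1))"
      using L N q \<delta> by (intro mult_right_mono powr_mono) (auto simp: field_simps)
    finally have "b * b powr (2 / N) \<le> b * (L powr (-1) * (\<delta> * s powr (-1)))"
      using b0 by (intro mult_left_mono)
    also have "\<dots> = \<delta> * (s powr (-1) * (L powr (- q) * L powr (- 1))) * B" by (simp add: b_def mult_ac)
    also have "L powr (- q) * L powr (- 1) = L powr (- q - 1)"
      by (simp only: powr_add[symmetric]) simp
    finally show ?thesis using b0 by (simp add: base)
  qed
  \<comment> \<open>With two summands, the sum is at most twice the maximum, so the p-th power
    splits into separate powers of \<open>a\<close> and \<open>b\<close>.\<close>
  have "2 * A + b \<le> 2 * a + D * b" using A by (simp add: D_def b_def algebra_simps)
  also have "\<dots> \<le> 2 * max (2 * a) (D * b)" by simp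
  finally have "(2 * A + b) powr p \<le> (2 * max (2 * a) (D * b)) powr p"
    using a b0 p1 by (intro powr_mono2) auto
  also have "\<dots> = 2 powr p * max (2 * a) (D * b) powr p"
    using a by (simp add: powr_mult)
  also have "max (2 * a) (D * b) powr p \<le> (2 * a) powr p + (D * b) powr p"
    by (simp add: max_def)
  also have "(2 * a) powr p + (D * b) powr p = 2 powr p * a powr p + D powr p * b powr p"
    using a b0 D by (simp add: powr_mult)
  also have "\<dots> \<le> (2 powr p + D powr p) * (a powr p + b powr p)"
    by (simp add: algebra_simps)
  also have "\<dots> \<le> (2 powr p + D powr p) * (s powr (-1/2) * A + \<delta> * (s powr (-1) * L powr (- q - 1)) * B)"
    by (intro mult_left_mono add_mono ap bp) auto
  finally show ?thesis by (simp add: b_def D_def mult.assoc)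
qed

lemma Linf_norm_le:
  assumes "0 \<le> M" "\<And>x. \<bar>f x\<bar> \<le> M"
  shows "Linf_norm f \<le> M"
  unfolding Linf_norm_def by (rule cInf_lower) (use assms in \<open>auto intro!: bdd_belowI[of _ 0]\<close>)

text \<open>Integrability of the representative itself follows because ln(e + |v|) >= 1 makes the
  weight at least 1.\<close>

lemma X_space_borel:
  fixes \<phi> :: "'a::euclidean_space \<Rightarrow> real"
  assumes \<phi>: "\<phi> \<in> X_space q" and q: "0 \<le> q"
  obtains \<phi>' where "AE x in lebesgue. \<phi> x = \<phi>' x" "integrable lborel \<phi>'"
    "integrable lborel (\<lambda>x. \<bar>\<phi>' x\<bar> * ln (exp 1 + \<bar>\<phi>' x\<bar>) powr q)"
proof -
  have m [measurable]: "\<phi> \<in> borel_measurable lebesgue"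
    and i: "integrable lebesgue (\<lambda>x. \<bar>\<phi> x\<bar> * (ln (exp 1 + \<bar>\<phi> x\<bar>)) powr q)"
    using \<phi> by (auto simp: X_space_def)
  obtain \<phi>' where \<phi>': "\<phi>' \<in> borel_measurable lborel" and ae: "AE x in lborel. \<phi> x = \<phi>' x"
    using completion_ex_borel_measurable_real[OF m] by auto
  have [measurable]: "\<phi>' \<in> borel_measurable borel" using \<phi>' by simp
  have ae': "AE x in lebesgue. \<phi> x = \<phi>' x" using ae by (rule AE_completion)
  let ?g = "\<lambda>x. \<bar>\<phi>' x\<bar> * ln (exp 1 + \<bar>\<phi>' x\<bar>) powr q"
  have "integrable lebesgue ?g"
  proof (rule integrable_cong_AE_imp[OF i])
    show "?g \<in> borel_measurable lebesgue" by (rule measurable_completion) measurable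
    show "AE x in lebesgue. \<bar>\<phi> x\<bar> * ln (exp 1 + \<bar>\<phi> x\<bar>) powr q = ?g x"
      using ae' by eventually_elim simp
  qed
  then have g: "integrable lborel ?g" by (subst (asm) integrable_completion) auto
  have "integrable lborel \<phi>'"
  proof (rule Bochner_Integration.integrable_bound[OF g])
    have "1 \<le> ln (exp 1 + \<bar>\<phi>' x\<bar>) powr q" for x
    proof -
      have "ln (exp 1) \<le> ln (exp 1 + \<bar>\<phi>' x\<bar>)" by (intro ln_mono) (auto intro: add_pos_nonneg)
      then show ?thesis using q by (intro ge_one_powr_ge_zero) auto
    qed
    then have "\<bar>\<phi>' x\<bar> * 1 \<le> \<bar>\<phi>' x\<bar> * ln (exp 1 + \<bar>\<phi>' x\<bar>) powr q" for x
      by (intro mult_left_mono) auto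
    then show "AE x in lborel. norm (\<phi>' x) \<le> norm (?g x)"
      by (simp add: abs_mult)
  qed simp
  with ae' g show ?thesis by (intro that)
qed

text \<open>The decay rate is read off from the supersolution: the truncated part is only t^(-N/4),
  and the weighted part carries (-ln t)^(-q) times the t^(-N/2) bound of the semigroup.\<close>

theorem mild_solution_exists:
  fixes \<phi> :: "'a::euclidean_space \<Rightarrow> real"
  assumes \<phi>: "\<phi> \<in> X_space q" and q: "real DIM('a) / 2 \<le> q"
  obtains T u C where "mild_solution (1 + 2 / real DIM('a)) \<phi> T u" "0 < C"
    "\<And>t. 0 < t \<Longrightarrow> t < T \<Longrightarrow> Linf_norm (u t) \<le> C * t powr (- real DIM('a) / 2) * (- ln t) powr (- q)"
proof -
  define N where "N = real DIM('a)"
  define p where "p = 1 + 2 / N"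
  have N: "0 < N" by (simp add: N_def)
  then have p: "1 < p" by (simp add: p_def)
  have qN: "N / 2 \<le> q" using q by (simp add: N_def)
  then have q0: "0 < q" using N by simp
  obtain \<phi>' where ae: "AE x in lebesgue. \<phi> x = \<phi>' x" and \<phi>': "integrable lborel \<phi>'"
    and \<psi>_int: "integrable lborel (\<lambda>x. \<bar>\<phi>' x\<bar> * ln (exp 1 + \<bar>\<phi>' x\<bar>) powr q)"
    by (rule X_space_borel[OF \<phi>]) (use q0 in auto)
  define \<psi> where "\<psi> x = \<bar>\<phi>' x\<bar> * ln (exp 1 + \<bar>\<phi>' x\<bar>) powr q" for x
  have \<psi>: "integrable lborel \<psi>" using \<psi>_int by (simp add: \<psi>_def[abs_def])
  have \<psi>0: "0 \<le> \<psi> x" for x by (simp add: \<psi>_def)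
  have abs_int: "integrable lborel (\<lambda>x. \<bar>\<phi>' x\<bar>)" using \<phi>' by simp
  have [measurable]: "\<phi>' \<in> borel_measurable borel" "\<psi> \<in> borel_measurable borel" using \<phi>' \<psi> by auto
  \<comment> \<open>Comes from ln(s^(-N/4)) = (N/4)(-ln s), raised to the power -q.\<close>
  define C where "C = (N / 4) powr (- q)"
  define D where "D = 2 * C + 1"
  define E where "E = 2 powr p * (2 powr p + D powr p)"
  \<comment> \<open>Chosen so that \<open>E * \<delta> / q = 1 / (2 * p)\<close>, the share of the
    weighted term in \<open>U / (2 * p)\<close>.\<close>
  define \<delta> where "\<delta> = q / (2 * p * E)"
  have C: "0 \<le> C" and D: "1 \<le> D" by (auto simp: C_def D_def)
  have E: "0 < E" unfolding E_def using D by (intro mult_pos_pos add_pos_pos) auto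
  have \<delta>: "0 < \<delta>" using q0 p E by (simp add: \<delta>_def)
  define A where "A s y = heat_sg s (\<lambda>x. \<bar>\<phi>' x\<bar>) y" for s y
  define B where "B s y = heat_sg s \<psi> y" for s y
  have A0: "0 \<le> A s y" for s y unfolding A_def by (rule heat_sg_nonneg) auto
  have B0: "0 \<le> B s y" for s y unfolding B_def by (rule heat_sg_nonneg) (auto simp: \<psi>0)
  define U where "U z = 2 * A (fst z) (snd z) + (- ln (fst z)) powr (- q) * B (fst z) (snd z)" for z
  have U0: "0 \<le> U z" for z by (simp add: U_def A0 B0)
  have Um [measurable]: "U \<in> borel_measurable borel"
    unfolding U_def[abs_def] A_def B_def by measurable
  \<comment> \<open>Four smallness conditions on the time: the o(t^(-N/2)) bound that replaces small
    data, the share of the S(t)|phi| term in the budget, -ln t > 1, and domination of t^(-N/4) by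
    the claimed rate.\<close>
  have "eventually (\<lambda>t. \<forall>x. heat_sg t \<psi> x \<le> \<delta> powr (N / 2) * t powr (- N / 2)) (at_right 0)"
    using heat_sg_small[OF \<psi> \<psi>0, of "\<delta> powr (N / 2)"] \<delta> by (simp add: N_def)
  moreover have "eventually (\<lambda>t. E * (2 * t powr (1/2)) \<le> 1 / p) (at_right 0)"
  proof -
    have "((\<lambda>t::real. E * (2 * t powr (1/2))) \<longlongrightarrow> 0) (at_right 0)" by real_asymp
    then have "eventually (\<lambda>t. E * (2 * t powr (1/2)) < 1 / p) (at_right 0)"
      using p by (intro order_tendstoD) auto
    then show ?thesis by eventually_elim simp
  qed
  moreover have "eventually (\<lambda>t. t < exp (-1::real)) (at_right 0)"
    by (intro order_tendstoD[OF tendsto_ident_at]) auto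
  moreover have "eventually (\<lambda>t::real. t powr (- N / 4) \<le> t powr (- N / 2) * (- ln t) powr (- q)) (at_right 0)"
    using N q0 by real_asymp
  ultimately have "eventually (\<lambda>t. (\<forall>x. heat_sg t \<psi> x \<le> \<delta> powr (N / 2) * t powr (- N / 2)) \<and>
     E * (2 * t powr (1/2)) \<le> 1 / p \<and> t < exp (-1) \<and> t powr (- N / 4) \<le> t powr (- N / 2) * (- ln t) powr (- q)) (at_right 0)"
    by (intro eventually_conj)
  then obtain b where b: "0 < b" and bb: "\<And>t x. 0 < t \<Longrightarrow> t < b \<Longrightarrow> B t x \<le> \<delta> powr (N / 2) * t powr (- N / 2)"
     "\<And>t. 0 < t \<Longrightarrow> t < b \<Longrightarrow> E * (2 * t powr (1/2)) \<le> 1 / p"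
     "\<And>t. 0 < t \<Longrightarrow> t < b \<Longrightarrow> t < exp (-1)"
     "\<And>t. 0 < t \<Longrightarrow> t < b \<Longrightarrow> t powr (- N / 4) \<le> t powr (- N / 2) * (- ln t) powr (- q)"
    unfolding eventually_at_right_field B_def by blast
  have L: "1 < - ln t" if "0 < t" "t < b" for t
  proof -
    have "ln t < ln (exp (-1))" using bb(3)[OF that] that by (intro ln_less_cancel_iff[THEN iffD2]) auto
    then show ?thesis by simp
  qed
  define a where "a s y = heat_sg s (\<lambda>x. min \<bar>\<phi>' x\<bar> (s powr (- N / 4))) y" for s y
  have min_int: "integrable lborel (\<lambda>x. min \<bar>\<phi>' x\<bar> (s powr (- N / 4)))" for s
    by (rule Bochner_Integration.integrable_bound[OF abs_int]) auto
  have a: "0 \<le> a s y" "a s y \<le> A s y" "a s y \<le> s powr (- N / 4)"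
    "A s y \<le> a s y + C * ((- ln s) powr (- q) * B s y)" if s: "0 < s" "s < b" for s y
  proof -
    show "0 \<le> a s y" unfolding a_def by (rule heat_sg_nonneg) auto
    show "a s y \<le> A s y" unfolding a_def A_def by (rule heat_sg_mono[OF min_int abs_int s(1)]) simp
    show "a s y \<le> s powr (- N / 4)" unfolding a_def by (rule heat_sg_le_const[OF min_int s(1)]) auto
    define K where "K = s powr (- N / 4)"
    have lK: "ln K = N / 4 * (- ln s)" using s by (simp add: K_def ln_powr)
    have "0 < ln K" unfolding lK using N L[OF s] by (intro mult_pos_pos) auto
    moreover have "0 < K" using s by (simp add: K_def)
    ultimately have K1: "1 < K" using ln_gt_zero_iff by blast
    have pw: "\<bar>\<phi>' x\<bar> \<le> min \<bar>\<phi>' x\<bar> K + ln K powr (- q) * \<psi> x" for x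
      unfolding \<psi>_def using q0 K1 by (intro log_split) auto
    have "A s y \<le> heat_sg s (\<lambda>x. min \<bar>\<phi>' x\<bar> K + ln K powr (- q) * \<psi> x) y"
      unfolding A_def using pw \<psi> min_int[of s] by (intro heat_sg_mono abs_int s) (simp_all add: K_def)
    also have "\<dots> = a s y + ln K powr (- q) * B s y"
      unfolding a_def B_def K_def
      using \<psi> min_int[of s] s by (subst heat_sg_add) (auto simp: heat_sg_cmult)
    also have "ln K powr (- q) = C * (- ln s) powr (- q)"
      unfolding lK C_def by (rule powr_mult)
    finally show "A s y \<le> a s y + C * ((- ln s) powr (- q) * B s y)" by (simp add: mult.assoc)
  qed
  have Ubound: "U (t, x) \<le> (2 + D * \<delta> powr (N / 2)) * t powr (- N / 2) * (- ln t) powr (- q)"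
    if t: "0 < t" "t < b" for t x
  proof -
    have "U (t, x) \<le> 2 * a t x + D * ((- ln t) powr (- q) * B t x)"
      using a(4)[OF t, of x] by (simp add: U_def D_def algebra_simps)
    also have "\<dots> \<le> 2 * (t powr (- N / 2) * (- ln t) powr (- q)) + D * ((- ln t) powr (- q) * (\<delta> powr (N / 2) * t powr (- N / 2)))"
      using order_trans[OF a(3)[OF t] bb(4)[OF t]] bb(1)[OF t] D
      by (intro add_mono mult_left_mono) auto
    finally show ?thesis by (simp add: algebra_simps)
  qed
  have Upowr: "U (s, y) powr p \<le> E * s powr (-1/2) * A s y + E * \<delta> * (s powr (-1) * (- ln s) powr (- q - 1)) * B s y"
    if s: "0 < s" "s < b" for s y
  proof -
    have "U (s, y) powr p \<le> E * (s powr (-1/2) * A s y + \<delta> * (s powr (-1) * (- ln s) powr (- q - 1)) * B s y)"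
      unfolding U_def fst_conv snd_conv E_def D_def
      using L[OF s] by (intro supersolution_powr_bound[where a="a s y" and N=N] N p_def qN s(1) C \<delta> a[OF s] B0 bb(1)[OF s]) auto
    then show ?thesis by (simp add: algebra_simps)
  qed
  have super: "(\<integral>\<^sup>+ z. ennreal (duhamel_kernel t x z) * ennreal (U z powr p) \<partial>lborel) \<le> ennreal (U (t, x) / (2 * p))"
    if t: "0 < t" "t < b" for t x
  proof -
    have A_nn: "ennreal (A s y) = heat_nn s (\<lambda>x. ennreal \<bar>\<phi>' x\<bar>) y" if "0 < s" for s y
      unfolding A_def by (rule heat_sg_eq_heat_nn[OF abs_int that]) simp
    have B_nn: "ennreal (B s y) = heat_nn s (\<lambda>x. ennreal (\<psi> x)) y" if "0 < s" for s y
      unfolding B_def by (rule heat_sg_eq_heat_nn[OF \<psi> that \<psi>0])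
    have [measurable]: "A s \<in> borel_measurable borel" "B s \<in> borel_measurable borel" for s
      unfolding A_def[abs_def] B_def[abs_def] by measurable
    \<comment> \<open>After the semigroup law both factors are evaluated at the final time
      \<open>t\<close> and leave the time integral.\<close>
    have heat_A: "heat_nn (t - s) (\<lambda>y. ennreal (A s y)) x = ennreal (A t x)"
      and heat_B: "heat_nn (t - s) (\<lambda>y. ennreal (B s y)) x = ennreal (B t x)" if "0 < s" "s < t" for s
      using that by (simp_all add: A_nn B_nn heat_nn_heat_nn)
    have "(\<integral>\<^sup>+ z. ennreal (duhamel_kernel t x z) * ennreal (U z powr p) \<partial>lborel) =
      (\<integral>\<^sup>+ s. indicator {0<..<t} s * heat_nn (t - s) (\<lambda>y. ennreal (U (s, y) powr p)) x \<partial>lborel)"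
      by (rule nn_integral_duhamel_kernel) measurable
    also have "\<dots> \<le> (\<integral>\<^sup>+ s. ennreal (E * A t x) * (indicator {0<..<t} s * ennreal (s powr (-1/2))) +
        ennreal (E * \<delta> * B t x) * (indicator {0<..<t} s * ennreal (s powr (-1) * (- ln s) powr (- q - 1))) \<partial>lborel)"
    proof (rule nn_integral_mono)
      fix s :: real
      show "indicator {0<..<t} s * heat_nn (t - s) (\<lambda>y. ennreal (U (s, y) powr p)) x \<le>
         ennreal (E * A t x) * (indicator {0<..<t} s * ennreal (s powr (-1/2))) +
         ennreal (E * \<delta> * B t x) * (indicator {0<..<t} s * ennreal (s powr (-1) * (- ln s) powr (- q - 1)))"
      proof (cases "s \<in> {0<..<t}")
        case True
        then have s: "0 < s" "s < t" "s < b" using t by auto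
        have "heat_nn (t - s) (\<lambda>y. ennreal (U (s, y) powr p)) x \<le>
          heat_nn (t - s) (\<lambda>y. ennreal (E * s powr (-1/2)) * ennreal (A s y) + ennreal (E * \<delta> * (s powr (-1) * (- ln s) powr (- q - 1))) * ennreal (B s y)) x"
          using Upowr[OF s(1,3)] E \<delta> A0 B0
          by (intro heat_nn_mono) (simp add: ennreal_mult[symmetric] ennreal_plus[symmetric] ennreal_leI del: ennreal_plus)
        also have "\<dots> = ennreal (E * s powr (-1/2)) * ennreal (A t x) + ennreal (E * \<delta> * (s powr (-1) * (- ln s) powr (- q - 1))) * ennreal (B t x)"
          using s by (simp add: heat_nn_add heat_nn_cmult heat_A heat_B)
        finally show ?thesis
          using True E \<delta> A0 B0 by (simp add: ennreal_mult[symmetric] mult_ac)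
      qed simp
    qed
    also have "\<dots> = ennreal (E * A t x) * ennreal (2 * t powr (1/2)) + ennreal (E * \<delta> * B t x) * ennreal ((- ln t) powr (- q) / q)"
    proof -
      have "t < 1" using bb(3)[OF t] exp_le_one_iff[of "-1::real"] by linarith
      then show ?thesis
        unfolding nn_integral_inverse_sqrt[OF t(1), symmetric] nn_integral_inverse_log_powr[OF t(1) \<open>t < 1\<close> q0, symmetric]
        by (simp add: nn_integral_add nn_integral_cmult)
    qed
    also have "\<dots> = ennreal (E * (2 * t powr (1/2)) * A t x + E * \<delta> / q * ((- ln t) powr (- q) * B t x))"
      using E \<delta> q0 A0 B0 by (simp add: ennreal_mult[symmetric] ennreal_plus[symmetric] mult_ac del: ennreal_plus)
    also have "\<dots> \<le> ennreal (U (t, x) / (2 * p))"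
    proof (rule ennreal_leI)
      \<comment> \<open>\<open>U / (2 * p)\<close> is A/p plus L^(-q) B/(2p); the two terms are
        matched separately.\<close>
      have "E * (2 * t powr (1/2)) * A t x \<le> 1 / p * A t x"
        by (intro mult_right_mono bb(2)[OF t] A0)
      moreover have "E * \<delta> / q = 1 / (2 * p)" using E q0 p by (simp add: \<delta>_def)
      ultimately show "E * (2 * t powr (1/2)) * A t x + E * \<delta> / q * ((- ln t) powr (- q) * B t x) \<le> U (t, x) / (2 * p)"
        using p by (simp add: U_def add_divide_distrib)
    qed
    finally show ?thesis .
  qed
  \<comment> \<open>Strictly below \<open>b\<close>, so that \<open>super\<close> is available at
    the final time \<open>T\<close> itself.\<close>
  define T where "T = b / 2"
  have T: "0 < T" "T < b" using b by (auto simp: T_def)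
  have U_int: "integrable lborel (\<lambda>x. U (t, x))" if "0 < t" for t
    unfolding U_def fst_conv snd_conv A_def B_def
    using integrable_heat_sg[OF abs_int that] integrable_heat_sg[OF \<psi> that] by simp
  \<comment> \<open>Since the heat kernel has mass 1, integrating the supersolution inequality at
    time \<open>T\<close> over space bounds the whole space-time integral of U^p by the L^1 norm of
    \<open>U\<close> at time \<open>T\<close>.\<close>
  have "(\<integral>\<^sup>+ z. indicator {0<..<T} (fst z) * ennreal (U z powr p) \<partial>lborel) < \<infinity>"
  proof -
    have "(\<integral>\<^sup>+ z. indicator {0<..<T} (fst z) * ennreal (U z powr p) \<partial>lborel) =
      (\<integral>\<^sup>+ z. \<integral>\<^sup>+ x. ennreal (duhamel_kernel T x z) * ennreal (U z powr p) \<partial>lborel \<partial>lborel)"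
    proof (intro nn_integral_cong)
      fix z :: "real \<times> 'a"
      show "indicator {0<..<T} (fst z) * ennreal (U z powr p) = (\<integral>\<^sup>+ x. ennreal (duhamel_kernel T x z) * ennreal (U z powr p) \<partial>lborel)"
        by (cases "fst z \<in> {0<..<T}")
           (auto simp: duhamel_kernel_def nn_integral_multc nn_integral_heat_kernel_diff)
    qed
    also have "\<dots> = (\<integral>\<^sup>+ x. \<integral>\<^sup>+ z. ennreal (duhamel_kernel T x z) * ennreal (U z powr p) \<partial>lborel \<partial>lborel)"
      by (rule lborel_pair.Fubini') measurable
    also have "\<dots> \<le> (\<integral>\<^sup>+ x. ennreal (U (T, x) / (2 * p)) \<partial>lborel)"
      by (intro nn_integral_mono super T)
    also have "\<dots> < \<infinity>"
      using U_int[OF T(1)] U0 p by (subst nn_integral_eq_integral) auto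
    finally show ?thesis .
  qed
  then have intp: "integrable lborel (\<lambda>z. indicator {0<..<T} (fst z) * U z powr p)"
  proof (subst integrable_iff_bounded, intro conjI)
    show "(\<lambda>z. indicator {0<..<T} (fst z) * U z powr p) \<in> borel_measurable lborel"
      unfolding indicator_def greaterThanLessThan_iff by measurable
  qed (simp add: abs_mult ennreal_mult ennreal_indicator)
  have lin: "\<bar>heat_sg t \<phi>' x\<bar> \<le> U (t, x) / 2" if "0 < t" for t x
  proof -
    have "heat_sg t \<phi>' x \<le> A t x" unfolding A_def by (rule heat_sg_mono[OF \<phi>' abs_int that]) auto
    moreover have "heat_sg t (\<lambda>x. - 1 * \<phi>' x) x \<le> A t x"
      unfolding A_def by (rule heat_sg_mono[OF _ abs_int that]) (use \<phi>' in auto)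
    ultimately have "\<bar>heat_sg t \<phi>' x\<bar> \<le> A t x" by (subst (asm) heat_sg_cmult) auto
    also have "\<dots> \<le> U (t, x) / 2" by (simp add: U_def B0)
    finally show ?thesis .
  qed
  have \<phi>m: "\<phi> \<in> borel_measurable lebesgue" using \<phi> by (simp add: X_space_def)
  obtain u where u: "mild_solution p \<phi> T u" "\<And>t x. 0 < t \<Longrightarrow> t < T \<Longrightarrow> \<bar>u t x\<bar> \<le> U (t, x)"
  proof (rule mild_solution_of_supersolution[OF p T(1) \<phi>m \<phi>' ae Um U0 lin])
    show "\<exists>M. \<forall>x. U (t, x) \<le> M" if "0 < t" "t < T" for t
      using Ubound[of t] that T by (intro exI allI) auto
    show "(\<integral>\<^sup>+ z. ennreal (duhamel_kernel t x z) * ennreal (U z powr p) \<partial>lborel) \<le> ennreal (U (t, x) / (2 * p))"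
      if "0 < t" "t < T" for t x using super that T by auto
  qed (use U_int intp in auto)
  have "Linf_norm (u t) \<le> (2 + D * \<delta> powr (N / 2)) * t powr (- N / 2) * (- ln t) powr (- q)" if "0 < t" "t < T" for t
    using D that T u(2)[OF that]
    by (intro Linf_norm_le order_trans[OF u(2)[OF that] Ubound]) auto
  then show ?thesis
    using u(1) D by (intro that[of T u "2 + D * \<delta> powr (N / 2)"]) (auto simp: N_def p_def intro!: add_pos_nonneg)
qed

section \<open>Radial integrals\<close>

text \<open>Polar coordinates for radial functions, through the distribution of
  \<open>- norm x\<close>. The sign turns the half-lines that determine a measure into balls, which
  have finite volume; with \<open>norm x\<close> they would be complements of balls.\<close>

lemma nn_integral_norm:
  fixes h :: "real \<Rightarrow> ennreal"
  assumes [measurable]: "h \<in> borel_measurable borel"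
  shows "(\<integral>\<^sup>+ x. h (norm (x::'a::euclidean_space)) \<partial>lborel) =
    (\<integral>\<^sup>+ r. indicator {0<..} r * ennreal (real DIM('a) * unit_ball_vol (real DIM('a)) * r ^ (DIM('a) - 1)) * h r \<partial>lborel)"
proof -
  define n where "n = DIM('a)"
  define w where "w = unit_ball_vol (real n)"
  have n: "n > 0" by (simp add: n_def)
  have w: "w > 0" by (simp add: w_def)
  define d where "d r = indicator {..<0} r * ennreal (real n * w * (- r) ^ (n - 1))" for r
  have [measurable]: "d \<in> borel_measurable borel" unfolding d_def[abs_def] by measurable
  have eq: "emeasure (distr lborel borel (\<lambda>x::'a. - norm x)) {c<..} = (if c < 0 then ennreal (w * (- c) ^ n) else 0)" for c
  proof -
    have "emeasure (distr lborel borel (\<lambda>x::'a. - norm x)) {c<..} = emeasure lborel (ball (0::'a) (- c))"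
      by (subst emeasure_distr) (auto intro!: arg_cong[where f="emeasure lborel"] simp: vimage_def)
    moreover have "ball (0::'a) (- c) = {}" if "\<not> c < 0" using that by (intro ball_empty) simp
    ultimately show ?thesis by (cases "c < 0") (simp_all add: emeasure_ball n_def w_def)
  qed
  have eq2: "emeasure (density lborel d) {c<..} = (if c < 0 then ennreal (w * (- c) ^ n) else 0)" for c
  proof -
    have "emeasure (density lborel d) {c<..} = (\<integral>\<^sup>+ r. d r * indicator {c<..} r \<partial>lborel)"
      by (simp add: emeasure_density)
    also have "\<dots> = (\<integral>\<^sup>+ r. indicator {c<..<0} r * ennreal (real n * w * (- r) ^ (n - 1)) \<partial>lborel)"
      unfolding d_def by (intro nn_integral_cong) (auto split: split_indicator)
    also have "\<dots> = (if c < 0 then ennreal (w * (- c) ^ n) else 0)"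
    proof (cases "c < 0")
      case True
      have "(\<integral>\<^sup>+ r. indicator {c<..<0} r * ennreal (real n * w * (- r) ^ (n - 1)) \<partial>lborel) = ennreal (0 - - (w * (- c) ^ n))"
      proof (rule nn_integral_FTC_open[where F="\<lambda>r. - (w * (- r) ^ n)"])
        show "((\<lambda>r. - (w * (- r) ^ n)) has_real_derivative real n * w * (- x) ^ (n - 1)) (at x)" for x
          by (auto intro!: derivative_eq_intros)
        have "((\<lambda>r. - (w * (- r) ^ n)) \<longlongrightarrow> - (w * (- 0) ^ n)) (at_left 0)"
          by (intro tendsto_intros)
        then show "((\<lambda>r. - (w * (- r) ^ n)) \<longlongrightarrow> 0) (at_left 0)" using n by (simp add: zero_power)
        show "((\<lambda>r. - (w * (- r) ^ n)) \<longlongrightarrow> - (w * (- c) ^ n)) (at_right c)" by (intro tendsto_intros)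
      qed (use True w in \<open>auto intro!: continuous_intros\<close>)
      then show ?thesis using True by simp
    next
      case False
      then have "{c<..<0} = {}" by auto
      then show ?thesis using False by simp
    qed
    finally show ?thesis .
  qed
  have M: "distr lborel borel (\<lambda>x::'a. - norm x) = density lborel d"
    by (rule measure_eqI_lessThan) (auto simp: eq eq2)
  have "(\<integral>\<^sup>+ x. h (norm (x::'a)) \<partial>lborel) = (\<integral>\<^sup>+ r. h (- r) \<partial>distr lborel borel (\<lambda>x::'a. - norm x))"
    by (subst nn_integral_distr) auto
  also have "\<dots> = (\<integral>\<^sup>+ r. d r * h (- r) \<partial>lborel)"
    unfolding M by (rule nn_integral_density) auto
  also have "\<dots> = (\<integral>\<^sup>+ r. d (- r) * h r \<partial>lborel)"
    using nn_integral_real_affine[of "\<lambda>r. d r * h (- r)" "-1" 0] by simp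
  also have "\<dots> = (\<integral>\<^sup>+ r. indicator {0<..} r * ennreal (real n * w * r ^ (n - 1)) * h r \<partial>lborel)"
    unfolding d_def by (intro nn_integral_cong) (auto split: split_indicator)
  finally show ?thesis by (simp add: n_def w_def)
qed

text \<open>The surface factor r^(N-1) reduces r^(-N) to 1/r, which leaves the logarithmic integral
  in one variable.\<close>

lemma nn_integral_radial_log:
  assumes r: "0 < r" "r < 1" and \<alpha>: "0 < \<alpha>"
  shows "(\<integral>\<^sup>+ x. indicator (ball (0::'a::euclidean_space) r) x *
      ennreal (norm x powr (- real DIM('a)) * (- ln (norm x)) powr (- \<alpha> - 1)) \<partial>lborel)
    = ennreal (real DIM('a) * unit_ball_vol (real DIM('a)) * ((- ln r) powr (- \<alpha>) / \<alpha>))"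
proof -
  define h where "h \<rho> = indicator {..<r} \<rho> * ennreal (\<rho> powr (- real DIM('a)) * (- ln \<rho>) powr (- \<alpha> - 1))" for \<rho>
  have [measurable]: "h \<in> borel_measurable borel" unfolding h_def[abs_def] by measurable
  define k where "k = real DIM('a) * unit_ball_vol (real DIM('a))"
  have k: "0 \<le> k" by (simp add: k_def)
  have "(\<integral>\<^sup>+ x. indicator (ball (0::'a) r) x *
      ennreal (norm x powr (- real DIM('a)) * (- ln (norm x)) powr (- \<alpha> - 1)) \<partial>lborel) = (\<integral>\<^sup>+ x. h (norm (x::'a)) \<partial>lborel)"
    by (intro nn_integral_cong) (auto simp: h_def split: split_indicator)
  also have "\<dots> = (\<integral>\<^sup>+ \<rho>. indicator {0<..} \<rho> * ennreal (k * \<rho> ^ (DIM('a) - 1)) * h \<rho> \<partial>lborel)"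
    unfolding k_def by (rule nn_integral_norm) measurable
  also have "\<dots> = (\<integral>\<^sup>+ \<rho>. ennreal k * (indicator {0<..<r} \<rho> * ennreal (\<rho> powr (-1) * (- ln \<rho>) powr (- \<alpha> - 1))) \<partial>lborel)"
  proof (intro nn_integral_cong)
    fix \<rho> :: real
    show "indicator {0<..} \<rho> * ennreal (k * \<rho> ^ (DIM('a) - 1)) * h \<rho> =
        ennreal k * (indicator {0<..<r} \<rho> * ennreal (\<rho> powr (-1) * (- ln \<rho>) powr (- \<alpha> - 1)))"
    proof (cases "0 < \<rho> \<and> \<rho> < r")
      case True
      have "\<rho> ^ (DIM('a) - 1) * \<rho> powr (- real DIM('a)) = \<rho> powr (-1)"
        using True by (simp add: powr_realpow[symmetric] powr_add[symmetric] of_nat_diff Suc_leI)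
      then show ?thesis
        using True k by (simp add: h_def ennreal_mult[symmetric] mult.assoc[symmetric]) (simp add: mult.assoc)
    qed (auto simp: h_def)
  qed
  also have "\<dots> = ennreal k * ennreal ((- ln r) powr (- \<alpha>) / \<alpha>)"
    unfolding nn_integral_inverse_log_powr[OF r \<alpha>, symmetric] by (rule nn_integral_cmult) measurable
  also have "\<dots> = ennreal (k * ((- ln r) powr (- \<alpha>) / \<alpha>))" using k \<alpha> by (simp add: ennreal_mult[symmetric])
  finally show ?thesis by (simp add: k_def)
qed

section \<open>The singular initial datum\<close>

text \<open>The datum of the theorem with \<beta> = N/2 - \<epsilon>. The exponent is normalised so
  that its mass in a small ball of radius r is a multiple of (-ln r)^(-\<beta>).\<close>

definition log_datum :: "real \<Rightarrow> 'a::euclidean_space \<Rightarrow> real" where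
  "log_datum \<beta> x = (if norm x < exp (-1) then norm x powr (- real DIM('a)) * (- ln (norm x)) powr (- \<beta> - 1) else 0)"

lemma borel_measurable_log_datum [measurable]: "log_datum \<beta> \<in> borel_measurable borel"
  unfolding log_datum_def[abs_def] by measurable

lemma log_datum_nonneg: "0 \<le> log_datum \<beta> x"
  by (simp add: log_datum_def)

text \<open>With r = |x| < 1/e, both e and the datum are at most r^(-N), and 2 <= r^(-2); so e plus
  the datum is at most r^(-(N+2)).\<close>

lemma log_datum_log_le:
  fixes x :: "'a::euclidean_space"
  assumes \<beta>: "0 < \<beta>" and x: "0 < norm x" "norm x < exp (-1)"
  shows "ln (exp 1 + log_datum \<beta> x) \<le> (real DIM('a) + 2) * (- ln (norm x))"
proof -
  define r where "r = norm x"
  define N where "N = real DIM('a)"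
  have r: "0 < r" "r < exp (-1)" "ln r < -1" and N: "1 \<le> N"
    using x ln_less_cancel_iff[of "norm x" "exp (-1)"] by (auto simp: r_def N_def Suc_le_eq)
  have "- ln r \<noteq> 0" using r(3) by linarith
  then have "(- ln r) powr 0 = 1" by (simp only: powr_zero_eq_one if_False)
  moreover have "(- ln r) powr (- \<beta> - 1) \<le> (- ln r) powr 0" using r(3) \<beta> by (intro powr_mono) linarith+
  ultimately have "log_datum \<beta> x \<le> r powr (- N)"
    using r by (simp add: log_datum_def r_def N_def mult_left_le)
  moreover have "exp 1 \<le> r powr (- N)"
  proof -
    have "exp 1 \<le> exp (- N * ln r)" using r N mult_mono[of 1 N 1 "- ln r"] by simp
    then show ?thesis using r by (simp add: powr_def)
  qed
  ultimately have "exp 1 + log_datum \<beta> x \<le> 2 * r powr (- N)" by simp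
  also have "\<dots> \<le> r powr (- 2) * r powr (- N)"
  proof -
    have "2 \<le> exp (- 2 * ln r)" using exp_ge_add_one_self[of "- 2 * ln r"] r by simp
    then have "2 \<le> r powr (- 2)" using r by (simp add: powr_def)
    then show ?thesis by (rule mult_right_mono) simp
  qed
  also have "\<dots> = r powr (- (N + 2))" by (simp add: add.commute flip: powr_add)
  finally have "ln (exp 1 + log_datum \<beta> x) \<le> ln (r powr (- (N + 2)))"
    by (intro ln_mono) (auto intro: add_pos_nonneg log_datum_nonneg)
  also have "\<dots> = (N + 2) * (- ln r)" using r by (simp add: ln_powr algebra_simps)
  finally show ?thesis by (simp add: r_def N_def)
qed

text \<open>The weight costs a factor (-ln |x|)^q, which changes the exponent parameter from \<beta>
  to \<beta> - q; this is still positive, so the radial integral is finite.\<close>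

lemma log_datum_in_X_space:
  assumes q: "0 \<le> q" "q < \<beta>"
  shows "(log_datum \<beta> :: 'a::euclidean_space \<Rightarrow> real) \<in> X_space q"
proof -
  let ?\<phi> = "log_datum \<beta> :: 'a \<Rightarrow> real"
  let ?g = "\<lambda>x. \<bar>?\<phi> x\<bar> * ln (exp 1 + \<bar>?\<phi> x\<bar>) powr q"
  define N where "N = real DIM('a)"
  define K where "K = (N + 2) powr q"
  have [measurable]: "ball (0::'a) (exp (-1)) \<in> sets borel" by simp
  have m: "?\<phi> \<in> borel_measurable lebesgue" by (rule measurable_completion) measurable
  have "(\<integral>\<^sup>+ x. ennreal (norm (?g x)) \<partial>lborel) \<le>
    (\<integral>\<^sup>+ x. ennreal K * (indicator (ball 0 (exp (-1))) x * ennreal (norm (x::'a) powr (- real DIM('a)) * (- ln (norm x)) powr (- (\<beta> - q) - 1))) \<partial>lborel)"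
  proof (rule nn_integral_mono)
    fix x :: 'a
    show "ennreal (norm (?g x)) \<le> ennreal K * (indicator (ball 0 (exp (-1))) x * ennreal (norm x powr (- real DIM('a)) * (- ln (norm x)) powr (- (\<beta> - q) - 1)))"
    proof (cases "0 < norm x \<and> norm x < exp (-1)")
      case True
      have "ln (norm x) < -1" using True ln_less_cancel_iff[of "norm x" "exp (-1)"] by auto
      then have L: "1 < - ln (norm x)" by simp
      have "0 \<le> ln (exp 1 + ?\<phi> x)"
        using log_datum_nonneg[of \<beta> x] exp_ge_add_one_self[of "1::real"] by (intro ln_ge_zero) linarith
      then have "ln (exp 1 + ?\<phi> x) powr q \<le> ((N + 2) * (- ln (norm x))) powr q"
        using log_datum_log_le[of \<beta> x] True q unfolding N_def by (intro powr_mono2) auto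
      also have "\<dots> = K * (- ln (norm x)) powr q" unfolding K_def by (rule powr_mult)
      finally have "?\<phi> x * ln (exp 1 + ?\<phi> x) powr q \<le> ?\<phi> x * (K * (- ln (norm x)) powr q)"
        by (intro mult_left_mono log_datum_nonneg)
      also have "\<dots> = K * (norm x powr (- real DIM('a)) * ((- ln (norm x)) powr (- \<beta> - 1) * (- ln (norm x)) powr q))"
        using True by (simp add: log_datum_def)
      also have "(- ln (norm x)) powr (- \<beta> - 1) * (- ln (norm x)) powr q = (- ln (norm x)) powr (- (\<beta> - q) - 1)"
        by (simp flip: powr_add add: algebra_simps)
      finally show ?thesis
        using True log_datum_nonneg[of \<beta> x]
        by (simp add: ennreal_mult[symmetric] K_def ennreal_leI)
    qed (auto simp: log_datum_def)
  qed
  also have "\<dots> = ennreal K * (\<integral>\<^sup>+ x. indicator (ball 0 (exp (-1))) x * ennreal (norm (x::'a) powr (- real DIM('a)) * (- ln (norm x)) powr (- (\<beta> - q) - 1)) \<partial>lborel)"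
    by (rule nn_integral_cmult) measurable
  also have "\<dots> < \<infinity>"
    using q by (subst nn_integral_radial_log) (auto simp: ennreal_mult_less_top)
  finally have g: "integrable lborel ?g" by (simp add: integrable_iff_bounded)
  have phi: "integrable lborel ?\<phi>"
  proof (rule Bochner_Integration.integrable_bound[OF g])
    have "1 \<le> ln (exp 1 + \<bar>?\<phi> x\<bar>) powr q" for x
    proof -
      have "ln (exp 1) \<le> ln (exp 1 + \<bar>?\<phi> x\<bar>)" by (intro ln_mono) (auto intro: add_pos_nonneg)
      then show ?thesis using q by (intro ge_one_powr_ge_zero) auto
    qed
    then have "\<bar>?\<phi> x\<bar> * 1 \<le> ?g x" for x by (intro mult_left_mono) auto
    then show "AE x in lborel. norm (?\<phi> x) \<le> norm (?g x)" by (simp add: abs_mult)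
  qed simp
  have "integrable lebesgue ?g" using g by (subst integrable_completion) auto
  moreover have phil: "integrable lebesgue ?\<phi>" using phi by (subst integrable_completion) auto
  moreover have "set_integrable lebesgue K ?\<phi>" if "compact K" for K
    unfolding set_integrable_def using that lmeasurable_compact[of K]
    by (intro integrable_mult_indicator phil) (simp add: fmeasurableD)
  ultimately show ?thesis using m by (simp add: X_space_def)
qed

section \<open>Lower bounds for the heat flow on parabolic balls |x| <= sqrt t\<close>

lemma heat_kernel_lower_bound:
  fixes x y :: "'a::euclidean_space"
  assumes t: "0 < t" and s: "t / 2 \<le> s" "s \<le> t" and xy: "norm x \<le> sqrt t" "norm y \<le> sqrt t"
  shows "(4 * pi) powr (- real DIM('a) / 2) * exp (-2) * t powr (- real DIM('a) / 2) \<le> heat_kernel s (x - y)"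
proof -
  have s0: "0 < s" using s t by simp
  \<comment> \<open>Two points of the ball satisfy |x - y|^2 <= 4t, and s >= t/2 then bounds the
    Gaussian exponent by 2.\<close>
  have "norm (x - y) \<le> 2 * sqrt t" using norm_triangle_ineq4[of x y] xy by simp
  then have "(norm (x - y))\<^sup>2 \<le> (2 * sqrt t)\<^sup>2" by (intro power_mono) auto
  also have "\<dots> = 4 * t" using t by (simp add: power_mult_distrib)
  finally have "(norm (x - y))\<^sup>2 / (4 * s) \<le> 2" using s s0 by (simp add: field_simps)
  then have "exp (-2) \<le> exp (- (norm (x - y))\<^sup>2 / (4 * s))" by simp
  moreover have "(4 * pi * t) powr (- real DIM('a) / 2) \<le> (4 * pi * s) powr (- real DIM('a) / 2)"
    using s s0 by (intro powr_mono2') auto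
  ultimately have "(4 * pi * t) powr (- real DIM('a) / 2) * exp (-2) \<le> heat_kernel s (x - y)"
    unfolding heat_kernel_def by (intro mult_mono) auto
  moreover have "(4 * pi * t) powr (- real DIM('a) / 2) = (4 * pi) powr (- real DIM('a) / 2) * t powr (- real DIM('a) / 2)"
    by (rule powr_mult)
  ultimately show ?thesis by (simp add: mult_ac)
qed

lemma heat_nn_lower_bound:
  fixes x :: "'a::euclidean_space" and f :: "'a \<Rightarrow> ennreal"
  assumes [measurable]: "f \<in> borel_measurable borel" "S \<in> sets borel"
    and t: "0 < t" and s: "t / 2 \<le> s" "s \<le> t" and x: "norm x \<le> sqrt t" and S: "S \<subseteq> cball 0 (sqrt t)"
  shows "ennreal ((4 * pi) powr (- real DIM('a) / 2) * exp (-2) * t powr (- real DIM('a) / 2)) *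
     (\<integral>\<^sup>+ y. indicator S y * f y \<partial>lborel) \<le> heat_nn s f x"
proof -
  have "ennreal ((4 * pi) powr (- real DIM('a) / 2) * exp (-2) * t powr (- real DIM('a) / 2)) *
     (\<integral>\<^sup>+ y. indicator S y * f y \<partial>lborel) =
    (\<integral>\<^sup>+ y. ennreal ((4 * pi) powr (- real DIM('a) / 2) * exp (-2) * t powr (- real DIM('a) / 2)) * (indicator S y * f y) \<partial>lborel)"
    by (rule nn_integral_cmult[symmetric]) measurable
  also have "\<dots> \<le> heat_nn s f x"
    unfolding heat_nn_def
  proof (rule nn_integral_mono)
    fix y
    show "ennreal ((4 * pi) powr (- real DIM('a) / 2) * exp (-2) * t powr (- real DIM('a) / 2)) * (indicator S y * f y)
      \<le> ennreal (heat_kernel s (x - y)) * f y"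
    proof (cases "y \<in> S")
      case True
      then have "norm y \<le> sqrt t" using S by auto
      then have "ennreal ((4 * pi) powr (- real DIM('a) / 2) * exp (-2) * t powr (- real DIM('a) / 2)) * f y
          \<le> ennreal (heat_kernel s (x - y)) * f y"
        by (intro mult_right_mono ennreal_leI heat_kernel_lower_bound[OF t s x]) auto
      then show ?thesis using True by simp
    qed simp
  qed
  finally show ?thesis .
qed

text \<open>The flow is at least a multiple of t^(-N/2) times the mass of the datum in the ball of
  radius sqrt t. The bound t < e^(-2) keeps this ball inside |x| < 1/e, and -ln(sqrt t) is half of
  -ln t.\<close>

lemma heat_nn_log_datum_lower_bound:
  assumes \<beta>: "0 < \<beta>"
  obtains c where "0 < c" "\<And>t (x::'a::euclidean_space). 0 < t \<Longrightarrow> t < exp (-2) \<Longrightarrow> norm x \<le> sqrt t \<Longrightarrow>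
    ennreal (c * t powr (- real DIM('a) / 2) * (- ln t) powr (- \<beta>)) \<le> heat_nn t (\<lambda>y. ennreal (log_datum \<beta> y)) x"
proof -
  define k where "k = (4 * pi) powr (- real DIM('a) / 2) * exp (-2)"
  define w where "w = real DIM('a) * unit_ball_vol (real DIM('a))"
  have kw: "0 < k" "0 < w" by (auto simp: k_def w_def)
  show ?thesis
  proof (rule that[of "k * w * (1/2) powr (- \<beta>) / \<beta>"])
    show "0 < k * w * (1/2) powr (- \<beta>) / \<beta>" using kw \<beta> by simp
    fix t :: real and x :: 'a
    assume t: "0 < t" "t < exp (-2)" and x: "norm x \<le> sqrt t"
    have "sqrt t < sqrt (exp (-2))" using t by (intro real_sqrt_less_mono)
    also have "\<dots> = exp (-1)" by (rule real_sqrt_unique) (auto simp: power2_eq_square mult_exp_exp)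
    finally have r: "0 < sqrt t" "sqrt t < exp (-1)" using t by auto
    then have r1: "sqrt t < 1" using exp_le_one_iff[of "-1::real"] by linarith
    have "ennreal (k * w * (1/2) powr (- \<beta>) / \<beta> * t powr (- real DIM('a) / 2) * (- ln t) powr (- \<beta>)) =
       ennreal (k * t powr (- real DIM('a) / 2)) * ennreal (w * ((- ln (sqrt t)) powr (- \<beta>) / \<beta>))"
    proof -
      have "- ln (sqrt t) = (1/2) * (- ln t)" using t by (simp add: ln_sqrt)
      then have "(- ln (sqrt t)) powr (- \<beta>) = (1/2) powr (- \<beta>) * (- ln t) powr (- \<beta>)"
        by (simp only: powr_mult)
      then show ?thesis using kw \<beta> by (simp add: ennreal_mult[symmetric] mult_ac)
    qed
    also have "ennreal (w * ((- ln (sqrt t)) powr (- \<beta>) / \<beta>)) =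
      (\<integral>\<^sup>+ y. indicator (ball (0::'a) (sqrt t)) y * ennreal (norm y powr (- real DIM('a)) * (- ln (norm y)) powr (- \<beta> - 1)) \<partial>lborel)"
      unfolding w_def by (rule nn_integral_radial_log[OF r(1) r1 \<beta>, symmetric])
    also have "\<dots> = (\<integral>\<^sup>+ y. indicator (ball (0::'a) (sqrt t)) y * ennreal (log_datum \<beta> y) \<partial>lborel)"
      using r by (intro nn_integral_cong) (auto simp: log_datum_def split: split_indicator)
    also have "ennreal (k * t powr (- real DIM('a) / 2)) * \<dots> \<le> heat_nn t (\<lambda>y. ennreal (log_datum \<beta> y)) x"
      unfolding k_def using t x by (intro heat_nn_lower_bound) auto
    finally show "ennreal (k * w * (1/2) powr (- \<beta>) / \<beta> * t powr (- real DIM('a) / 2) * (- ln t) powr (- \<beta>))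
      \<le> heat_nn t (\<lambda>y. ennreal (log_datum \<beta> y)) x" .
  qed
qed

section \<open>Lower bounds for nonnegative integral solutions\<close>

text \<open>Completeness: every subset of the exceptional null set is measurable. It serves for time
  slices of a solution, about which only joint measurability is assumed.\<close>

lemma borel_measurable_lebesgue_cong_AE:
  fixes f g :: "'a::euclidean_space \<Rightarrow> real"
  assumes g [measurable]: "g \<in> borel_measurable lebesgue" and ae: "AE x in lborel. f x = g x"
  shows "f \<in> borel_measurable lebesgue"
proof (rule measurableI)
  fix A :: "real set" assume [measurable]: "A \<in> sets borel"
  have [measurable]: "Measurable.pred lebesgue (\<lambda>x. f x \<noteq> g x)"
    "Measurable.pred lebesgue (\<lambda>x. f x \<in> A \<and> f x \<noteq> g x)"
    using ae by (auto intro!: sets_completion_AE elim: eventually_mono)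
  have "Measurable.pred lebesgue (\<lambda>x. (g x \<in> A \<and> \<not> f x \<noteq> g x) \<or> (f x \<in> A \<and> f x \<noteq> g x))" by measurable
  then have "{x \<in> space lebesgue. (g x \<in> A \<and> \<not> f x \<noteq> g x) \<or> (f x \<in> A \<and> f x \<noteq> g x)} \<in> sets lebesgue"
    by (simp only: pred_def)
  moreover have "{x \<in> space lebesgue. (g x \<in> A \<and> \<not> f x \<noteq> g x) \<or> (f x \<in> A \<and> f x \<noteq> g x)} = f -` A \<inter> space lebesgue"
    by auto
  ultimately show "f -` A \<inter> space lebesgue \<in> sets lebesgue" by simp
qed auto

text \<open>Any minorant \<open>l\<close> of the solution can be fed into the Duhamel term. The
  premise \<open>0 < l (s, y)\<close> allows \<open>l\<close> to be 0 wherever nothing is known;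
  \<open>l = 0\<close> gives back the linear flow.\<close>

lemma integral_solution_lower_bound:
  fixes \<phi> :: "'a::euclidean_space \<Rightarrow> real" and l :: "real \<times> 'a \<Rightarrow> real"
  assumes sol: "integral_solution p \<phi> T u" and nn: "nonneg_on T u" and p: "0 \<le> p"
    and \<phi>: "\<phi> \<in> borel_measurable borel" "\<And>x. 0 \<le> \<phi> x"
    and [measurable]: "l \<in> borel_measurable borel" and l0: "\<And>z. 0 \<le> l z"
    and l: "\<And>s. 0 < s \<Longrightarrow> s < T \<Longrightarrow> AE y in lebesgue. 0 < l (s, y) \<longrightarrow> l (s, y) \<le> u s y"
    and t: "0 < t" "t < T"
  shows "AE x in lebesgue. heat_nn t (\<lambda>y. ennreal (\<phi> y)) x +
     (\<integral>\<^sup>+ z. ennreal (duhamel_kernel t x z) * ennreal (l z powr p) \<partial>lborel) \<le> ennreal (u t x)"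
proof -
  note \<phi>(1) [measurable]
  \<comment> \<open>The solution is only Lebesgue measurable and nonnegative only almost everywhere
    on space-time; \<open>v\<close> is a Borel representative, equal to it on almost every time
    slice.\<close>
  define u' where "u' z = indicator ({0<..<T} \<times> UNIV) z *\<^sub>R u (fst z) (snd z)" for z :: "real \<times> 'a"
  have "u' \<in> borel_measurable lebesgue"
    using sol by (simp add: integral_solution_def set_borel_measurable_def u'_def[abs_def])
  then obtain v where "v \<in> borel_measurable lborel" and ae: "AE z in lborel. u' z = v z"
    using completion_ex_borel_measurable_real[of u' lborel] by auto
  then have v [measurable]: "v \<in> borel_measurable borel" by simp
  have vm [measurable]: "(\<lambda>y. v (s, y)) \<in> borel_measurable borel" for s
    by (rule measurable_compose[OF _ v]) (simp add: borel_prod[symmetric])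
  have uv: "AE z in lborel. 0 < fst z \<and> fst z < T \<longrightarrow> u (fst z) (snd z) = v z"
    using ae by eventually_elim (auto simp: u'_def indicator_def mem_Times_iff)
  have uv_s: "AE s in lborel. AE y in lborel. 0 < s \<and> s < T \<longrightarrow> u s y = v (s, y)"
  proof -
    have "AE z in lborel \<Otimes>\<^sub>M lborel. 0 < fst z \<and> fst z < T \<longrightarrow> u (fst z) (snd z) = v z"
      unfolding lborel_prod by (rule uv)
    from lborel_pair.AE_pair[OF this] show ?thesis by (simp only: fst_conv snd_conv)
  qed
  have v0: "AE z in lborel. 0 < fst z \<and> fst z < T \<longrightarrow> 0 \<le> v z"
  proof -
    have "AE z in lborel. z \<in> {0<..<T} \<times> UNIV \<longrightarrow> 0 \<le> u (fst z) (snd z :: 'a)"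
      using nn unfolding nonneg_on_def AE_completion_iff .
    with uv show ?thesis by eventually_elim (auto simp: mem_Times_iff)
  qed
  \<comment> \<open>From slices to space-time: Fubini needs the exceptional set to be measurable,
    which it is for \<open>v\<close>.\<close>
  have lv: "AE z in lborel. 0 < fst z \<and> fst z < T \<longrightarrow> 0 < l z \<longrightarrow> l z \<le> v z"
    unfolding lborel_prod[symmetric]
  proof (rule lborel_pair.AE_pair_measure)
    have [measurable]: "l \<in> borel_measurable (borel \<Otimes>\<^sub>M borel)" "v \<in> borel_measurable (borel \<Otimes>\<^sub>M borel)"
      by (simp_all add: borel_prod)
    show "{z \<in> space (lborel \<Otimes>\<^sub>M lborel). 0 < fst z \<and> fst z < T \<longrightarrow> 0 < l z \<longrightarrow> l z \<le> v z} \<in> sets (lborel \<Otimes>\<^sub>M lborel)"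
      by measurable
    show "AE s in lborel. AE y in lborel. 0 < fst (s, y) \<and> fst (s, y) < T \<longrightarrow> 0 < l (s, y) \<longrightarrow> l (s, y) \<le> v (s, y)"
      using uv_s
    proof eventually_elim
      case (elim s)
      show ?case
      proof (cases "0 < s \<and> s < T")
        case True
        then have "AE y in lborel. 0 < l (s, y) \<longrightarrow> l (s, y) \<le> u s y"
          using l[of s] unfolding AE_completion_iff by simp
        with elim show ?thesis by eventually_elim (use True in auto)
      qed (auto simp: not_less)
    qed
  qed
  have "AE x in lebesgue. integrable lebesgue (\<lambda>y. heat_kernel t (x - y) * \<phi> y) \<and>
        integrable lebesgue (\<lambda>z::real \<times> 'a. indicator {0<..<t} (fst z) *
             heat_kernel (t - fst z) (x - snd z) * fnl p (u (fst z) (snd z))) \<and>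
        u t x = duhamel p \<phi> u t x"
    using sol t unfolding integral_solution_def by auto
  then show ?thesis
  proof eventually_elim
    case (elim x)
    have i1: "integrable lborel (\<lambda>y. heat_kernel t (x - y) * \<phi> y)"
      using elim by (subst (asm) integrable_completion) auto
    have eqz: "AE z in lborel. indicator {0<..<t} (fst z) * heat_kernel (t - fst z) (x - snd z) * fnl p (u (fst z) (snd z))
      = duhamel_kernel t x z * fnl p (v z)"
      using uv by eventually_elim (use t in \<open>auto simp: duhamel_kernel_def indicator_def\<close>)
    have "integrable lebesgue (\<lambda>z. duhamel_kernel t x z * fnl p (v z))"
    proof (rule integrable_cong_AE_imp)
      show "(\<lambda>z. duhamel_kernel t x z * fnl p (v z)) \<in> borel_measurable lebesgue"
        by (rule measurable_completion) measurable
    qed (use elim AE_completion[OF eqz] in auto)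
    then have i2: "integrable lborel (\<lambda>z. duhamel_kernel t x z * fnl p (v z))"
      by (subst (asm) integrable_completion) auto
    \<comment> \<open>On almost every slice \<open>u\<close> and \<open>v\<close> agree almost
      everywhere, so the Duhamel term is unchanged.\<close>
    have "(\<integral> s. indicator {0<..<t} s * heat_sg (t - s) (\<lambda>y. fnl p (u s y)) x \<partial>lebesgue) =
      (\<integral> s. indicator {0<..<t} s * heat_sg (t - s) (\<lambda>y. fnl p (v (s, y))) x \<partial>lebesgue)"
    proof -
      have ae_s: "AE s in lborel. indicator {0<..<t} s * heat_sg (t - s) (\<lambda>y. fnl p (u s y)) x =
          indicator {0<..<t} s * heat_sg (t - s) (\<lambda>y. fnl p (v (s, y))) x"
        using uv_s
      proof eventually_elim
        case (elim s)
        show ?case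
        proof (cases "s \<in> {0<..<t}")
          case True
          have vl: "(\<lambda>y. fnl p (v (s, y))) \<in> borel_measurable lebesgue"
            by (rule measurable_completion) measurable
          have ae_y: "AE y in lborel. fnl p (u s y) = fnl p (v (s, y))"
            using elim by eventually_elim (use True t in auto)
          have "heat_sg (t - s) (\<lambda>y. fnl p (u s y)) x = heat_sg (t - s) (\<lambda>y. fnl p (v (s, y))) x"
            by (rule heat_sg_cong_AE(1)[OF borel_measurable_lebesgue_cong_AE[OF vl ae_y] vl AE_completion[OF ae_y]])
          then show ?thesis by simp
        qed simp
      qed
      have gm: "(\<lambda>s. indicator {0<..<t} s * heat_sg (t - s) (\<lambda>y. fnl p (v (s, y))) x) \<in> borel_measurable lebesgue"
      proof (rule measurable_completion)
        have [measurable]: "v \<in> borel_measurable (borel \<Otimes>\<^sub>M borel)" by (simp add: borel_prod)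
        have "(\<lambda>s. heat_sg (t - s) (\<lambda>y. fnl p (v (s, y))) x) =
          (\<lambda>s. \<integral> y. heat_kernel (t - s) (x - y) * fnl p (v (s, y)) \<partial>lborel)"
          by (simp add: heat_sg_lborel)
        also have "\<dots> \<in> borel_measurable lborel" by measurable
        finally have [measurable]: "(\<lambda>s. heat_sg (t - s) (\<lambda>y. fnl p (v (s, y))) x) \<in> borel_measurable lborel" .
        show "(\<lambda>s. indicator {0<..<t} s * heat_sg (t - s) (\<lambda>y. fnl p (v (s, y))) x) \<in> borel_measurable lborel"
          by measurable
      qed
      show ?thesis
        by (rule integral_cong_AE[OF borel_measurable_lebesgue_cong_AE[OF gm ae_s] gm AE_completion[OF ae_s]])
    qed
    then have "duhamel p \<phi> u t x = duhamel p \<phi> (\<lambda>s y. v (s, y)) t x"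
      by (simp add: duhamel_def)
    also have "\<dots> = heat_sg t \<phi> x + (\<integral> z. duhamel_kernel t x z * fnl p (v z) \<partial>lborel)"
      by (rule duhamel_eq[OF v i2])
    finally have u_eq: "u t x = heat_sg t \<phi> x + (\<integral> z. duhamel_kernel t x z * fnl p (v z) \<partial>lborel)"
      using elim by simp
    have W0: "AE z in lborel. 0 \<le> duhamel_kernel t x z * fnl p (v z)"
      using v0
    proof eventually_elim
      case (elim z)
      then show ?case using t by (cases "fst z \<in> {0<..<t}") (auto simp: fnl_nonneg duhamel_kernel_eq_0)
    qed
    have "ennreal (heat_sg t \<phi> x) = heat_nn t (\<lambda>y. ennreal (\<phi> y)) x"
      unfolding heat_sg_lborel[OF \<phi>(1)] heat_nn_def
      using \<phi>(2) by (subst nn_integral_eq_integral[OF i1, symmetric]) (auto simp: ennreal_mult)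
    moreover have "ennreal (\<integral> z. duhamel_kernel t x z * fnl p (v z) \<partial>lborel) =
      (\<integral>\<^sup>+ z. ennreal (duhamel_kernel t x z * fnl p (v z)) \<partial>lborel)"
      by (rule nn_integral_eq_integral[OF i2 W0, symmetric])
    moreover have "(\<integral>\<^sup>+ z. ennreal (duhamel_kernel t x z) * ennreal (l z powr p) \<partial>lborel) \<le>
      (\<integral>\<^sup>+ z. ennreal (duhamel_kernel t x z * fnl p (v z)) \<partial>lborel)"
    proof (rule nn_integral_mono_AE)
      show "AE z in lborel. ennreal (duhamel_kernel t x z) * ennreal (l z powr p) \<le> ennreal (duhamel_kernel t x z * fnl p (v z))"
        using v0 lv
      proof eventually_elim
        case (elim z)
        show ?case
        proof (cases "fst z \<in> {0<..<t}")
          case True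
          then have "0 \<le> v z" "0 < l z \<longrightarrow> l z \<le> v z" using elim t by auto
          then have "l z powr p \<le> fnl p (v z)"
            using l0[of z] p by (cases "l z = 0") (auto simp: fnl_nonneg intro!: powr_mono2)
          then show ?thesis by (simp add: ennreal_mult[symmetric] ennreal_leI mult_left_mono)
        qed (simp add: duhamel_kernel_eq_0)
      qed
    qed
    moreover have "0 \<le> heat_sg t \<phi> x" by (rule heat_sg_nonneg) (use \<phi> in auto)
    moreover have "0 \<le> (\<integral> z. duhamel_kernel t x z * fnl p (v z) \<partial>lborel)"
      using W0 by (rule integral_nonneg_AE)
    ultimately show ?case unfolding u_eq by (simp add: add_left_mono)
  qed
qed

section \<open>Nonexistence\<close>

context
  fixes \<beta> p T :: real and u :: "real \<Rightarrow> 'a::euclidean_space \<Rightarrow> real"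
  assumes \<beta>: "0 < \<beta>" and p: "p = 1 + 2 / real DIM('a)"
    and sol: "integral_solution p (log_datum \<beta>) T u" and nn: "nonneg_on T u"
begin

text \<open>Only the exponent is tracked; \<open>c\<close> and \<tau> may shrink at every step. The
  condition \<tau> <= e^(-2) keeps -ln t above 2.\<close>

definition parabolic_bound :: "real \<Rightarrow> bool" where
  "parabolic_bound e \<longleftrightarrow> (\<exists>c \<tau>. 0 < c \<and> 0 < \<tau> \<and> \<tau> \<le> T \<and> \<tau> \<le> exp (-2) \<and>
     (\<forall>t. 0 < t \<longrightarrow> t < \<tau> \<longrightarrow> (AE x in lebesgue. norm x \<le> sqrt t \<longrightarrow>
        c * t powr (- real DIM('a) / 2) * (- ln t) powr e \<le> u t x)))"

lemma T_pos: "0 < T"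
  using sol by (simp add: integral_solution_def)

lemma parabolic_bound_initial: "parabolic_bound (- \<beta>)"
proof -
  obtain c where c: "0 < c" "\<And>t (x::'a). 0 < t \<Longrightarrow> t < exp (-2) \<Longrightarrow> norm x \<le> sqrt t \<Longrightarrow>
    ennreal (c * t powr (- real DIM('a) / 2) * (- ln t) powr (- \<beta>)) \<le> heat_nn t (\<lambda>y. ennreal (log_datum \<beta> y)) x"
    using heat_nn_log_datum_lower_bound[OF \<beta>] by blast
  show ?thesis
    unfolding parabolic_bound_def
  proof (rule exI[of _ c], rule exI[of _ "min T (exp (-2))"], intro conjI allI impI)
    fix t assume t: "0 < t" "t < min T (exp (-2))"
    \<comment> \<open>The minorant is 0 here, so the solution is compared with the linear flow
      alone.\<close>
    have "AE x in lebesgue. heat_nn t (\<lambda>y. ennreal (log_datum \<beta> y)) x +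
       (\<integral>\<^sup>+ z. ennreal (duhamel_kernel t x z) * ennreal (0 powr p) \<partial>lborel) \<le> ennreal (u t x)"
      by (rule integral_solution_lower_bound[OF sol nn]) (use t p in \<open>auto intro: log_datum_nonneg\<close>)
    then show "AE x in lebesgue. norm x \<le> sqrt t \<longrightarrow> c * t powr (- real DIM('a) / 2) * (- ln t) powr (- \<beta>) \<le> u t x"
    proof eventually_elim
      case (elim x)
      show ?case
      proof
        assume x: "norm x \<le> sqrt t"
        have "ennreal (c * t powr (- real DIM('a) / 2) * (- ln t) powr (- \<beta>)) \<le> heat_nn t (\<lambda>y. ennreal (log_datum \<beta> y)) x"
          using t x by (intro c(2)) auto
        also have "\<dots> \<le> ennreal (u t x)" using elim by simp
        finally have le: "ennreal (c * t powr (- real DIM('a) / 2) * (- ln t) powr (- \<beta>)) \<le> ennreal (u t x)" .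
        \<comment> \<open>\<open>ennreal\<close> sends negative reals to 0; strict positivity of the
          left side is what allows the return to a real inequality.\<close>
        have "t < 1" using t exp_le_one_iff[of "-2::real"] by linarith
        then have "0 < c * t powr (- real DIM('a) / 2) * (- ln t) powr (- \<beta>)" using c(1) t by simp
        then show "c * t powr (- real DIM('a) / 2) * (- ln t) powr (- \<beta>) \<le> u t x"
          using le by (simp add: ennreal_le_iff2)
      qed
    qed
  qed (use c T_pos in auto)
qed

text \<open>The p-th power of the bound is s^(-Np/2) (-ln s)^(pe), and the ball of radius sqrt s
  contributes the volume s^(N/2). As Np/2 = N/2 + 1, exactly 1/s remains. Restricting to s < t/2
  keeps t - s between t/2 and t, where the kernel bound applies.\<close>

lemma parabolic_bound_duhamel:
  assumes "parabolic_bound e"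
  obtains k \<tau> where "0 < k" "0 < \<tau>" "\<tau> \<le> T" "\<tau> \<le> exp (-2)"
    "\<And>t. 0 < t \<Longrightarrow> t < \<tau> \<Longrightarrow> AE x in lebesgue. norm x \<le> sqrt t \<longrightarrow>
      ennreal (k * t powr (- real DIM('a) / 2)) *
        (\<integral>\<^sup>+ s. indicator {0<..<t/2} s * ennreal (s powr (-1) * (- ln s) powr (p * e)) \<partial>lborel) \<le> ennreal (u t x)"
proof -
  define N where "N = real DIM('a)"
  have N: "0 < N" by (simp add: N_def)
  have p0: "0 < p" using N by (simp add: p N_def add_pos_nonneg)
  obtain c \<tau> where c: "0 < c" and \<tau>: "0 < \<tau>" "\<tau> \<le> T" "\<tau> \<le> exp (-2)"
    and b: "\<And>t. 0 < t \<Longrightarrow> t < \<tau> \<Longrightarrow> AE x in lebesgue. norm x \<le> sqrt t \<longrightarrow> c * t powr (- N / 2) * (- ln t) powr e \<le> u t x"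
    using assms unfolding parabolic_bound_def N_def by blast
  define l where "l z = (if 0 < fst z \<and> fst z < \<tau> \<and> norm (snd z) \<le> sqrt (fst z)
     then c * fst z powr (- N / 2) * (- ln (fst z)) powr e else 0)" for z :: "real \<times> 'a"
  have [measurable]: "l \<in> borel_measurable borel" unfolding l_def[abs_def] by measurable
  have l0: "0 \<le> l z" for z using c by (simp add: l_def)
  have lu: "AE y in lebesgue. 0 < l (s, y) \<longrightarrow> l (s, y) \<le> u s y" if "0 < s" for s
  proof (cases "s < \<tau>")
    case True
    show ?thesis using b[OF that True] by eventually_elim (auto simp: l_def)
  qed (simp add: l_def)
  define w where "w = unit_ball_vol N"
  define g where "g = (4 * pi) powr (- N / 2) * exp (-2)"
  have w: "0 < w" using N by (simp add: w_def)
  have g: "0 < g" by (simp add: g_def)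
  define k where "k = g * c powr p * w"
  show ?thesis
  proof (rule that[of k \<tau>])
    show "0 < k" using w g c by (simp add: k_def)
    fix t assume t: "0 < t" "t < \<tau>"
    have "t < T" using t \<tau> by simp
    have "AE x in lebesgue. heat_nn t (\<lambda>y. ennreal (log_datum \<beta> y)) x +
       (\<integral>\<^sup>+ z. ennreal (duhamel_kernel t x z) * ennreal (l z powr p) \<partial>lborel) \<le> ennreal (u t x)"
      using p0 t \<open>t < T\<close> lu
      by (intro integral_solution_lower_bound[OF sol nn]) (auto intro: log_datum_nonneg l0)
    then show "AE x in lebesgue. norm x \<le> sqrt t \<longrightarrow>
      ennreal (k * t powr (- real DIM('a) / 2)) *
        (\<integral>\<^sup>+ s. indicator {0<..<t/2} s * ennreal (s powr (-1) * (- ln s) powr (p * e)) \<partial>lborel) \<le> ennreal (u t x)"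
    proof eventually_elim
      case (elim x)
      show ?case
      proof
        assume x: "norm x \<le> sqrt t"
        have "ennreal (k * t powr (- N / 2)) *
            (\<integral>\<^sup>+ s. indicator {0<..<t/2} s * ennreal (s powr (-1) * (- ln s) powr (p * e)) \<partial>lborel)
          = (\<integral>\<^sup>+ s. ennreal (k * t powr (- N / 2)) * (indicator {0<..<t/2} s * ennreal (s powr (-1) * (- ln s) powr (p * e))) \<partial>lborel)"
          by (rule nn_integral_cmult[symmetric]) measurable
        also have "\<dots> \<le> (\<integral>\<^sup>+ s. indicator {0<..<t} s * heat_nn (t - s) (\<lambda>y. ennreal (l (s, y) powr p)) x \<partial>lborel)"
        proof (rule nn_integral_mono)
          fix s :: real
          show "ennreal (k * t powr (- N / 2)) * (indicator {0<..<t/2} s * ennreal (s powr (-1) * (- ln s) powr (p * e)))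
            \<le> indicator {0<..<t} s * heat_nn (t - s) (\<lambda>y. ennreal (l (s, y) powr p)) x"
          proof (cases "0 < s \<and> s < t/2")
            case True
            define m where "m = (c * s powr (- N / 2) * (- ln s) powr e) powr p"
            have [measurable]: "(\<lambda>y. l (s, y)) \<in> borel_measurable borel" unfolding l_def fst_conv snd_conv by measurable
            have "(\<integral>\<^sup>+ y. indicator (cball 0 (sqrt s)) y * ennreal (l (s, y) powr p) \<partial>lborel)
              = (\<integral>\<^sup>+ y. ennreal m * indicator (cball (0::'a) (sqrt s)) y \<partial>lborel)"
              using True t by (intro nn_integral_cong) (auto simp: l_def m_def split: split_indicator)
            also have "\<dots> = ennreal m * ennreal (w * sqrt s ^ DIM('a))"
              using True by (subst nn_integral_cmult_indicator) (auto simp: emeasure_cball w_def N_def)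
            also have "\<dots> = ennreal (m * (w * s powr (N / 2)))"
            proof -
              have "sqrt s ^ DIM('a) = (s powr (1/2)) powr N"
                using True by (simp add: powr_half_sqrt N_def powr_realpow)
              also have "\<dots> = s powr (N / 2)" by (simp add: powr_powr)
              finally show ?thesis using w by (simp add: ennreal_mult[symmetric] m_def)
            qed
            finally have vol: "(\<integral>\<^sup>+ y. indicator (cball 0 (sqrt s)) y * ennreal (l (s, y) powr p) \<partial>lborel)
              = ennreal (m * (w * s powr (N / 2)))" .
            have "cball 0 (sqrt s) \<subseteq> cball (0::'a) (sqrt t)"
              using True by (intro subset_cball real_sqrt_le_mono) simp
            then have "ennreal (g * t powr (- N / 2)) * ennreal (m * (w * s powr (N / 2)))
               \<le> heat_nn (t - s) (\<lambda>y. ennreal (l (s, y) powr p)) x"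
              unfolding vol[symmetric] unfolding g_def N_def
              using True t x by (intro heat_nn_lower_bound) auto
            moreover have "ennreal (k * t powr (- N / 2)) * ennreal (s powr (-1) * (- ln s) powr (p * e))
               = ennreal (g * t powr (- N / 2)) * ennreal (m * (w * s powr (N / 2)))"
            proof -
              have "m = c powr p * ((s powr (- N / 2)) powr p * ((- ln s) powr e) powr p)"
                unfolding m_def by (simp only: powr_mult mult.assoc)
              also have "\<dots> = c powr p * (s powr (- N / 2 * p) * (- ln s) powr (p * e))"
                by (simp add: powr_powr mult.commute)
              also have "- N / 2 * p = - N / 2 - 1" using N by (simp add: p N_def[symmetric] field_simps)
              finally have "m * (w * s powr (N / 2)) = c powr p * w * ((s powr (- N / 2 - 1) * s powr (N / 2)) * (- ln s) powr (p * e))"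
                by (simp add: mult_ac)
              also have "s powr (- N / 2 - 1) * s powr (N / 2) = s powr (-1)" by (simp flip: powr_add)
              finally show ?thesis
                using g w c by (simp add: k_def ennreal_mult[symmetric] mult_ac)
            qed
            ultimately show ?thesis using True t by simp
          qed auto
        qed
        also have "\<dots> = (\<integral>\<^sup>+ z. ennreal (duhamel_kernel t x z) * ennreal (l z powr p) \<partial>lborel)"
          by (rule nn_integral_duhamel_kernel[symmetric]) measurable
        also have "\<dots> \<le> heat_nn t (\<lambda>y. ennreal (log_datum \<beta> y)) x + \<dots>"
          by (intro add_increasing) auto
        also have "\<dots> \<le> ennreal (u t x)" by (rule elim)
        finally show "ennreal (k * t powr (- real DIM('a) / 2)) *
          (\<integral>\<^sup>+ s. indicator {0<..<t/2} s * ennreal (s powr (-1) * (- ln s) powr (p * e)) \<partial>lborel) \<le> ennreal (u t x)"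
          by (simp add: N_def)
      qed
    qed
  qed (use \<tau> in auto)
qed

text \<open>With p e = -q - 1 and q > 0 the time integral is (-ln(t/2))^(-q)/q. Since -ln(t/2) <=
  2(-ln t), returning to \<open>t\<close> costs only the factor 2^(-q).\<close>

lemma parabolic_bound_step:
  assumes b: "parabolic_bound e" and e: "p * e < - 1"
  shows "parabolic_bound (p * e + 1)"
proof -
  define N where "N = real DIM('a)"
  define q where "q = - (p * e + 1)"
  have q: "0 < q" using e by (simp add: q_def)
  obtain k \<tau> where k: "0 < k" and \<tau>: "0 < \<tau>" "\<tau> \<le> T" "\<tau> \<le> exp (-2)" and
    low: "\<And>t. 0 < t \<Longrightarrow> t < \<tau> \<Longrightarrow> AE x in lebesgue. norm x \<le> sqrt t \<longrightarrow>
      ennreal (k * t powr (- N / 2)) *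
        (\<integral>\<^sup>+ s. indicator {0<..<t/2} s * ennreal (s powr (-1) * (- ln s) powr (p * e)) \<partial>lborel) \<le> ennreal (u t x)"
    using parabolic_bound_duhamel[OF b] unfolding N_def by blast
  have pe: "p * e = - q - 1" by (simp add: q_def)
  show ?thesis
    unfolding parabolic_bound_def
  proof (rule exI[of _ "k * 2 powr (- q) / q"], rule exI[of _ \<tau>], intro conjI allI impI)
    show "0 < k * 2 powr (- q) / q" using k q by simp
    fix t assume t: "0 < t" "t < \<tau>"
    have lt: "ln t < - 2" using ln_less_cancel_iff[of t "exp (-2)"] t \<tau> by auto
    have t1: "t < 1" using t \<tau> exp_le_one_iff[of "-2::real"] by linarith
    have pos: "0 < k * 2 powr (- q) / q * t powr (- N / 2) * (- ln t) powr (p * e + 1)"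
      using k q t lt t1 by simp
    have le: "ennreal (k * 2 powr (- q) / q * t powr (- N / 2) * (- ln t) powr (p * e + 1)) \<le>
       ennreal (k * t powr (- N / 2)) *
        (\<integral>\<^sup>+ s. indicator {0<..<t/2} s * ennreal (s powr (-1) * (- ln s) powr (p * e)) \<partial>lborel)"
    proof -
      have "ln (2::real) \<le> 1" using ln_le_minus_one[of "2::real"] by simp
      moreover have "ln (t / 2) = ln t - ln 2" using t by (simp add: ln_div)
      ultimately have "- ln (t / 2) \<le> 2 * (- ln t)" "0 < - ln (t / 2)" using lt ln_gt_zero[of "2::real"] by linarith+
      then have "(2 * (- ln t)) powr (- q) \<le> (- ln (t / 2)) powr (- q)" using q by (intro powr_mono2') auto
      moreover have "(2 * (- ln t)) powr (- q) = 2 powr (- q) * (- ln t) powr (- q)" by (rule powr_mult)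
      moreover have "p * e + 1 = - q" by (simp add: q_def)
      ultimately have "2 powr (- q) / q * (- ln t) powr (p * e + 1) \<le> (- ln (t / 2)) powr (- q) / q"
        using q by (simp add: divide_right_mono)
      then have "k * t powr (- N / 2) * (2 powr (- q) / q * (- ln t) powr (p * e + 1)) \<le> k * t powr (- N / 2) * ((- ln (t / 2)) powr (- q) / q)"
        using k by (intro mult_left_mono) auto
      moreover have "(\<integral>\<^sup>+ s. indicator {0<..<t/2} s * ennreal (s powr (-1) * (- ln s) powr (p * e)) \<partial>lborel) = ennreal ((- ln (t/2)) powr (- q) / q)"
        unfolding pe using t t1 q by (intro nn_integral_inverse_log_powr) auto
      ultimately show ?thesis using k q by (simp add: ennreal_mult[symmetric] ennreal_leI mult_ac)
    qed
    show "AE x in lebesgue. norm x \<le> sqrt t \<longrightarrow> k * 2 powr (- q) / q * t powr (- real DIM('a) / 2) * (- ln t) powr (p * e + 1) \<le> u t x"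
      using low[OF t]
    proof eventually_elim
      case (elim x)
      show ?case
      proof
        assume "norm x \<le> sqrt t"
        with elim le have "ennreal (k * 2 powr (- q) / q * t powr (- N / 2) * (- ln t) powr (p * e + 1)) \<le> ennreal (u t x)"
          by (meson order_trans)
        then show "k * 2 powr (- q) / q * t powr (- real DIM('a) / 2) * (- ln t) powr (p * e + 1) \<le> u t x"
          using pos by (simp add: ennreal_le_iff2 N_def)
      qed
    qed
  qed (use \<tau> in auto)
qed

text \<open>The time integral is infinite, by comparison with the exponents -r - 1, whose integrals
  grow like 1/r as r tends to 0. The solution would then be infinite on a ball of positive measure,
  although its values are real.\<close>

lemma parabolic_bound_blowup:
  assumes b: "parabolic_bound e" and e: "- 1 \<le> p * e"
  shows False
proof -
  define N where "N = real DIM('a)"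
  obtain k \<tau> where k: "0 < k" and \<tau>: "0 < \<tau>" "\<tau> \<le> T" "\<tau> \<le> exp (-2)" and
    low: "\<And>t. 0 < t \<Longrightarrow> t < \<tau> \<Longrightarrow> AE x in lebesgue. norm x \<le> sqrt t \<longrightarrow>
      ennreal (k * t powr (- N / 2)) *
        (\<integral>\<^sup>+ s. indicator {0<..<t/2} s * ennreal (s powr (-1) * (- ln s) powr (p * e)) \<partial>lborel) \<le> ennreal (u t x)"
    using parabolic_bound_duhamel[OF b] unfolding N_def by blast
  define t where "t = \<tau> / 2"
  have t: "0 < t" "t < \<tau>" using \<tau> by (auto simp: t_def)
  have t1: "t < 1" using t \<tau> exp_le_one_iff[of "-2::real"] by linarith
  have L: "2 < - ln s" if "0 < s" "s < t" for s
    using ln_less_cancel_iff[of s "exp (-2)"] that t \<tau> by auto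
  define I where "I = (\<integral>\<^sup>+ s. indicator {0<..<t/2} s * ennreal (s powr (-1) * (- ln s) powr (p * e)) \<partial>lborel)"
  have I: "ennreal ((- ln (t/2)) powr (- 1) / r) \<le> I" if r: "0 < r" "r \<le> 1" for r
  proof -
    have "ennreal ((- ln (t/2)) powr (- 1) / r) \<le> ennreal ((- ln (t/2)) powr (- r) / r)"
      using L[of "t/2"] t r by (intro ennreal_leI divide_right_mono powr_mono) auto
    also have "\<dots> = (\<integral>\<^sup>+ s. indicator {0<..<t/2} s * ennreal (s powr (-1) * (- ln s) powr (- r - 1)) \<partial>lborel)"
      using t t1 r by (intro nn_integral_inverse_log_powr[symmetric]) auto
    also have "\<dots> \<le> I"
      unfolding I_def
    proof (rule nn_integral_mono)
      fix s :: real
      show "indicator {0<..<t/2} s * ennreal (s powr (-1) * (- ln s) powr (- r - 1)) \<le>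
        indicator {0<..<t/2} s * ennreal (s powr (-1) * (- ln s) powr (p * e))"
      proof (cases "0 < s \<and> s < t/2")
        case True
        have "(- ln s) powr (- r - 1) \<le> (- ln s) powr (p * e)"
          using L[of s] True t e r by (intro powr_mono) auto
        then have "ennreal (s powr (-1) * (- ln s) powr (- r - 1)) \<le> ennreal (s powr (-1) * (- ln s) powr (p * e))"
          by (intro ennreal_leI mult_left_mono) auto
        then show ?thesis by (rule mult_left_mono) simp
      qed auto
    qed
    finally show ?thesis .
  qed
  have "I = top"
  proof (rule ccontr)
    assume "I \<noteq> top"
    then obtain i where i: "I = ennreal i" "0 \<le> i" by (cases I) auto
    define m where "m = (- ln (t/2)) powr (- 1)"
    have m: "0 < m" using L[of "t/2"] t t1 by (simp add: m_def)
    \<comment> \<open>Small enough that the lower bound m/r is at least i + 1, which exceeds the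
      supposed value i.\<close>
    define r where "r = min 1 (m / (i + 1))"
    have r: "0 < r" "r \<le> 1" "r \<le> m / (i + 1)" using m i by (auto simp: r_def)
    have "m / r \<le> i" using I[OF r(1,2)] i unfolding m_def[symmetric] by (simp add: ennreal_le_iff)
    moreover have "i + 1 \<le> m / r" using r i by (simp add: field_simps)
    ultimately show False by simp
  qed
  then have "AE x in lebesgue. \<not> norm (x::'a) \<le> sqrt t"
    using low[OF t] k t unfolding I_def[symmetric]
    by (auto elim!: eventually_mono simp: ennreal_mult_top top_unique)
  then have "AE x in lborel. x \<notin> cball (0::'a) (sqrt t)"
    unfolding AE_completion_iff by (auto elim!: eventually_mono)
  then have "cball (0::'a) (sqrt t) \<in> null_sets lborel"
    by (subst (asm) AE_iff_null_sets[symmetric]) auto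
  then show False
    using t unit_ball_vol_pos[of "real DIM('a)"] by (auto simp: null_sets_def emeasure_cball)
qed

lemma no_integral_solution:
  assumes "\<beta> < real DIM('a) / 2"
  shows False
proof -
  define N where "N = real DIM('a)"
  define \<epsilon> where "\<epsilon> = N / 2 - \<beta>"
  have N: "0 < N" and \<epsilon>: "0 < \<epsilon>" using assms by (auto simp: N_def \<epsilon>_def)
  \<comment> \<open>The identity p N/2 = N/2 + 1 gives (p e + 1) + N/2 = p (e + N/2), the geometric
    growth of the exponent.\<close>
  have p1: "1 < p" "p * (N / 2) = N / 2 + 1" using N by (auto simp: p N_def[symmetric] field_simps)
  have b: "parabolic_bound (p ^ j * \<epsilon> - N / 2)" for j
  proof (induction j)
    case 0
    then show ?case using parabolic_bound_initial by (simp add: \<epsilon>_def)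
  next
    case (Suc j)
    \<comment> \<open>If this failed, the blow-up case would already be contradictory; so the
      improvement step always applies.\<close>
    have "p * (p ^ j * \<epsilon> - N / 2) < - 1" using parabolic_bound_blowup[OF Suc] not_le_imp_less by blast
    moreover have "p * (p ^ j * \<epsilon> - N / 2) + 1 = p ^ Suc j * \<epsilon> - N / 2"
      unfolding right_diff_distrib p1(2) by simp
    ultimately show ?case using parabolic_bound_step[OF Suc] by simp
  qed
  obtain j where "N / 2 / \<epsilon> < p ^ j" using real_arch_pow[OF p1(1)] by blast
  then have "0 < p ^ j * \<epsilon> - N / 2" using \<epsilon> by (simp add: field_simps)
  then have "0 < p * (p ^ j * \<epsilon> - N / 2)" using p1 by (intro mult_pos_pos) auto
  then show False using parabolic_bound_blowup[OF b[of j]] by linarith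
qed

end

theorem theorem1p3:
  fixes N p :: real
  defines "N \<equiv> real DIM('a::euclidean_space)"
      and "p \<equiv> 1 + 2 / real DIM('a)"
  shows
   "(\<forall>q (\<phi>::'a \<Rightarrow> real). N / 2 \<le> q \<and> \<phi> \<in> X_space q \<longrightarrow>
       (\<exists>T u C. mild_solution p \<phi> T u \<and> 0 < C \<and>
          (\<forall>\<^sub>F t in at_right 0. Linf_norm (u t) \<le> C * t powr (- N / 2) * (- ln t) powr (- q))))
    \<and> (\<forall>\<phi>::'a \<Rightarrow> real. \<phi> \<in> X_space (N / 2) \<longrightarrow> (\<exists>T u. mild_solution p \<phi> T u))
    \<and> (\<forall>q. 0 \<le> q \<and> q < N / 2 \<longrightarrow>
         (\<exists>\<epsilon>. 0 < \<epsilon> \<and> \<epsilon> < N / 2 - q \<and>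
            (let \<phi>\<^sub>0 = (\<lambda>x::'a. if norm x < exp (-1)
                          then norm x powr (- N) * (- ln (norm x)) powr (- N / 2 - 1 + \<epsilon>) else 0)
             in \<phi>\<^sub>0 \<in> X_space q \<and> (\<forall>x. 0 \<le> \<phi>\<^sub>0 x)
                \<and> \<not> (\<exists>T u. integral_solution p \<phi>\<^sub>0 T u \<and> nonneg_on T u)
                \<and> \<not> (\<exists>T u. mild_solution p \<phi>\<^sub>0 T u \<and> nonneg_on T u))))"
proof -
  have ex: "\<exists>T u C. mild_solution p \<phi> T u \<and> 0 < C \<and>
      (\<forall>\<^sub>F t in at_right 0. Linf_norm (u t) \<le> C * t powr (- N / 2) * (- ln t) powr (- q))"
    if q: "N / 2 \<le> q" and \<phi>: "\<phi> \<in> X_space q" for q and \<phi> :: "'a \<Rightarrow> real"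
  proof -
    obtain T u C where u: "mild_solution p \<phi> T u" "0 < C"
      "\<And>t. 0 < t \<Longrightarrow> t < T \<Longrightarrow> Linf_norm (u t) \<le> C * t powr (- N / 2) * (- ln t) powr (- q)"
      using mild_solution_exists[OF \<phi>] q unfolding N_def p_def by blast
    then have "0 < T" by (simp add: mild_solution_def integral_solution_def)
    then have "\<forall>\<^sub>F t in at_right 0. Linf_norm (u t) \<le> C * t powr (- N / 2) * (- ln t) powr (- q)"
      using u(3) unfolding eventually_at_right_field by blast
    then show ?thesis using u(1,2) by blast
  qed
  have nonex: "\<exists>\<epsilon>. 0 < \<epsilon> \<and> \<epsilon> < N / 2 - q \<and>
            (let \<phi>\<^sub>0 = (\<lambda>x::'a. if norm x < exp (-1)
                          then norm x powr (- N) * (- ln (norm x)) powr (- N / 2 - 1 + \<epsilon>) else 0)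
             in \<phi>\<^sub>0 \<in> X_space q \<and> (\<forall>x. 0 \<le> \<phi>\<^sub>0 x)
                \<and> \<not> (\<exists>T u. integral_solution p \<phi>\<^sub>0 T u \<and> nonneg_on T u)
                \<and> \<not> (\<exists>T u. mild_solution p \<phi>\<^sub>0 T u \<and> nonneg_on T u))"
    if q: "0 \<le> q" "q < N / 2" for q
  proof -
    \<comment> \<open>Then \<beta> is the midpoint of q and N/2: \<beta> > q puts the datum in the
      space, and \<beta> < N/2 forces nonexistence.\<close>
    define \<epsilon> where "\<epsilon> = (N / 2 - q) / 2"
    define \<beta> where "\<beta> = N / 2 - \<epsilon>"
    have \<epsilon>: "0 < \<epsilon>" "\<epsilon> < N / 2 - q" and \<beta>: "0 < \<beta>" "q < \<beta>" "\<beta> < real DIM('a) / 2"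
      using q by (auto simp: \<epsilon>_def \<beta>_def N_def field_simps)
    have exponent: "- N / 2 - 1 + \<epsilon> = - \<beta> - 1" by (simp add: \<beta>_def)
    have datum: "(\<lambda>x::'a. if norm x < exp (-1)
        then norm x powr (- N) * (- ln (norm x)) powr (- N / 2 - 1 + \<epsilon>) else 0) = log_datum \<beta>"
      unfolding exponent by (rule ext) (simp add: log_datum_def N_def)
    have no_sol: "\<not> (integral_solution p (log_datum \<beta> :: 'a \<Rightarrow> real) T u \<and> nonneg_on T u)" for T u
      using no_integral_solution[OF \<beta>(1) p_def[THEN meta_eq_to_obj_eq] _ _ \<beta>(3)] by blast
    show ?thesis
    proof (intro exI[of _ \<epsilon>] conjI)
      show "let \<phi>\<^sub>0 = (\<lambda>x::'a. if norm x < exp (-1)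
                          then norm x powr (- N) * (- ln (norm x)) powr (- N / 2 - 1 + \<epsilon>) else 0)
             in \<phi>\<^sub>0 \<in> X_space q \<and> (\<forall>x. 0 \<le> \<phi>\<^sub>0 x)
                \<and> \<not> (\<exists>T u. integral_solution p \<phi>\<^sub>0 T u \<and> nonneg_on T u)
                \<and> \<not> (\<exists>T u. mild_solution p \<phi>\<^sub>0 T u \<and> nonneg_on T u)"
        unfolding datum Let_def
        using log_datum_in_X_space[OF q(1) \<beta>(2)] no_sol log_datum_nonneg
        unfolding mild_solution_def by blast
    qed (use \<epsilon> in auto)
  qed
  show ?thesis
    using ex nonex by blast
qed

end
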